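(* Assume that (A1) $j_\ast\in\mathcal J$; (A2) for every $j\in\mathcal J_-$, the rank $\gamma_j$ is constant (and positive) and $\liminf_{n\to\infty,\ p/n\to c_0}(np)^{-1}\lambda_j>0$. For a penalty $m$, consider the information criterion $$\mathrm{IC}_m(j)=n\log|\hat\Sigma_j|+np(\log 2\pi+1)+m(j),\qquad j\in\mathcal J.$$ Then $\mathrm{IC}_m$ is consistent in the asymptotic framework $n\to\infty$, $p/n\to c_0\in[0,1)$, i.e. $\hat j_\ast=\arg\min_{j\in\mathcal J}\mathrm{IC}_m(j)$ satisfies $\mathbb P(\hat j_\ast=j_\ast)\to1$, if either of the following two conditions holds (all limits being in this framework): (1) $p$ is unbounded, and (HD-1) $\lim\,(n\log p)^{-1}(m(j)-m(j_\ast))>-\gamma_j$ for all $j\in\mathcal J_-$, and (HD-2) $\lim\,p^{-1}(m(j)-m(j_\ast))>-c_0^{-1}(k_j-k_\ast)\log(1-c_0)$ for all $j\in\mathcal J_+\setminus\{j_\ast\}$; (2) $p$ is bounded, and (LS-1) $\lim\,n^{-1}(m(j)-m(j_\ast))\ge 0$ for all $j\in\mathcal J_-$, and (LS-2) $\lim\,(m(j)-m(j_\ast))=\infty$ for all $j\in\mathcal J_+\setminus\{j_\ast\}$. Here $c_0^{-1}\log(1-c_0)$ is read as $-1$ when $c_0=0$.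
   Context: Model. $Y$ is an $n\times p$ random matrix of responses, $X$ is an $n\times k$ matrix of explanatory variables with $\operatorname{rank}X=k<n$ ($k$ fixed), and $\omega=\{1,\dots,k\}$. For $j\subset\omega$, $k_j$ is the number of elements of $j$ and $X_j$ is the $n\times k_j$ matrix of the columns of $X$ indexed by $j$. $N_{n\times p}(M,\Sigma\otimes I_n)$ is the matrix normal distribution (rows independent, each with covariance $\Sigma$, mean matrix $M$). The data are generated from the true model $Y\sim N_{n\times p}(X_\ast\Theta_\ast,\Sigma_\ast\otimes I_n)$, where $j_\ast\subset\omega$, $X_\ast=X_{j_\ast}$, $k_\ast=k_{j_\ast}$, $\Theta_\ast$ is a $k_\ast\times p$ matrix and $\Sigma_\ast$ is a $p\times p$ positive definite matrix. $\mathcal J\subset 2^\omega$ is the set of candidate models, $\mathcal J_+=\{j\in\mathcal J\mid j_\ast\subset j\}$ and $\mathcal J_-=\{j\in\mathcal J\mid j_\ast\not\subset j\}$. $\omega,\mathcal J,j_\ast$ do not depend on $n$. $|A|$ denotes the determinant of a square matrix $A$. Estimator. $\hat\Sigma_j=\frac1nY^\top(I_n-P_j)Y$ with $P_j=X_j(X_j^\top X_j)^{-1}X_j^\top$. Noncentrality matrix. $\gamma_j$ is the rank of $\Sigma_\ast^{-1/2}\Theta_\ast^\top X_\ast^\top(I_n-P_j)X_\ast\Theta_\ast\Sigma_\ast^{-1/2}$. When $\gamma_j>0$, this matrix is written as $\Gamma_j\Gamma_j^\top$ with $\Gamma_j$ a $p\times\gamma_j$ matrix of full rank, and $\lambda_j$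 is the smallest eigenvalue of the positive definite matrix $\Gamma_j^\top\Gamma_j$ (equivalently, the smallest nonzero eigenvalue of the noncentrality matrix). Penalty. $m(j)$ is a real-valued penalty term that may depend on $n$ and $p$; if it depends on the data, the limits in the conditions on $m$ are understood in probability. Asymptotic framework. $p=p(n)$ is a nondecreasing function of $n$ (bounded or divergent), $n\to\infty$, and $c_{n,p}=p/n\to c_0\in[0,1)$; $X,\Theta_\ast,\Sigma_\ast$ may vary with $n$. *)

theory Defs
  imports
    "HOL-Probability.Probability"
    "Jordan_Normal_Form.DL_Rank"
    "Jordan_Normal_Form.DL_Submatrix"
    "Jordan_Normal_Form.Gauss_Jordan_Elimination"
    "Jordan_Normal_Form.Spectral_Radius"
begin

text \<open>Matrices are those of the entry on Jordan normal forms, since both dimensions of the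
  response matrix vary with the sample size.\<close>

no_notation inner (infix "\<bullet>" 70)

definition inv_mat :: "real mat \<Rightarrow> real mat" where
  "inv_mat A = the (mat_inverse A)"

definition mat_rank :: "real mat \<Rightarrow> nat" where
  "mat_rank A = vec_space.rank (dim_row A) A"

definition pos_def :: "nat \<Rightarrow> real mat \<Rightarrow> bool" where
  "pos_def p A \<longleftrightarrow> A \<in> carrier_mat p p \<and> A\<^sup>T = A \<and>
     (\<forall>v \<in> carrier_vec p. v \<noteq> 0\<^sub>v p \<longrightarrow> v \<bullet> (A *\<^sub>v v) > 0)"

text \<open>\<open>A\<^sup>-\<^sup>1\<^sup>/\<^sup>2\<close> for positive definite \<open>A\<close>; the positive definite square root chosen
  here exists and is unique.\<close>

definition inv_sqrt_mat :: "real mat \<Rightarrow> real mat" where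
  "inv_sqrt_mat A = inv_mat (SOME R. pos_def (dim_row A) R \<and> R * R = A)"

text \<open>Only used for symmetric matrices of positive dimension, so that the spectrum over the reals
  is the whole spectrum and is not empty.\<close>

definition min_eigenvalue :: "real mat \<Rightarrow> real" where
  "min_eigenvalue A = Min (spectrum A)"


text \<open>Vectors in the sample space of a row are represented as functions on \<open>{..<p}\<close>, so that the
  product of Lebesgue measures can be used as reference measure.\<close>

definition mvn_density :: "nat \<Rightarrow> real vec \<Rightarrow> real mat \<Rightarrow> (nat \<Rightarrow> real) \<Rightarrow> real" where
  "mvn_density p \<mu> \<Sigma> x =
     (let d = Matrix.vec p x - \<mu>
      in exp (- (d \<bullet> (inv_mat \<Sigma> *\<^sub>v d)) / 2) / sqrt ((2 * pi) ^ p * Determinant.det \<Sigma>))"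

text \<open>\<open>Z \<sim> N\<^bsub>n\<times>p\<^esub>(B, \<Sigma> \<otimes> I\<^sub>n)\<close> for positive definite \<open>\<Sigma>\<close>.\<close>

definition matrix_normal ::
  "'a measure \<Rightarrow> nat \<Rightarrow> nat \<Rightarrow> ('a \<Rightarrow> real mat) \<Rightarrow> real mat \<Rightarrow> real mat \<Rightarrow> bool" where
  "matrix_normal M n p Z B \<Sigma> \<longleftrightarrow>
     (\<forall>x \<in> space M. Z x \<in> carrier_mat n p) \<and>
     prob_space.indep_vars M (\<lambda>_. PiM {..<p} (\<lambda>_. borel))
       (\<lambda>i x. \<lambda>a\<in>{..<p}. Z x $$ (i, a)) {..<n} \<and>
     (\<forall>i<n. distributed M (PiM {..<p} (\<lambda>_. lborel))
       (\<lambda>x. \<lambda>a\<in>{..<p}. Z x $$ (i, a))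
       (\<lambda>y. ennreal (mvn_density p (Matrix.row B i) \<Sigma> y)))"


text \<open>Explanatory variables are indexed by \<open>{..<k}\<close> instead of \<open>{1..k}\<close>.\<close>

definition sub_cols :: "real mat \<Rightarrow> nat set \<Rightarrow> real mat" where
  "sub_cols X j = submatrix X UNIV j"

definition proj_mat :: "real mat \<Rightarrow> nat set \<Rightarrow> real mat" where
  "proj_mat X j =
     sub_cols X j * inv_mat ((sub_cols X j)\<^sup>T * sub_cols X j) * (sub_cols X j)\<^sup>T"

definition Sigma_hat :: "real mat \<Rightarrow> real mat \<Rightarrow> nat set \<Rightarrow> real mat" where
  "Sigma_hat X Y j =
     (1 / real (dim_row X)) \<cdot>\<^sub>m (Y\<^sup>T * (1\<^sub>m (dim_row X) - proj_mat X j) * Y)"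

text \<open>The matrix \<open>\<Sigma>\<^sub>*\<^sup>-\<^sup>1\<^sup>/\<^sup>2 \<Theta>\<^sub>*\<^sup>T X\<^sub>*\<^sup>T (I\<^sub>n - P\<^sub>j) X\<^sub>* \<Theta>\<^sub>* \<Sigma>\<^sub>*\<^sup>-\<^sup>1\<^sup>/\<^sup>2\<close>.\<close>

definition noncentrality ::
  "real mat \<Rightarrow> nat set \<Rightarrow> real mat \<Rightarrow> real mat \<Rightarrow> nat set \<Rightarrow> real mat" where
  "noncentrality X jstar \<Theta> \<Sigma> j =
     inv_sqrt_mat \<Sigma> * \<Theta>\<^sup>T * (sub_cols X jstar)\<^sup>T * (1\<^sub>m (dim_row X) - proj_mat X j)
       * sub_cols X jstar * \<Theta> * inv_sqrt_mat \<Sigma>"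

definition full_rank_factor :: "nat \<Rightarrow> nat \<Rightarrow> real mat \<Rightarrow> real mat \<Rightarrow> bool" where
  "full_rank_factor p g A G \<longleftrightarrow> G \<in> carrier_mat p g \<and> mat_rank G = g \<and> A = G * G\<^sup>T"

definition IC :: "real mat \<Rightarrow> real mat \<Rightarrow> (nat set \<Rightarrow> real) \<Rightarrow> nat set \<Rightarrow> real" where
  "IC X Y m j =
     real (dim_row Y) * ln (Determinant.det (Sigma_hat X Y j))
       + real (dim_row Y) * real (dim_col Y) * (ln (2 * pi) + 1) + m j"


text \<open>Limit in probability of real random variables, where the limit may be infinite. For
  nonrandom sequences it is the ordinary limit in the extended reals, see \<open>plim_const_iff\<close>.\<close>

definition plim :: "(nat \<Rightarrow> 'a measure) \<Rightarrow> (nat \<Rightarrow> 'a \<Rightarrow> real) \<Rightarrow> ereal \<Rightarrow> bool" where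
  "plim M f L \<longleftrightarrow>
     (\<forall>U. open U \<and> L \<in> U \<longrightarrow>
        (\<lambda>n. measure (M n) {x \<in> space (M n). ereal (f n x) \<in> U}) \<longlonglongrightarrow> 1)"

lemma plim_const_iff:
  assumes "\<forall>\<^sub>F n in sequentially. prob_space (M n)"
  shows "plim M (\<lambda>n _. c n) L \<longleftrightarrow> (\<lambda>n. ereal (c n)) \<longlonglongrightarrow> L"
proof -
  have "(\<lambda>n. measure (M n) {x \<in> space (M n). ereal (c n) \<in> U}) \<longlonglongrightarrow> 1
          \<longleftrightarrow> (\<forall>\<^sub>F n in sequentially. ereal (c n) \<in> U)" (is "?f \<longlonglongrightarrow> 1 \<longleftrightarrow> ?E") for U
  proof
    assume "?f \<longlonglongrightarrow> 1"
    then have "\<forall>\<^sub>F n in sequentially. ?f n > 0"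
      by (rule order_tendstoD) simp
    then show ?E
      by eventually_elim (auto split: if_splits intro: ccontr)
  next
    assume ?E
    with assms have "\<forall>\<^sub>F n in sequentially. ?f n = 1"
      by eventually_elim (simp add: prob_space.prob_space)
    then show "?f \<longlonglongrightarrow> 1"
      by (rule tendsto_eventually)
  qed
  then show ?thesis
    unfolding plim_def tendsto_def by blast
qed

text \<open>\<open>c\<^sup>-\<^sup>1 log (1 - c)\<close>, continuously extended to \<open>c = 0\<close>.\<close>

definition log_ratio :: "real \<Rightarrow> real" where
  "log_ratio c = (if c = 0 then -1 else ln (1 - c) / c)"

end

theory Submission
  imports Defs
begin

text \<open>Write \<open>W\<^sub>j = Y\<^sup>T (I - P\<^sub>j) Y\<close>, so that \<open>IC\<^sub>m(j) - IC\<^sub>m(j\<^sub>*)\<close> is \<open>n ln (|W\<^sub>j| / |W\<^sub>*|)\<close> plus the difference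
  of the penalties.

  If \<open>j\<close> contains the true model, a column added to the design changes the determinant by a factor
  \<open>1 - h\<close>, where \<open>h = u \<bullet> P u\<close> for a unit vector \<open>u\<close> and the projection \<open>P\<close> onto the column space of the
  residual noise. The law of the noise is invariant under reflections, and \<open>tr P = tr P\<^sup>2 = p\<close>; this
  alone gives \<open>E h = p / N\<close> and \<open>E h\<^sup>2 = p (p + 2) / (N (N + 2))\<close>, with \<open>N\<close> the number of residual degrees
  of freedom, without any knowledge of the law of \<open>h\<close>. Chebyshev's inequality (\<open>p\<close> unbounded) or
  Markov's inequality (\<open>p\<close> bounded) then bounds \<open>n ln (|W\<^sub>j| / |W\<^sub>*|)\<close> from below.

  If \<open>j\<close> does not contain the true model, compare \<open>W\<^sub>j\<close> with \<open>W\<^sub>j\<^sub>'\<close> for \<open>j' = j \<union> j\<^sub>*\<close>. By the matrix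
  Cauchy-Schwarz inequality the ratio of determinants does not increase if \<open>Y\<close> is replaced by \<open>Y A\<close>. For
  \<open>A = \<Sigma>\<^sub>*\<^sup>-\<^sup>1\<^sup>/\<^sup>2 \<Gamma> (\<Gamma>\<^sup>T \<Gamma>)\<^sup>-\<^sup>1\<close> the signal becomes the identity matrix of size \<open>\<gamma>\<^sub>j\<close> and the noise has variance of
  order \<open>1 / \<lambda>\<^sub>j\<close>, hence the ratio is at least \<open>(1 + \<delta> p)\<close> to the power \<open>\<gamma>\<^sub>j\<close> with a constant
  \<open>\<delta> > 0\<close>.\<close>

section \<open>Symmetric matrices, determinants and projections\<close>

no_notation vec_nth (infixl "$" 90)

text \<open>The bounds on the penalty come from two expansions. If \<open>p\<close> is bounded,
  \<open>h\<close> does not concentrate and only \<open>n * h\<close> is bounded in probability, so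
  the penalty has to diverge. A model that misses part of the signal gains about
  \<open>n * \<gamma> * ln p\<close>, whereas the detour over the larger model costs at most a
  multiple of \<open>p \<le> n\<close>; this leaves \<open>- \<gamma>\<close> as the threshold on
  the scale \<open>n * ln p\<close>. Orthogonal invariance is needed for a density on matrices whose
  reference measure is an iterated product. Reflections suffice for it, since any two vectors of
  equal length are exchanged by one of them. Every logarithm presupposes a positive determinant, so
  positive definiteness of the residual Gram matrices has to hold almost surely and is part of each
  estimate. Several constants can be chosen only after the error probability
  \<open>\<epsilon>\<close>; estimates with such constants are stated at a fixed level.\<close>

abbreviation det :: "real mat \<Rightarrow> real" where "det \<equiv> Determinant.det"

section \<open>Nonnegative quadratic forms and the Cauchy-Schwarz inequality\<close>

definition psd :: "nat \<Rightarrow> real mat \<Rightarrow> bool" where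
  "psd n A \<longleftrightarrow> A \<in> carrier_mat n n \<and> A\<^sup>T = A \<and> (\<forall>v \<in> carrier_vec n. 0 \<le> v \<bullet> (A *\<^sub>v v))"

lemma pos_def_psd: "pos_def n A \<Longrightarrow> psd n A"
  unfolding pos_def_def psd_def
  by (metis less_eq_real_def mult_mat_vec_carrier scalar_prod_left_zero)

lemma scalar_prod_self_nonneg: "0 \<le> (v :: real vec) \<bullet> v"
  unfolding scalar_prod_def by (auto intro: sum_nonneg)

lemma scalar_prod_self_eq_0: "v \<in> carrier_vec n \<Longrightarrow> (v :: real vec) \<bullet> v = 0 \<longleftrightarrow> v = 0\<^sub>v n"
  unfolding scalar_prod_def by (subst sum_nonneg_eq_0_iff) auto

lemma scalar_prod_self_pos: "v \<in> carrier_vec n \<Longrightarrow> v \<noteq> 0\<^sub>v n \<Longrightarrow> 0 < (v :: real vec) \<bullet> v"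
  using scalar_prod_self_eq_0[of v n] scalar_prod_self_nonneg[of v] by linarith

lemma sym_form:
  assumes "A \<in> carrier_mat n n" "A\<^sup>T = A" "x \<in> carrier_vec n" "y \<in> carrier_vec n"
  shows "y \<bullet> (A *\<^sub>v x) = x \<bullet> (A *\<^sub>v (y :: real vec))"
  by (metis assms comm_scalar_prod mult_mat_vec_carrier transpose_vec_mult_scalar)

lemma quadratic_form_add_smult:
  assumes "A \<in> carrier_mat n n" "A\<^sup>T = A" "x \<in> carrier_vec n" "y \<in> carrier_vec n"
  shows "(x + t \<cdot>\<^sub>v y) \<bullet> (A *\<^sub>v (x + t \<cdot>\<^sub>v y)) =
    x \<bullet> (A *\<^sub>v x) + 2 * t * (y \<bullet> (A *\<^sub>v x)) + t\<^sup>2 * (y \<bullet> (A *\<^sub>v (y :: real vec)))"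
proof -
  have "A *\<^sub>v (x + t \<cdot>\<^sub>v y) = A *\<^sub>v x + t \<cdot>\<^sub>v (A *\<^sub>v y)"
    using assms by (simp add: mult_add_distrib_mat_vec[of _ n n] mult_mat_vec[of _ n n])
  then show ?thesis
    using assms sym_form[OF assms]
    by (simp add: scalar_prod_add_distrib[of _ n] add_scalar_prod_distrib[of _ n]
        power2_eq_square algebra_simps)
qed

lemma psd_cauchy_schwarz:
  assumes A: "psd n A" and x: "x \<in> carrier_vec n" and y: "y \<in> carrier_vec n"
  shows "(y \<bullet> (A *\<^sub>v x))\<^sup>2 \<le> (x \<bullet> (A *\<^sub>v x)) * (y \<bullet> (A *\<^sub>v y))"
proof -
  define a b c where "a = x \<bullet> (A *\<^sub>v x)" "b = y \<bullet> (A *\<^sub>v x)" "c = y \<bullet> (A *\<^sub>v y)"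
  have *: "0 \<le> a + 2 * t * b + t\<^sup>2 * c" for t
  proof -
    have "0 \<le> (x + t \<cdot>\<^sub>v y) \<bullet> (A *\<^sub>v (x + t \<cdot>\<^sub>v y))"
      using A x y unfolding psd_def by auto
    then show ?thesis
      using quadratic_form_add_smult[of A n x y t] A x y unfolding psd_def a_b_c_def by simp
  qed
  have c: "c \<ge> 0" using A y unfolding psd_def a_b_c_def by auto
  have "b\<^sup>2 \<le> a * c"
  proof (cases "c = 0")
    case True
    have "b = 0"
    proof (rule ccontr)
      assume "b \<noteq> 0"
      \<comment> \<open>For \<open>c = 0\<close> the polynomial is affine in \<open>t\<close>; at
        this \<open>t\<close> its value is -1.\<close>
      then show False using *[of "- (a + 1) / (2 * b)"] True by (simp add: field_simps)
    qed
    then show ?thesis using True by simp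
  next
    case False
    \<comment> \<open>The value at the minimiser \<open>t = - b / c\<close>.\<close>
    have "0 \<le> a + 2 * (- b / c) * b + (- b / c)\<^sup>2 * c" by (rule *)
    also have "\<dots> = a - b\<^sup>2 / c" using False by (simp add: field_simps power2_eq_square)
    finally show ?thesis using False c by (simp add: field_simps)
  qed
  then show ?thesis unfolding a_b_c_def .
qed

lemma psd_one: "psd n (1\<^sub>m n)"
  unfolding psd_def using scalar_prod_self_nonneg by auto

lemma cauchy_schwarz_vec:
  assumes "x \<in> carrier_vec n" "y \<in> carrier_vec n"
  shows "(y \<bullet> x)\<^sup>2 \<le> (x \<bullet> x) * (y \<bullet> (y :: real vec))"
  using psd_cauchy_schwarz[OF psd_one assms] assms by simp

text \<open>Each product of two coordinates is at most \<open>x \<bullet> x\<close> in absolute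
  value, so the sum of the absolute entries bounds the form. The summand 1 makes the constant
  positive, so that it may be divided by.\<close>

lemma quadratic_form_bound:
  assumes A: "A \<in> carrier_mat n n"
  shows "\<exists>K>0. \<forall>x \<in> carrier_vec n. \<bar>x \<bullet> (A *\<^sub>v x)\<bar> \<le> K * (x \<bullet> (x :: real vec))"
proof (intro exI conjI ballI)
  let ?K = "1 + (\<Sum>i<n. \<Sum>j<n. \<bar>A $$ (i, j)\<bar>)"
  show "?K > 0" by (intro add_pos_nonneg sum_nonneg) auto
  fix x :: "real vec" assume x: "x \<in> carrier_vec n"
  have sq: "(x $ i)\<^sup>2 \<le> x \<bullet> x" if "i < n" for i
    unfolding scalar_prod_def power2_eq_square using x that
    by (intro member_le_sum[of i "{0..<dim_vec x}" "\<lambda>i. x $ i * x $ i"]) auto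
  have prod: "\<bar>x $ i * x $ j\<bar> \<le> x \<bullet> x" if "i < n" "j < n" for i j
  proof -
    have "2 * \<bar>x $ i * x $ j\<bar> \<le> (x $ i)\<^sup>2 + (x $ j)\<^sup>2"
      using sum_squares_bound[of "\<bar>x $ i\<bar>" "\<bar>x $ j\<bar>"] by (simp add: abs_mult)
    then show ?thesis using sq[OF that(1)] sq[OF that(2)] by linarith
  qed
  have "x \<bullet> (A *\<^sub>v x) = (\<Sum>i<n. \<Sum>j<n. A $$ (i, j) * (x $ i * x $ j))"
    using A x unfolding scalar_prod_def
    by (auto simp: sum_distrib_left scalar_prod_def lessThan_atLeast0 mult_ac intro!: sum.cong)
  also have "\<bar>\<dots>\<bar> \<le> (\<Sum>i<n. \<Sum>j<n. \<bar>A $$ (i, j)\<bar> * (x \<bullet> x))"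
    by (intro order.trans[OF sum_abs] sum_mono order.trans[OF sum_abs])
      (auto simp: abs_mult intro!: mult_left_mono order.trans[OF eq_refl prod])
  also have "\<dots> \<le> ?K * (x \<bullet> x)"
    using scalar_prod_self_nonneg[of x] by (simp add: sum_distrib_right distrib_right)
  finally show "\<bar>x \<bullet> (A *\<^sub>v x)\<bar> \<le> ?K * (x \<bullet> x)" .
qed

lemma smult_mat_mult_vec:
  assumes "A \<in> carrier_mat nr nc" "v \<in> carrier_vec nc"
  shows "(a \<cdot>\<^sub>m A) *\<^sub>v v = a \<cdot>\<^sub>v (A *\<^sub>v (v :: real vec))"
  using assms by (intro eq_vecI) auto

lemma transpose_smult: "(a \<cdot>\<^sub>m A)\<^sup>T = a \<cdot>\<^sub>m (A\<^sup>T :: real mat)"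
  by (intro eq_matI) auto

section \<open>The least eigenvalue of a symmetric matrix\<close>

lemma char_matrix_form:
  assumes "A \<in> carrier_mat n n" "x \<in> carrier_vec n"
  shows "y \<in> carrier_vec n \<Longrightarrow> y \<bullet> (char_matrix A t *\<^sub>v x) = y \<bullet> (A *\<^sub>v x) - t * (y \<bullet> (x::real vec))"
  using assms unfolding char_matrix_def
  by (simp add: add_mult_distrib_mat_vec[of _ n n] scalar_prod_add_distrib[of _ n] smult_mat_mult_vec[of _ n n])

text \<open>Order completeness takes the place of compactness of the sphere: \<open>t\<close> is the
  supremum of the set \<open>G\<close> of lower bounds for the Rayleigh quotient, and belongs to
  \<open>G\<close>. Hence \<open>B = S - t I\<close> has a nonnegative form. If \<open>B\<close>
  were invertible, Cauchy-Schwarz and a bound for the form of the inverse would put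
  \<open>t + 1 / L\<close> into \<open>G\<close>. So \<open>B\<close> is singular and
  \<open>t\<close> is an eigenvalue.\<close>

lemma symmetric_least_eigenvalue:
  assumes S: "S \<in> carrier_mat n n" "S\<^sup>T = S" and n: "n > 0"
  shows "\<exists>t. eigenvalue S t \<and> (\<forall>x \<in> carrier_vec n. t * (x \<bullet> x) \<le> x \<bullet> (S *\<^sub>v (x :: real vec)))"
proof -
  define G where "G = {t. \<forall>x \<in> carrier_vec n. t * (x \<bullet> x) \<le> x \<bullet> (S *\<^sub>v (x :: real vec))}"
  obtain K where K: "\<And>x. x \<in> carrier_vec n \<Longrightarrow> \<bar>x \<bullet> (S *\<^sub>v x)\<bar> \<le> K * (x \<bullet> (x :: real vec))"
    using quadratic_form_bound[OF S(1)] by blast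
  have "- K \<in> G" unfolding G_def using K by (force simp: abs_le_iff)
  then have ne: "G \<noteq> {}" by auto
  have pos: "x \<bullet> (S *\<^sub>v x) / (x \<bullet> x) \<ge> t" if "t \<in> G" "x \<in> carrier_vec n" "x \<noteq> 0\<^sub>v n" for t x
    using that scalar_prod_self_pos[of x n] unfolding G_def by (simp add: field_simps)
  have e0: "unit_vec n 0 \<in> carrier_vec n" "unit_vec n 0 \<noteq> (0\<^sub>v n :: real vec)"
    using n by auto
  have bdd: "bdd_above G"
    using pos[OF _ e0] by (intro bdd_aboveI)
  define t where "t = Sup G"
  have tG: "t \<in> G"
    unfolding G_def mem_Collect_eq
  proof
    fix x :: "real vec" assume x: "x \<in> carrier_vec n"
    show "t * (x \<bullet> x) \<le> x \<bullet> (S *\<^sub>v x)"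
    proof (cases "x = 0\<^sub>v n")
      case False
      have "t \<le> x \<bullet> (S *\<^sub>v x) / (x \<bullet> x)"
        unfolding t_def using pos[OF _ x False] by (intro cSup_least[OF ne])
      then show ?thesis using scalar_prod_self_pos[OF x False] by (simp add: field_simps)
    qed (use S in auto)
  qed
  define B where "B = char_matrix S t"
  have B: "B \<in> carrier_mat n n" "B\<^sup>T = B"
    using S unfolding B_def char_matrix_def by (auto simp: transpose_add[of _ n n] transpose_smult)
  have form: "y \<bullet> (B *\<^sub>v x) = y \<bullet> (S *\<^sub>v x) - t * (y \<bullet> x)"
    if "x \<in> carrier_vec n" "y \<in> carrier_vec n" for x y
    unfolding B_def using char_matrix_form[OF S(1) that] .
  have psd: "psd n B"
    using tG B form unfolding psd_def G_def by auto
  have "det B = 0"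
  proof (rule ccontr)
    assume "det B \<noteq> 0"
    then obtain C where C: "C \<in> carrier_mat n n" "B * C = 1\<^sub>m n"
      using det_non_zero_imp_unit[OF B(1)] unfolding Units_def ring_mat_def by auto
    obtain L where L: "L > 0" "\<And>x. x \<in> carrier_vec n \<Longrightarrow> \<bar>x \<bullet> (C *\<^sub>v x)\<bar> \<le> L * (x \<bullet> (x :: real vec))"
      using quadratic_form_bound[OF C(1)] by blast
    have "t + 1 / L \<in> G"
      unfolding G_def mem_Collect_eq
    proof
      fix x :: "real vec" assume x: "x \<in> carrier_vec n"
      show "(t + 1 / L) * (x \<bullet> x) \<le> x \<bullet> (S *\<^sub>v x)"
      proof (cases "x = 0\<^sub>v n")
        case False
        note p = scalar_prod_self_pos[OF x False]
        define y where "y = C *\<^sub>v x"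
        have y: "y \<in> carrier_vec n" using C x unfolding y_def by auto
        have By: "B *\<^sub>v y = x" unfolding y_def
          using assoc_mult_mat_vec[OF B(1) C(1) x] C x by simp
        \<comment> \<open>Cauchy-Schwarz for the form of \<open>B\<close> at \<open>y\<close> and
          \<open>x\<close>; since \<open>B y = x\<close>, the mixed term is
          \<open>x \<bullet> x\<close>.\<close>
        have "(x \<bullet> x)\<^sup>2 \<le> (y \<bullet> (B *\<^sub>v y)) * (x \<bullet> (B *\<^sub>v x))"
          using psd_cauchy_schwarz[OF psd y x] By by simp
        also have "y \<bullet> (B *\<^sub>v y) = x \<bullet> (C *\<^sub>v x)"
          unfolding By using comm_scalar_prod[OF x y] unfolding y_def by simp
        also have "(x \<bullet> (C *\<^sub>v x)) * (x \<bullet> (B *\<^sub>v x)) \<le> (L * (x \<bullet> x)) * (x \<bullet> (B *\<^sub>v x))"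
          using L(2)[OF x] psd x unfolding psd_def by (intro mult_right_mono) auto
        finally have "x \<bullet> x \<le> L * (x \<bullet> (B *\<^sub>v x))"
          using p by (simp add: power2_eq_square)
        then show ?thesis using L(1) form[OF x x] by (simp add: field_simps)
      qed (use S in auto)
    qed
    then have "t + 1 / L \<le> t" unfolding t_def by (intro cSup_upper bdd)
    then show False using L(1) by simp
  qed
  then have "eigenvalue S t"
    using eigenvalue_det[OF S(1)] unfolding B_def by simp
  with tG show ?thesis unfolding G_def by auto
qed

text \<open>The minimum of the finite spectrum is at most the eigenvalue that is already known to
  bound the Rayleigh quotient from below.\<close>

lemma min_eigenvalue_le_form:
  assumes S: "S \<in> carrier_mat n n" "S\<^sup>T = S" and n: "n > 0" and x: "x \<in> carrier_vec n"
  shows "min_eigenvalue S * (x \<bullet> x) \<le> x \<bullet> (S *\<^sub>v x)"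
proof -
  obtain t where t: "eigenvalue S t" "t * (x \<bullet> x) \<le> x \<bullet> (S *\<^sub>v x)"
    using symmetric_least_eigenvalue[OF S n] x by blast
  have "min_eigenvalue S \<le> t"
    unfolding min_eigenvalue_def using t(1) card_finite_spectrum[OF S(1)]
    by (intro Min_le) (auto simp: spectrum_def)
  then show ?thesis
    using t(2) scalar_prod_self_nonneg[of x] mult_right_mono by fastforce
qed

lemma mult_mat_cancel_left:
  assumes "A \<in> carrier_mat n m" "B \<in> carrier_mat m n" "A * B = 1\<^sub>m n" "C \<in> carrier_mat n k"
  shows "A * (B * C) = (C :: real mat)"
proof -
  have "A * (B * C) = (A * B) * C" by (rule assoc_mult_mat[symmetric, OF assms(1,2,4)])
  then show ?thesis using assms(3,4) by simp
qed

lemma mult_vec_cancel_left: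
  assumes "A \<in> carrier_mat n m" "B \<in> carrier_mat m n" "A * B = 1\<^sub>m n" "v \<in> carrier_vec n"
  shows "A *\<^sub>v (B *\<^sub>v v) = (v :: real vec)"
proof -
  have "A *\<^sub>v (B *\<^sub>v v) = (A * B) *\<^sub>v v" by (rule assoc_mult_mat_vec[symmetric, OF assms(1,2,4)])
  then show ?thesis using assms(3,4) by simp
qed

section \<open>Rank-one matrices and Householder reflections\<close>

definition outer :: "real vec \<Rightarrow> real mat" where
  "outer u = Matrix.mat (dim_vec u) (dim_vec u) (\<lambda>(i, j). u $ i * u $ j)"

lemma outer_carrier[simp]: "u \<in> carrier_vec n \<Longrightarrow> outer u \<in> carrier_mat n n"
  unfolding outer_def by auto

lemma outer_transpose[simp]: "(outer u)\<^sup>T = outer u"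
  unfolding outer_def by (intro eq_matI) (auto simp: mult.commute)

lemma outer_mult_vec:
  assumes "u \<in> carrier_vec n" "x \<in> carrier_vec n"
  shows "outer u *\<^sub>v x = (u \<bullet> x) \<cdot>\<^sub>v u"
  using assms unfolding outer_def
  by (intro eq_vecI) (auto simp: scalar_prod_def sum_distrib_right sum_distrib_left mult_ac)

lemma mat_eq_by_vec:
  assumes "A \<in> carrier_mat nr nc" "B \<in> carrier_mat nr nc"
    and "\<And>x. x \<in> carrier_vec nc \<Longrightarrow> A *\<^sub>v x = B *\<^sub>v (x :: real vec)"
  shows "A = B"
proof (rule eq_matI)
  fix i j assume ij: "i < dim_row B" "j < dim_col B"
  have "(A *\<^sub>v unit_vec nc j) $ i = (B *\<^sub>v unit_vec nc j) $ i" using assms(3) by simp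
  then show "A $$ (i, j) = B $$ (i, j)" using ij assms(1,2) by simp
qed (use assms in auto)

text \<open>A reflection for unit vectors \<open>w\<close>; the normalisation is left to the
  lemmas.\<close>

definition householder :: "real vec \<Rightarrow> real mat" where
  "householder w = 1\<^sub>m (dim_vec w) - 2 \<cdot>\<^sub>m outer w"

lemma householder_carrier[simp]: "w \<in> carrier_vec n \<Longrightarrow> householder w \<in> carrier_mat n n"
  unfolding householder_def by (auto intro!: minus_carrier_mat)

lemma householder_transpose[simp]: "(householder w)\<^sup>T = householder w"
proof -
  have w: "w \<in> carrier_vec (dim_vec w)" by auto
  show ?thesis
    unfolding householder_def
    using outer_carrier[OF w] by (subst transpose_minus) (auto simp: transpose_smult)
qed

lemma householder_mult_vec:
  assumes "w \<in> carrier_vec n" "x \<in> carrier_vec n"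
  shows "householder w *\<^sub>v x = x - (2 * (w \<bullet> x)) \<cdot>\<^sub>v w"
  using assms unfolding householder_def
  by (simp add: minus_mult_distrib_mat_vec[of _ n n] smult_mat_mult_vec[of _ n n] outer_mult_vec
      smult_smult_assoc)

lemma householder_involution:
  assumes "w \<in> carrier_vec n" "w \<bullet> w = 1"
  shows "householder w * householder w = 1\<^sub>m n"
proof (rule mat_eq_by_vec)
  fix x :: "real vec" assume x: "x \<in> carrier_vec n"
  have "w \<bullet> (x - (2 * (w \<bullet> x)) \<cdot>\<^sub>v w) = - (w \<bullet> x)"
    using assms x by (simp add: scalar_prod_minus_distrib[of _ n])
  then show "householder w * householder w *\<^sub>v x = 1\<^sub>m n *\<^sub>v x"
    using assms x
    by (auto simp: assoc_mult_mat_vec[of _ n n _ n] householder_mult_vec[of _ n] intro!: eq_vecI)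
qed (use assms in \<open>auto intro!: mult_carrier_mat[of _ n n]\<close>)

text \<open>With \<open>r\<close> the length of \<open>a - b\<close>, equal lengths give
  \<open>w \<bullet> b = - r / 2\<close>, so the reflection along the normalised difference adds
  exactly \<open>a - b\<close> to \<open>b\<close>.\<close>

lemma householder_swap:
  assumes a: "a \<in> carrier_vec n" and b: "b \<in> carrier_vec n" and ab: "a \<bullet> a = b \<bullet> b" and ne: "a \<noteq> b"
  defines "w \<equiv> (1 / sqrt ((a - b) \<bullet> (a - b))) \<cdot>\<^sub>v (a - b)"
  shows "w \<in> carrier_vec n" "w \<bullet> w = 1" "householder w *\<^sub>v b = a"
proof -
  show w: "w \<in> carrier_vec n" unfolding w_def using a b by auto
  have "a - b \<noteq> 0\<^sub>v n"
  proof
    assume "a - b = 0\<^sub>v n"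
    then have "(a - b) $ i = 0" if "i < n" for i using that by simp
    then have "a = b" using a b by (intro eq_vecI) auto
    then show False using ne by simp
  qed
  then have pos: "(a - b) \<bullet> (a - b) > 0"
    using a b by (intro scalar_prod_self_pos[of _ n]) auto
  define r where "r = sqrt ((a - b) \<bullet> (a - b))"
  have r: "r > 0" "r * r = (a - b) \<bullet> (a - b)" unfolding r_def using pos by auto
  show "w \<bullet> w = 1"
    unfolding w_def r_def[symmetric] using a b r pos by (simp add: field_simps)
  have exp: "(a - b) \<bullet> (a - b) = 2 * (b \<bullet> b) - 2 * (a \<bullet> b)"
    using a b ab comm_scalar_prod[OF a b]
    by (simp add: minus_scalar_prod_distrib[of _ n] scalar_prod_minus_distrib[of _ n])
  have "w \<bullet> b = (a \<bullet> b - b \<bullet> b) / r"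
    unfolding w_def r_def[symmetric] using a b by (simp add: minus_scalar_prod_distrib[of _ n])
  also have "\<dots> = - r / 2" using r exp by (simp add: field_simps)
  finally have "2 * (w \<bullet> b) / r = - 1" using r by simp
  moreover have "householder w *\<^sub>v b = b - (2 * (w \<bullet> b) / r) \<cdot>\<^sub>v (a - b)"
    unfolding householder_mult_vec[OF w b] unfolding w_def r_def[symmetric]
    using a b by (simp add: smult_smult_assoc)
  ultimately show "householder w *\<^sub>v b = a"
    using a b by (intro eq_vecI) auto
qed

section \<open>Diagonal matrices and the spectral theorem\<close>

definition diag_of :: "nat \<Rightarrow> (nat \<Rightarrow> real) \<Rightarrow> real mat" where
  "diag_of n d = Matrix.mat n n (\<lambda>(i, j). if i = j then d i else 0)"

lemma diag_of_carrier[simp]: "diag_of n d \<in> carrier_mat n n"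
  unfolding diag_of_def by simp

lemma diag_of_transpose[simp]: "(diag_of n d)\<^sup>T = diag_of n d"
  unfolding diag_of_def by (intro eq_matI) auto

lemma diag_of_mult: "diag_of n d * diag_of n e = diag_of n (\<lambda>i. d i * e i)"
proof (rule eq_matI)
  fix i j assume "i < dim_row (diag_of n (\<lambda>i. d i * e i))" "j < dim_col (diag_of n (\<lambda>i. d i * e i))"
  then have ij: "i < n" "j < n" by (auto simp: diag_of_def)
  have "(diag_of n d * diag_of n e) $$ (i, j) =
      (\<Sum>k = 0..<n. (if i = k then d i else 0) * (if k = j then e k else 0))"
    using ij unfolding diag_of_def by (simp add: scalar_prod_def)
  also have "\<dots> = (\<Sum>k = 0..<n. if i = k then d i * (if i = j then e i else 0) else 0)"
    by (intro sum.cong) auto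
  also have "\<dots> = (if i = j then d i * e i else 0)" using ij by (simp add: sum.delta)
  finally show "(diag_of n d * diag_of n e) $$ (i, j) = diag_of n (\<lambda>i. d i * e i) $$ (i, j)"
    using ij by (simp add: diag_of_def)
qed (auto simp: diag_of_def)

lemma diag_of_form:
  assumes "y \<in> carrier_vec n"
  shows "y \<bullet> (diag_of n d *\<^sub>v y) = (\<Sum>i<n. d i * (y $ i)\<^sup>2)"
proof -
  have "(diag_of n d *\<^sub>v y) $ i = d i * y $ i" if "i < n" for i
  proof -
    have "(diag_of n d *\<^sub>v y) $ i = (\<Sum>k = 0..<n. (if i = k then d i else 0) * y $ k)"
      using that assms unfolding diag_of_def by (simp add: scalar_prod_def)
    also have "\<dots> = (\<Sum>k = 0..<n. if i = k then d i * y $ i else 0)"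
      by (intro sum.cong) auto
    finally show ?thesis using that by (simp add: sum.delta)
  qed
  then show ?thesis
    using assms unfolding scalar_prod_def
    by (auto simp: lessThan_atLeast0 power2_eq_square diag_of_def intro!: sum.cong)
qed

lemma det_diag_of: "det (diag_of n d) = (\<Prod>i<n. d i)"
  using det_upper_triangular[of "diag_of n d" n]
  by (auto simp: diag_of_def diag_mat_def prod.distinct_set_conv_list[symmetric]
      lessThan_atLeast0 upper_triangular_def intro!: prod.cong)

lemma unit_eigenvector:
  assumes "S \<in> carrier_mat n n" "S\<^sup>T = S" "n > 0"
  shows "\<exists>t v. v \<in> carrier_vec n \<and> v \<bullet> v = 1 \<and> S *\<^sub>v v = t \<cdot>\<^sub>v (v :: real vec)"
proof -
  obtain t v where v: "v \<in> carrier_vec n" "v \<noteq> 0\<^sub>v n" "S *\<^sub>v v = t \<cdot>\<^sub>v v"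
    using symmetric_least_eigenvalue[OF assms] assms(1) unfolding eigenvalue_def eigenvector_def by auto
  have p: "v \<bullet> v > 0" using scalar_prod_self_pos[OF v(1,2)] .
  let ?c = "1 / sqrt (v \<bullet> v)"
  have "S *\<^sub>v (?c \<cdot>\<^sub>v v) = t \<cdot>\<^sub>v (?c \<cdot>\<^sub>v v)"
    using v assms(1) by (simp add: mult_mat_vec[of _ n n] smult_smult_assoc mult.commute)
  moreover have "(?c \<cdot>\<^sub>v v) \<bullet> (?c \<cdot>\<^sub>v v) = 1" using v(1) p by simp
  ultimately show ?thesis using v(1) by (intro exI[of _ t] exI[of _ "?c \<cdot>\<^sub>v v"]) auto
qed

text \<open>Deflation, by induction on the dimension. A symmetric orthogonal \<open>H\<close>
  carries the first unit vector \<open>e\<close> to a unit eigenvector, so the first column of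
  \<open>H A H\<close> is \<open>t e\<close>, and by symmetry its first row as well. The remaining
  block is diagonalised by the induction hypothesis.\<close>

lemma spectral_theorem:
  assumes "A \<in> carrier_mat n n" "A\<^sup>T = (A :: real mat)"
  shows "\<exists>V d. V \<in> carrier_mat n n \<and> V\<^sup>T * V = 1\<^sub>m n \<and> V * V\<^sup>T = 1\<^sub>m n \<and> A = V * diag_of n d * V\<^sup>T"
  using assms
proof (induction n arbitrary: A)
  case 0
  then show ?case by (intro exI[of _ "1\<^sub>m 0"] exI[of _ "\<lambda>_. 0"]) (auto intro!: eq_matI)
next
  case (Suc n)
  note A = Suc.prems
  let ?N = "Suc n"
  obtain t v where v: "v \<in> carrier_vec ?N" "v \<bullet> v = 1" "A *\<^sub>v v = t \<cdot>\<^sub>v v"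
    using unit_eigenvector[OF A] by auto
  define e where "e = (unit_vec ?N 0 :: real vec)"
  have e: "e \<in> carrier_vec ?N" "e \<bullet> e = 1" unfolding e_def by auto
  obtain H where H: "H \<in> carrier_mat ?N ?N" "H\<^sup>T = H" "H * H = 1\<^sub>m ?N" "H *\<^sub>v e = v"
  proof (cases "v = e")
    case True
    \<comment> \<open>A reflection that swaps two vectors needs them to be distinct; if the
      eigenvector already is \<open>e\<close>, the identity takes its place.\<close>
    show ?thesis by (rule that[of "1\<^sub>m ?N"]) (use True e in auto)
  next
    case False
    let ?w = "(1 / sqrt ((v - e) \<bullet> (v - e))) \<cdot>\<^sub>v (v - e)"
    note w = householder_swap[OF v(1) e(1) _ False, unfolded v(2) e(2), OF refl]
    show ?thesis
      by (rule that[of "householder ?w"]) (use w householder_involution[OF w(1,2)] in auto)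
  qed
  define B where "B = H * A * H"
  have B: "B \<in> carrier_mat ?N ?N" unfolding B_def using H A by auto
  have Bsym: "B\<^sup>T = B"
    unfolding B_def using H A by (simp add: transpose_mult[of _ ?N ?N _ ?N] mult_carrier_mat[of _ ?N ?N _ ?N])
  have Hv: "H *\<^sub>v v = e"
    using mult_vec_cancel_left[OF H(1,1,3) e(1)] H(4) by simp
  have Be: "B *\<^sub>v e = t \<cdot>\<^sub>v e"
    unfolding B_def using H A v e
    by (simp add: assoc_mult_mat_vec[of _ ?N ?N _ ?N] mult_mat_vec[of _ ?N ?N] Hv)
  have col0: "B $$ (i, 0) = (if i = 0 then t else 0)" if "i < ?N" for i
  proof -
    have "(B *\<^sub>v e) $ i = B $$ (i, 0)" using B that unfolding e_def by simp
    then show ?thesis unfolding Be using that by (auto simp: e_def)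
  qed
  have row0: "B $$ (0, i) = (if i = 0 then t else 0)" if "i < ?N" for i
    using col0[OF that] Bsym B that by (metis carrier_matD index_transpose_mat(1) zero_less_Suc)
  define A' where "A' = Matrix.mat n n (\<lambda>(i, j). B $$ (Suc i, Suc j))"
  have A': "A' \<in> carrier_mat n n" unfolding A'_def by simp
  have "A'\<^sup>T = A'"
  proof (rule eq_matI)
    fix i j assume ij: "i < dim_row A'" "j < dim_col A'"
    have "B $$ (Suc j, Suc i) = B\<^sup>T $$ (Suc i, Suc j)" using ij B A' by auto
    then show "A'\<^sup>T $$ (i, j) = A' $$ (i, j)" using ij Bsym unfolding A'_def by auto
  qed (use A' in auto)
  then obtain V' d where V': "V' \<in> carrier_mat n n" "V'\<^sup>T * V' = 1\<^sub>m n" "V' * V'\<^sup>T = 1\<^sub>m n"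
    "A' = V' * diag_of n d * V'\<^sup>T"
    using Suc.IH[OF A'] by auto
  define d' where "d' = case_nat t d"
  let ?T = "t \<cdot>\<^sub>m 1\<^sub>m 1 :: real mat"
  let ?Z1 = "0\<^sub>m 1 n :: real mat" and ?Z2 = "0\<^sub>m n 1 :: real mat"
  define U where "U = four_block_mat (1\<^sub>m 1) ?Z1 ?Z2 V'"
  have U: "U \<in> carrier_mat ?N ?N" unfolding U_def using V'(1) four_block_carrier_mat[of "1\<^sub>m 1" 1 1 V' n n] by auto
  have UT: "U\<^sup>T = four_block_mat (1\<^sub>m 1) ?Z1 ?Z2 V'\<^sup>T"
    unfolding U_def using V'(1) by (subst transpose_four_block_mat[of _ 1 1 _ n _ n]) auto
  have one: "1\<^sub>m ?N = four_block_mat (1\<^sub>m 1) ?Z1 ?Z2 (1\<^sub>m n)"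
    by (intro eq_matI) auto
  have UTU: "U\<^sup>T * U = 1\<^sub>m ?N" "U * U\<^sup>T = 1\<^sub>m ?N"
    unfolding UT unfolding U_def one using V'
    by (subst mult_four_block_mat[of _ 1 1 _ n _ n _ _ 1 _ n]; auto)+
  have D: "diag_of ?N d' = four_block_mat ?T ?Z1 ?Z2 (diag_of n d)"
    unfolding diag_of_def d'_def by (intro eq_matI) (auto split: nat.splits)
  have Bblock: "B = four_block_mat ?T ?Z1 ?Z2 A'"
  proof (rule eq_matI)
    fix i j assume "i < dim_row (four_block_mat ?T ?Z1 ?Z2 A')" "j < dim_col (four_block_mat ?T ?Z1 ?Z2 A')"
    then have ij: "i < ?N" "j < ?N" using A' by auto
    then show "B $$ (i, j) = four_block_mat ?T ?Z1 ?Z2 A' $$ (i, j)"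
      using row0[of j] col0[of i] A' by (cases i; cases j) (auto simp: A'_def)
  qed (use B A' in auto)
  have "U * diag_of ?N d' = four_block_mat ?T ?Z1 ?Z2 (V' * diag_of n d)"
    unfolding U_def D using V'(1)
    by (subst mult_four_block_mat[of _ 1 1 _ n _ n _ _ 1 _ n]) (auto simp: left_mult_zero_mat[of _ n n])
  moreover have C: "V' * diag_of n d \<in> carrier_mat n n" using V'(1) by auto
  ultimately have "U * diag_of ?N d' * U\<^sup>T = four_block_mat ?T ?Z1 ?Z2 (V' * diag_of n d * V'\<^sup>T)"
    unfolding UT using V'(1)
    by (simp del: assoc_mult_mat, subst mult_four_block_mat[of _ 1 1 _ n _ n _ _ 1 _ n])
      (auto simp: left_mult_zero_mat[of _ n n] right_mult_zero_mat[of _ n n] left_add_zero_mat[of _ n n] simp del: assoc_mult_mat)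
  then have BU: "B = U * diag_of ?N d' * U\<^sup>T" unfolding Bblock V'(4)[symmetric] by simp
  define V where "V = H * U"
  have V: "V \<in> carrier_mat ?N ?N" unfolding V_def using H U by auto
  have VT: "V\<^sup>T = U\<^sup>T * H" unfolding V_def using H U by (simp add: transpose_mult[of _ ?N ?N])
  have cancel: "H * (H * C) = C" if "C \<in> carrier_mat ?N ?N" for C
    using mult_mat_cancel_left[OF H(1,1,3) that] .
  have cancelU: "U * (U\<^sup>T * C) = C" if "C \<in> carrier_mat ?N ?N" for C
    using U UTU(2) that by (intro mult_mat_cancel_left[of _ ?N ?N]) auto
  have "V\<^sup>T * V = 1\<^sub>m ?N"
    unfolding VT unfolding V_def using H U UTU cancel
    by (simp add: assoc_mult_mat[of _ ?N ?N _ ?N _ ?N])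
  moreover have "V * V\<^sup>T = 1\<^sub>m ?N"
    unfolding VT unfolding V_def using H U UTU cancelU
    by (simp add: assoc_mult_mat[of _ ?N ?N _ ?N _ ?N])
  moreover have "A = H * B * H"
    unfolding B_def using H A cancel by (simp add: assoc_mult_mat[of _ ?N ?N _ ?N _ ?N])
  then have "A = V * diag_of ?N d' * V\<^sup>T"
    unfolding BU VT unfolding V_def using H U
    by (simp add: assoc_mult_mat[of _ ?N ?N _ ?N _ ?N] mult_carrier_mat[of _ ?N ?N _ ?N])
  ultimately show ?case using V by auto
qed

lemma orthogonal_diag_form:
  assumes "V \<in> carrier_mat n n" "x \<in> carrier_vec n"
  shows "x \<bullet> (V * diag_of n d * V\<^sup>T *\<^sub>v x) = (\<Sum>i<n. d i * ((V\<^sup>T *\<^sub>v x) $ i)\<^sup>2)"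
proof -
  have "x \<bullet> (V *\<^sub>v (diag_of n d *\<^sub>v (V\<^sup>T *\<^sub>v x))) = (V\<^sup>T *\<^sub>v x) \<bullet> (diag_of n d *\<^sub>v (V\<^sup>T *\<^sub>v x))"
    using assms by (subst transpose_vec_mult_scalar[of V n n]) (auto simp: mult_mat_vec_carrier[of _ n n])
  then show ?thesis
    using assms diag_of_form[of "V\<^sup>T *\<^sub>v x" n d]
    by (simp add: assoc_mult_mat_vec[of _ n n _ n])
qed

lemma det_orthogonal_diag:
  assumes "V \<in> carrier_mat n n" "V * V\<^sup>T = 1\<^sub>m n"
  shows "det (V * diag_of n d * V\<^sup>T) = (\<Prod>i<n. d i)"
proof -
  have "det V * det (V\<^sup>T) = 1"
    using assms det_mult[of V n "V\<^sup>T"] by simp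
  then show ?thesis
    using assms by (simp add: det_mult[of _ n] det_diag_of)
qed

section \<open>Positive definite matrices, their roots and inverses\<close>

text \<open>At the \<open>i\<close>-th column of \<open>V\<close> the form takes the value
  \<open>d i\<close>, so the eigenvalues inherit positivity.\<close>

lemma pos_def_spectral:
  assumes "pos_def n A"
  shows "\<exists>V d. V \<in> carrier_mat n n \<and> V\<^sup>T * V = 1\<^sub>m n \<and> V * V\<^sup>T = 1\<^sub>m n \<and> A = V * diag_of n d * V\<^sup>T
    \<and> (\<forall>i<n. d i > 0)"
proof -
  have A: "A \<in> carrier_mat n n" "A\<^sup>T = A" using assms unfolding pos_def_def by auto
  obtain V d where V: "V \<in> carrier_mat n n" "V\<^sup>T * V = 1\<^sub>m n" "V * V\<^sup>T = 1\<^sub>m n"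
    "A = V * diag_of n d * V\<^sup>T"
    using spectral_theorem[OF A] by auto
  have "d i > 0" if i: "i < n" for i
  proof -
    define x where "x = V *\<^sub>v unit_vec n i"
    have x: "x \<in> carrier_vec n" using V unfolding x_def by auto
    have Vx: "V\<^sup>T *\<^sub>v x = unit_vec n i" unfolding x_def
      using V(1,2) by (intro mult_vec_cancel_left[of _ n n]) auto
    have "x \<noteq> 0\<^sub>v n"
    proof
      assume "x = 0\<^sub>v n"
      then have "V\<^sup>T *\<^sub>v x = 0\<^sub>v n" using V(1) by (auto intro!: eq_vecI)
      then have "(unit_vec n i :: real vec) $ i = 0\<^sub>v n $ i" using Vx by simp
      then show False using i by simp
    qed
    then have "0 < x \<bullet> (A *\<^sub>v x)" using assms x unfolding pos_def_def by auto
    also have "\<dots> = (\<Sum>k<n. d k * (unit_vec n i $ k)\<^sup>2)"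
      unfolding V(4) orthogonal_diag_form[OF V(1) x] Vx ..
    also have "\<dots> = (\<Sum>k<n. if k = i then d i else 0)"
      using i by (intro sum.cong) auto
    also have "\<dots> = d i" using i by simp
    finally show ?thesis .
  qed
  then show ?thesis using V by blast
qed

lemma pos_def_det: "pos_def n A \<Longrightarrow> det A > 0"
  using pos_def_spectral[of n A] det_orthogonal_diag[of _ n]
  by (auto intro!: prod_pos)

lemma pos_defI_spectral:
  assumes V: "V \<in> carrier_mat n n" "V * V\<^sup>T = 1\<^sub>m n" and d: "\<And>i. i < n \<Longrightarrow> d i > 0"
  shows "pos_def n (V * diag_of n d * V\<^sup>T)"
  unfolding pos_def_def
proof (intro conjI ballI impI)
  show "V * diag_of n d * V\<^sup>T \<in> carrier_mat n n" using V by (auto intro!: mult_carrier_mat[of _ n n])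
  show "(V * diag_of n d * V\<^sup>T)\<^sup>T = V * diag_of n d * V\<^sup>T"
    using V by (simp add: transpose_mult[of _ n n _ n] mult_carrier_mat[of _ n n _ n] assoc_mult_mat[of _ n n _ n _ n])
  fix x :: "real vec" assume x: "x \<in> carrier_vec n" "x \<noteq> 0\<^sub>v n"
  define y where "y = V\<^sup>T *\<^sub>v x"
  have "V *\<^sub>v y = x" unfolding y_def using V x
    by (intro mult_vec_cancel_left[of _ n n]) auto
  then have "y \<noteq> 0\<^sub>v n" using x V(1) by auto
  moreover have y: "y \<in> carrier_vec n" unfolding y_def using V x by auto
  ultimately obtain i where i: "i < n" "y $ i \<noteq> 0"
    by (metis carrier_vecD eq_vecI index_zero_vec)
  show "0 < x \<bullet> (V * diag_of n d * V\<^sup>T *\<^sub>v x)"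
    unfolding orthogonal_diag_form[OF V(1) x(1)] y_def[symmetric]
    using i d by (intro sum_pos2[of _ i]) (auto intro!: mult_nonneg_nonneg less_imp_le[OF d])
qed

lemma pos_def_sqrt_exists:
  assumes "pos_def n A"
  shows "\<exists>R. pos_def n R \<and> R * R = A"
proof -
  obtain V d where V: "V \<in> carrier_mat n n" "V\<^sup>T * V = 1\<^sub>m n" "V * V\<^sup>T = 1\<^sub>m n"
    "A = V * diag_of n d * V\<^sup>T" "\<forall>i<n. d i > 0"
    using pos_def_spectral[OF assms] by auto
  define R where "R = V * diag_of n (\<lambda>i. sqrt (d i)) * V\<^sup>T"
  have "pos_def n R" unfolding R_def using V by (intro pos_defI_spectral) auto
  moreover have "R * R = A"
  proof -
    have c: "V\<^sup>T * (V * C) = C" if "C \<in> carrier_mat n n" for C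
      using V(1,2) that by (intro mult_mat_cancel_left[of _ n n]) auto
    have dd: "diag_of n (\<lambda>i. sqrt (d i)) * (diag_of n (\<lambda>i. sqrt (d i)) * C) = diag_of n d * C"
      if "C \<in> carrier_mat n n" for C
    proof -
      have "diag_of n (\<lambda>i. sqrt (d i) * sqrt (d i)) = diag_of n d"
        unfolding diag_of_def using V(5) by (intro eq_matI) auto
      then show ?thesis
        using assoc_mult_mat[OF diag_of_carrier diag_of_carrier that] by (metis diag_of_mult)
    qed
    show ?thesis unfolding R_def V(4) using V(1)
      by (simp add: assoc_mult_mat[of _ n n _ n _ n] mult_carrier_mat[of _ n n] c dd)
  qed
  ultimately show ?thesis by blast
qed

text \<open>The nonzero determinant excludes the result \<open>None\<close> of
  \<open>mat_inverse\<close>, for which \<open>inv_mat\<close> would be unspecified.\<close>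

lemma inv_mat:
  assumes A: "A \<in> carrier_mat n n" and d: "det A \<noteq> 0"
  shows "inv_mat A \<in> carrier_mat n n" "A * inv_mat A = 1\<^sub>m n" "inv_mat A * A = 1\<^sub>m n"
proof -
  have "mat_inverse A \<noteq> None"
    using mat_inverse(1)[OF A, of undefined] det_non_zero_imp_unit[OF A d, of undefined] by blast
  then obtain B where "mat_inverse A = Some B" by auto
  with mat_inverse(2)[OF A this]
  show "inv_mat A \<in> carrier_mat n n" "A * inv_mat A = 1\<^sub>m n" "inv_mat A * A = 1\<^sub>m n"
    unfolding inv_mat_def by auto
qed

lemma inverse_unique:
  assumes "A \<in> carrier_mat n n" "B \<in> carrier_mat n n" "C \<in> carrier_mat n n"
    and "B * A = 1\<^sub>m n" "A * C = 1\<^sub>m n"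
  shows "B = (C :: real mat)"
  using assms mult_mat_cancel_left[OF assms(2,1,4,3)] by simp

lemma inv_mat_transpose:
  assumes A: "A \<in> carrier_mat n n" and d: "det A \<noteq> 0" and s: "A\<^sup>T = A"
  shows "(inv_mat A)\<^sup>T = inv_mat A"
proof (rule inverse_unique[OF A])
  note i = inv_mat[OF A d]
  show "(inv_mat A)\<^sup>T * A = 1\<^sub>m n"
    using transpose_mult[OF A i(1)] i(2) s by simp
qed (use inv_mat[OF A d] in auto)

text \<open>Valid for whichever root \<open>R\<close> the choice operator returns: \<open>R\<close>
  is symmetric with positive determinant, and cancelling it on both sides of \<open>R R\<close>
  leaves the identity.\<close>

lemma inv_sqrt_mat:
  assumes A: "pos_def n A"
  shows "inv_sqrt_mat A \<in> carrier_mat n n" "(inv_sqrt_mat A)\<^sup>T = inv_sqrt_mat A"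
    "inv_sqrt_mat A * A * inv_sqrt_mat A = 1\<^sub>m n"
proof -
  have dim: "dim_row A = n" using A unfolding pos_def_def by auto
  define R where "R = (SOME R. pos_def (dim_row A) R \<and> R * R = A)"
  have R: "pos_def n R" "R * R = A"
    using someI_ex[OF pos_def_sqrt_exists[OF A]] unfolding R_def dim by auto
  have c: "R \<in> carrier_mat n n" "R\<^sup>T = R" using R unfolding pos_def_def by auto
  have d: "det R \<noteq> 0" using pos_def_det[OF R(1)] by simp
  note i = inv_mat[OF c(1) d]
  have eq: "inv_sqrt_mat A = inv_mat R" unfolding inv_sqrt_mat_def R_def ..
  show "inv_sqrt_mat A \<in> carrier_mat n n" "(inv_sqrt_mat A)\<^sup>T = inv_sqrt_mat A"
    unfolding eq using i inv_mat_transpose[OF c(1) d c(2)] by auto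
  show "inv_sqrt_mat A * A * inv_sqrt_mat A = 1\<^sub>m n"
  proof -
    have "inv_mat R * (R * R) = R" by (rule mult_mat_cancel_left[OF i(1) c(1) i(3) c(1)])
    then have "inv_mat R * A * inv_mat R = 1\<^sub>m n" unfolding R(2) using i(2) by simp
    then show ?thesis unfolding eq .
  qed
qed

section \<open>Determinant inequalities and identities\<close>

text \<open>Congruence with the inverse root \<open>T\<close> of \<open>B\<close> reduces the claim
  to the case of the identity: the form of \<open>T A T\<close> dominates
  \<open>x \<bullet> x\<close>, so all eigenvalues of \<open>T A T\<close> are at least 1, and its
  determinant is \<open>det A / det B\<close>.\<close>

lemma det_mono:
  assumes B: "pos_def n B" and A: "A \<in> carrier_mat n n" "A\<^sup>T = A"
    and le: "\<And>x. x \<in> carrier_vec n \<Longrightarrow> x \<bullet> (B *\<^sub>v x) \<le> x \<bullet> (A *\<^sub>v x)"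
  shows "det B \<le> det A"
proof -
  define T where "T = inv_sqrt_mat B"
  note T = inv_sqrt_mat[OF B, folded T_def]
  have Bc: "B \<in> carrier_mat n n" using B unfolding pos_def_def by auto
  define M where "M = T * A * T"
  have M: "M \<in> carrier_mat n n" "M\<^sup>T = M"
    unfolding M_def using T A
    by (auto simp: transpose_mult[of _ n n _ n] mult_carrier_mat[of _ n n _ n])
  have form: "x \<bullet> (T * C * T *\<^sub>v x) = (T *\<^sub>v x) \<bullet> (C *\<^sub>v (T *\<^sub>v x))"
    if "C \<in> carrier_mat n n" "x \<in> carrier_vec n" for C x
    using that T transpose_vec_mult_scalar[of T n n "C *\<^sub>v (T *\<^sub>v x)" x]
    by (simp add: assoc_mult_mat_vec[of _ n n _ n] assoc_mult_mat[of _ n n _ n _ n])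
  have ge: "x \<bullet> x \<le> x \<bullet> (M *\<^sub>v x)" if x: "x \<in> carrier_vec n" for x
  proof -
    have "x \<bullet> x = x \<bullet> (T * B * T *\<^sub>v x)" using T(3) x by simp
    also have "\<dots> \<le> x \<bullet> (M *\<^sub>v x)"
      unfolding M_def form[OF Bc x] form[OF A(1) x] using T x by (intro le) auto
    finally show ?thesis .
  qed
  obtain V d where V: "V \<in> carrier_mat n n" "V\<^sup>T * V = 1\<^sub>m n" "V * V\<^sup>T = 1\<^sub>m n"
    "M = V * diag_of n d * V\<^sup>T"
    using spectral_theorem[OF M] by auto
  have "d i \<ge> 1" if i: "i < n" for i
  proof -
    define x where "x = V *\<^sub>v unit_vec n i"
    have x: "x \<in> carrier_vec n" using V unfolding x_def by auto
    have Vx: "V\<^sup>T *\<^sub>v x = unit_vec n i" unfolding x_def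
      using V(1,2) by (intro mult_vec_cancel_left[of _ n n]) auto
    have "(V\<^sup>T *\<^sub>v x) \<bullet> unit_vec n i = x \<bullet> (V *\<^sub>v unit_vec n i)"
      using V x by (intro transpose_vec_mult_scalar) auto
    then have "x \<bullet> x = 1" unfolding Vx x_def[symmetric] using i by simp
    then have "1 \<le> x \<bullet> (M *\<^sub>v x)" using ge[OF x] by simp
    also have "\<dots> = (\<Sum>k<n. d k * (unit_vec n i $ k)\<^sup>2)"
      unfolding V(4) orthogonal_diag_form[OF V(1) x] Vx ..
    also have "\<dots> = (\<Sum>k<n. if k = i then d i else 0)"
      using i by (intro sum.cong) auto
    also have "\<dots> = d i" using i by simp
    finally show ?thesis .
  qed
  then have "det M \<ge> 1"
    unfolding V(4) det_orthogonal_diag[OF V(1,3)] by (intro prod_ge_1) auto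
  moreover have "det M = det A * (det T)\<^sup>2"
    unfolding M_def using T A by (simp add: det_mult[of _ n] power2_eq_square mult_carrier_mat[of _ n n])
  moreover have TB: "det B * (det T)\<^sup>2 = 1"
  proof -
    have "det (T * B * T) = det B * (det T)\<^sup>2"
      using T(1) Bc by (simp add: det_mult[of _ n] power2_eq_square mult_carrier_mat[of _ n n])
    then show ?thesis using T(3) by simp
  qed
  ultimately have "det B * (det T)\<^sup>2 \<le> det A * (det T)\<^sup>2" by simp
  moreover have "(det T)\<^sup>2 > 0" using TB by (cases "det T = 0") auto
  ultimately show ?thesis by simp
qed

text \<open>Multiplying the block matrix \<open>?M\<close> by the unit triangular \<open>?U\<close>
  from the right and from the left gives two block lower triangular matrices, and the two sides of
  the claim are their determinants.\<close>

lemma sylvester_det: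
  assumes A: "A \<in> carrier_mat n m" and B: "B \<in> carrier_mat m n"
  shows "det (1\<^sub>m n + A * B) = det (1\<^sub>m m + B * (A :: real mat))"
proof -
  let ?M = "four_block_mat (1\<^sub>m n) (- A) B (1\<^sub>m m)"
  let ?U = "four_block_mat (1\<^sub>m n) A (0\<^sub>m m n) (1\<^sub>m m)"
  have c: "?M \<in> carrier_mat (n + m) (n + m)" "?U \<in> carrier_mat (n + m) (n + m)"
    using A B by auto
  have "?M * ?U = four_block_mat (1\<^sub>m n) (0\<^sub>m n m) B (1\<^sub>m m + B * A)"
    using A B by (subst mult_four_block_mat[of _ n n _ m _ m _ _ n _ m])
      (auto simp: uminus_l_inv_mat add_uminus_minus_mat comm_add_mat[of "B * A" m m])
  then have 1: "det (?M * ?U) = det (1\<^sub>m m + B * A)"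
    using A B det_four_block_mat_upper_right_zero[of "1\<^sub>m n" n "0\<^sub>m n m" m B "1\<^sub>m m + B * A"] by simp
  have "?U * ?M = four_block_mat (1\<^sub>m n + A * B) (0\<^sub>m n m) B (1\<^sub>m m)"
    using A B by (subst mult_four_block_mat[of _ n n _ m _ m _ _ n _ m])
      (auto simp: uminus_l_inv_mat add_uminus_minus_mat)
  then have 2: "det (?U * ?M) = det (1\<^sub>m n + A * B)"
    using A B det_four_block_mat_upper_right_zero[of "1\<^sub>m n + A * B" n "0\<^sub>m n m" m B "1\<^sub>m m"] by simp
  show ?thesis using 1 2 det_mult[OF c] det_mult[OF c(2,1)] by (metis mult.commute)
qed

text \<open>The matrix determinant lemma: factor out \<open>W\<close>, then exchange the sizes with
  Sylvester's identity. It serves with \<open>m = 1\<close> for rank-one updates and with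
  \<open>m = n\<close> to bring determinants of different sizes to a common size.\<close>

lemma det_add_mult:
  assumes W: "W \<in> carrier_mat p p" "det W \<noteq> 0" and A: "A \<in> carrier_mat p m" and B: "B \<in> carrier_mat m p"
  shows "det (W + A * B) = det W * det (1\<^sub>m m + B * (inv_mat W * A))"
proof -
  note i = inv_mat[OF W]
  have "W * (1\<^sub>m p + inv_mat W * A * B) = W + W * (inv_mat W * A * B)"
    using W A B i by (subst mult_add_distrib_mat[of _ p p _ p]) (auto intro!: mult_carrier_mat[of _ p m] mult_carrier_mat[of _ p p])
  also have "W * (inv_mat W * A * B) = W * (inv_mat W * (A * B))"
    using A B i by (simp add: assoc_mult_mat[of _ p p _ m _ p])
  also have "\<dots> = A * B" using W A B i by (intro mult_mat_cancel_left[of _ p p]) auto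
  finally have "W + A * B = W * (1\<^sub>m p + inv_mat W * A * B)" ..
  then have "det (W + A * B) = det W * det (1\<^sub>m p + inv_mat W * A * B)"
    using W A B i by (simp add: det_mult[of _ p])
  also have "det (1\<^sub>m p + inv_mat W * A * B) = det (1\<^sub>m m + B * (inv_mat W * A))"
    using i A B by (intro sylvester_det) auto
  finally show ?thesis .
qed

lemma det_minus_outer:
  assumes W: "W \<in> carrier_mat p p" "det W \<noteq> 0" and v: "v \<in> carrier_vec p"
  shows "det (W - outer v) = det W * (1 - v \<bullet> (inv_mat W *\<^sub>v v))"
proof -
  define A where "A = Matrix.mat p 1 (\<lambda>(i, j). - v $ i)"
  define B where "B = Matrix.mat 1 p (\<lambda>(i, j). v $ j)"
  have c: "A \<in> carrier_mat p 1" "B \<in> carrier_mat 1 p" unfolding A_def B_def by auto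
  note i = inv_mat[OF W]
  have "W - outer v = W + A * B"
    using W v unfolding A_def B_def outer_def by (intro eq_matI) (auto simp: scalar_prod_def)
  moreover have "1\<^sub>m 1 + B * (inv_mat W * A) = Matrix.mat 1 1 (\<lambda>_. 1 - v \<bullet> (inv_mat W *\<^sub>v v))"
    using i v unfolding A_def B_def
    by (intro eq_matI) (auto simp: scalar_prod_def sum_negf)
  moreover have "det (Matrix.mat 1 1 (\<lambda>_. 1 - v \<bullet> (inv_mat W *\<^sub>v v))) = 1 - v \<bullet> (inv_mat W *\<^sub>v v)"
    by (subst det_single) auto
  ultimately show ?thesis using det_add_mult[OF W c] by simp
qed

section \<open>Lebesgue measure on matrices\<close>

text \<open>An iterated product rather than one over pairs of indices, so that its inner factor is
  the reference measure for a row in \<open>matrix_normal\<close>.\<close>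

abbreviation lborel_mat :: "nat \<Rightarrow> nat \<Rightarrow> (nat \<Rightarrow> nat \<Rightarrow> real) measure" where
  "lborel_mat n p \<equiv> PiM {..<n} (\<lambda>_. PiM {..<p} (\<lambda>_. lborel))"

definition translate :: "nat \<Rightarrow> nat \<Rightarrow> (nat \<Rightarrow> nat \<Rightarrow> real) \<Rightarrow> (nat \<Rightarrow> nat \<Rightarrow> real) \<Rightarrow> nat \<Rightarrow> nat \<Rightarrow> real" where
  "translate n p s z = (\<lambda>i\<in>{..<n}. \<lambda>a\<in>{..<p}. z i a + s i a)"

definition reflect :: "nat \<Rightarrow> nat \<Rightarrow> (nat \<Rightarrow> real) \<Rightarrow> (nat \<Rightarrow> nat \<Rightarrow> real) \<Rightarrow> nat \<Rightarrow> nat \<Rightarrow> real" where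
  "reflect n p w z = (\<lambda>i\<in>{..<n}. \<lambda>a\<in>{..<p}. z i a - 2 * w i * (\<Sum>k<n. w k * z k a))"

text \<open>Product measures are determined by boxes, and the preimage of a box under a
  componentwise map is a box. For translations of matrices this is applied twice, to the entries of
  a row and to the rows.\<close>

lemma distr_PiM_componentwise:
  assumes I: "finite I" and sf: "\<And>i. sigma_finite_measure (M i)"
    and t: "\<And>i. i \<in> I \<Longrightarrow> t i \<in> measurable (M i) (M i)"
    and inv: "\<And>i. i \<in> I \<Longrightarrow> distr (M i) (M i) (t i) = M i"
  shows "distr (PiM I M) (PiM I M) (\<lambda>x. \<lambda>i\<in>I. t i (x i)) = PiM I M"
proof -
  interpret product_sigma_finite M unfolding product_sigma_finite_def using sf by auto
  have meas: "(\<lambda>x. \<lambda>i\<in>I. t i (x i)) \<in> measurable (PiM I M) (PiM I M)"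
  proof (rule measurable_restrict)
    fix i assume i: "i \<in> I"
    show "(\<lambda>x. t i (x i)) \<in> measurable (PiM I M) (M i)"
      by (rule measurable_compose[where f = "\<lambda>x. x i" and g = "t i", OF measurable_component_singleton[OF i, of M] t[OF i]])
  qed
  show ?thesis
  proof (rule PiM_eqI[OF I])
    fix A assume A: "\<And>i. i \<in> I \<Longrightarrow> A i \<in> sets (M i)"
    have "(\<lambda>x. \<lambda>i\<in>I. t i (x i)) -` Pi\<^sub>E I A \<inter> space (PiM I M) = (\<Pi>\<^sub>E i\<in>I. t i -` A i \<inter> space (M i))"
      by (auto simp: space_PiM PiE_iff)
    then have "emeasure (distr (PiM I M) (PiM I M) (\<lambda>x. \<lambda>i\<in>I. t i (x i))) (Pi\<^sub>E I A) =
        emeasure (PiM I M) (\<Pi>\<^sub>E i\<in>I. t i -` A i \<inter> space (M i))"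
      using A I by (subst emeasure_distr[OF meas]) (auto intro!: sets_PiM_I_finite)
    also have "\<dots> = (\<Prod>i\<in>I. emeasure (M i) (t i -` A i \<inter> space (M i)))"
      using A t I by (intro emeasure_PiM) auto
    also have "\<dots> = (\<Prod>i\<in>I. emeasure (M i) (A i))"
      using A t inv by (intro prod.cong refl) (metis emeasure_distr)
    finally show "emeasure (distr (PiM I M) (PiM I M) (\<lambda>x. \<lambda>i\<in>I. t i (x i))) (Pi\<^sub>E I A) =
      (\<Prod>i\<in>I. emeasure (M i) (A i))" .
  qed simp
qed

lemma sigma_finite_PiM_lborel: "sigma_finite_measure (PiM {..<p::nat} (\<lambda>_. lborel :: real measure))"
proof -
  interpret product_sigma_finite "\<lambda>_::nat. lborel :: real measure" ..
  show ?thesis by (rule sigma_finite) simp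
qed

lemma sigma_finite_lborel_mat: "sigma_finite_measure (lborel_mat n p)"
proof -
  interpret product_sigma_finite "\<lambda>_::nat. PiM {..<p::nat} (\<lambda>_. lborel :: real measure)"
    unfolding product_sigma_finite_def using sigma_finite_PiM_lborel by auto
  show ?thesis by (rule sigma_finite) simp
qed

lemma lborel_mat_entry[measurable (raw)]:
  assumes "f \<in> measurable N (lborel_mat n p)" "i < n" "a < p"
  shows "(\<lambda>x. f x i a) \<in> borel_measurable N"
proof -
  have "(\<lambda>x. f x i) \<in> measurable N (PiM {..<p} (\<lambda>_. lborel))"
    by (rule measurable_compose[OF assms(1) measurable_component_singleton]) (use assms(2) in simp)
  then have "(\<lambda>x. f x i a) \<in> measurable N lborel"
    by (rule measurable_compose[OF _ measurable_component_singleton]) (use assms(3) in simp)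
  then show ?thesis by simp
qed

lemma lborel_mat_measurableI:
  assumes "\<And>i a. i < n \<Longrightarrow> a < p \<Longrightarrow> (\<lambda>x. F x i a) \<in> borel_measurable N"
  shows "(\<lambda>x. \<lambda>i\<in>{..<n}. \<lambda>a\<in>{..<p}. F x i a) \<in> measurable N (lborel_mat n p)"
  by (intro measurable_restrict) (use assms in auto)

lemma space_lborel_mat: "space (lborel_mat n p) = ({..<n} \<rightarrow>\<^sub>E ({..<p} \<rightarrow>\<^sub>E UNIV))"
  by (auto simp: space_PiM)

text \<open>Points of the space are \<open>undefined\<close> outside the index ranges, so agreement
  inside is enough.\<close>

lemma lborel_mat_eqI:
  assumes "x \<in> space (lborel_mat n p)" "y \<in> space (lborel_mat n p)"
    and "\<And>i a. i < n \<Longrightarrow> a < p \<Longrightarrow> x i a = y i a"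
  shows "x = y"
proof (rule ext)
  fix i
  show "x i = y i"
  proof (cases "i < n")
    case True
    then have "x i \<in> {..<p} \<rightarrow>\<^sub>E UNIV" "y i \<in> {..<p} \<rightarrow>\<^sub>E UNIV"
      using assms(1,2) unfolding space_lborel_mat by auto
    then show ?thesis using assms(3)[OF True] by (intro PiE_ext) auto
  next
    case False
    then show ?thesis using assms(1,2) unfolding space_lborel_mat by (auto simp: PiE_def extensional_def)
  qed
qed

lemma translate_measurable[measurable (raw)]:
  assumes "\<And>i a. i < n \<Longrightarrow> a < p \<Longrightarrow> (\<lambda>x. s x i a) \<in> borel_measurable N" "z \<in> measurable N (lborel_mat n p)"
  shows "(\<lambda>x. translate n p (s x) (z x)) \<in> measurable N (lborel_mat n p)"
  unfolding translate_def using assms(1)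
  by (intro lborel_mat_measurableI borel_measurable_add lborel_mat_entry[OF assms(2)])

lemma reflect_measurable[measurable (raw)]:
  assumes "z \<in> measurable N (lborel_mat n p)"
  shows "(\<lambda>x. reflect n p w (z x)) \<in> measurable N (lborel_mat n p)"
  unfolding reflect_def using assms
  by (intro lborel_mat_measurableI borel_measurable_diff borel_measurable_times borel_measurable_sum
      borel_measurable_const lborel_mat_entry[of z N n p]) auto

lemma translate_apply: "i < n \<Longrightarrow> a < p \<Longrightarrow> translate n p s z i a = z i a + s i a"
  by (simp add: translate_def)

lemma reflect_apply: "i < n \<Longrightarrow> a < p \<Longrightarrow> reflect n p w z i a = z i a - 2 * w i * (\<Sum>k<n. w k * z k a)"
  by (simp add: reflect_def)

lemma translate_space[simp]: "translate n p s z \<in> space (lborel_mat n p)"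
  by (auto simp: translate_def space_lborel_mat)

lemma reflect_space[simp]: "reflect n p w z \<in> space (lborel_mat n p)"
  by (auto simp: reflect_def space_lborel_mat)

section \<open>Invariance of the reference measure\<close>

lemma distr_lborel_mat_translate: "distr (lborel_mat n p) (lborel_mat n p) (translate n p s) = lborel_mat n p"
proof -
  have tr: "distr lborel lborel (\<lambda>x :: real. x + c) = lborel" for c
  proof -
    have "distr lborel lborel (\<lambda>x :: real. x + c) = distr lborel borel ((+) c)"
      by (intro distr_cong) (auto simp: add.commute)
    then show ?thesis by (simp add: lborel_distr_plus)
  qed
  have row: "distr (PiM {..<p} (\<lambda>_. lborel)) (PiM {..<p} (\<lambda>_. lborel)) (\<lambda>x. \<lambda>a\<in>{..<p}. x a + s i a)
      = PiM {..<p} (\<lambda>_. lborel :: real measure)" for i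
    by (rule distr_PiM_componentwise[where t = "\<lambda>a x. x + s i a"])
      (auto simp: lborel.sigma_finite_measure_axioms tr)
  show ?thesis
    unfolding translate_def
    by (rule distr_PiM_componentwise[where t = "\<lambda>i x. \<lambda>a\<in>{..<p}. x a + s i a"])
      (auto simp: sigma_finite_PiM_lborel row intro!: measurable_restrict)
qed

lemma nn_integral_lborel_mat_translate:
  assumes [measurable]: "f \<in> borel_measurable (lborel_mat n p)"
  shows "(\<integral>\<^sup>+ z. f (translate n p s z) \<partial>lborel_mat n p) = (\<integral>\<^sup>+ z. f z \<partial>lborel_mat n p)"
proof -
  have "(\<integral>\<^sup>+ z. f z \<partial>lborel_mat n p) = (\<integral>\<^sup>+ z. f z \<partial>distr (lborel_mat n p) (lborel_mat n p) (translate n p s))"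
    unfolding distr_lborel_mat_translate ..
  also have "\<dots> = (\<integral>\<^sup>+ z. f (translate n p s z) \<partial>lborel_mat n p)"
    by (subst nn_integral_distr) (auto intro!: translate_measurable)
  finally show ?thesis ..
qed

lemma reflect_translate:
  "reflect n p w (translate n p y x) = translate n p (reflect n p w y) (reflect n p w x)"
  by (rule lborel_mat_eqI[of _ n p])
    (simp_all add: reflect_apply translate_apply sum.distrib algebra_simps)

lemma reflect_reflect:
  assumes w: "(\<Sum>k<n. w k * w k) = 1" and x: "x \<in> space (lborel_mat n p)"
  shows "reflect n p w (reflect n p w x) = x"
proof (rule lborel_mat_eqI[of _ n p])
  fix i a assume ia: "i < n" "a < p"
  define L where "L = (\<Sum>k<n. w k * x k a)"
  have "(\<Sum>k<n. w k * reflect n p w x k a) = (\<Sum>k<n. w k * x k a - 2 * L * (w k * w k))"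
    using ia unfolding L_def by (intro sum.cong) (auto simp: reflect_apply algebra_simps)
  also have "\<dots> = L - 2 * L * (\<Sum>k<n. w k * w k)"
    unfolding L_def by (simp add: sum_subtractf sum_distrib_left)
  also have "\<dots> = - L" using w by simp
  finally show "reflect n p w (reflect n p w x) i a = x i a"
    using ia by (simp add: reflect_apply[of i n a p w "reflect n p w x"]) (simp add: reflect_apply L_def)
qed (use x in auto)

text \<open>The translation-invariant measure is the only one up to a factor; an even density that is
  invariant under the reflection shows that the factor is \<open>1\<close>.\<close>

lemma nn_integral_lborel_mat_reflect:
  assumes w: "(\<Sum>k<n. w k * w k) = 1"
    and [measurable]: "f \<in> borel_measurable (lborel_mat n p)" "g \<in> borel_measurable (lborel_mat n p)"
    and g1: "(\<integral>\<^sup>+ z. g z \<partial>lborel_mat n p) = 1"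
    and g_reflect: "\<And>z. z \<in> space (lborel_mat n p) \<Longrightarrow> g (reflect n p w z) = g z"
    and g_even: "\<And>y z. y \<in> space (lborel_mat n p) \<Longrightarrow> z \<in> space (lborel_mat n p) \<Longrightarrow>
      g (translate n p (\<lambda>i a. - y i a) z) = g (translate n p (\<lambda>i a. - z i a) y)"
  shows "(\<integral>\<^sup>+ z. f (reflect n p w z) \<partial>lborel_mat n p) = (\<integral>\<^sup>+ z. f z \<partial>lborel_mat n p)"
proof -
  interpret sigma_finite_measure "lborel_mat n p" by (rule sigma_finite_lborel_mat)
  interpret pair_sigma_finite "lborel_mat n p" "lborel_mat n p" ..
  let ?T = "reflect n p w" and ?L = "lborel_mat n p"
  \<comment> \<open>The factor with integral 1 brings in a second variable \<open>y\<close>; a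
    translation by \<open>?T y\<close> then turns \<open>f (?T x)\<close> into a function of
    \<open>?T x + y\<close>.\<close>
  have "(\<integral>\<^sup>+ z. f (?T z) \<partial>?L) = (\<integral>\<^sup>+ x. f (?T x) \<partial>?L) * (\<integral>\<^sup>+ y. g y \<partial>?L)"
    by (simp add: g1)
  also have "\<dots> = (\<integral>\<^sup>+ y. (\<integral>\<^sup>+ x. f (?T x) \<partial>?L) * g y \<partial>?L)"
    by (simp add: nn_integral_cmult)
  also have "\<dots> = (\<integral>\<^sup>+ y. (\<integral>\<^sup>+ x. f (translate n p y (?T x)) * g y \<partial>?L) \<partial>?L)"
  proof (rule nn_integral_cong)
    fix y assume y: "y \<in> space ?L"
    have "(\<integral>\<^sup>+ x. f (?T x) \<partial>?L) = (\<integral>\<^sup>+ x. f (?T (translate n p (?T y) x)) \<partial>?L)"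
      by (rule nn_integral_lborel_mat_translate[symmetric]) measurable
    also have "\<dots> = (\<integral>\<^sup>+ x. f (translate n p y (?T x)) \<partial>?L)"
      by (simp add: reflect_translate reflect_reflect[OF w y])
    finally show "(\<integral>\<^sup>+ x. f (?T x) \<partial>?L) * g y = (\<integral>\<^sup>+ x. f (translate n p y (?T x)) * g y \<partial>?L)"
      by (simp add: nn_integral_multc)
  qed
  also have "\<dots> = (\<integral>\<^sup>+ x. (\<integral>\<^sup>+ y. f (translate n p y (?T x)) * g y \<partial>?L) \<partial>?L)"
    by (rule Fubini') measurable
  \<comment> \<open>After the exchange of the integrals, shifting \<open>y\<close> back by
    \<open>?T x\<close> moves the reflection from \<open>f\<close> to \<open>g\<close>.\<close>
  also have "\<dots> = (\<integral>\<^sup>+ x. (\<integral>\<^sup>+ y. f y * g (translate n p (\<lambda>i a. - ?T x i a) y) \<partial>?L) \<partial>?L)"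
  proof (rule nn_integral_cong)
    fix x assume x: "x \<in> space ?L"
    let ?h = "\<lambda>y. f y * g (translate n p (\<lambda>i a. - ?T x i a) y)"
    have "(\<integral>\<^sup>+ y. ?h y \<partial>?L) = (\<integral>\<^sup>+ y. ?h (translate n p (?T x) y) \<partial>?L)"
      by (rule nn_integral_lborel_mat_translate[symmetric]) measurable
    also have "\<dots> = (\<integral>\<^sup>+ y. f (translate n p y (?T x)) * g y \<partial>?L)"
    proof (rule nn_integral_cong)
      fix y assume y: "y \<in> space ?L"
      have "translate n p (\<lambda>i a. - ?T x i a) (translate n p (?T x) y) = y"
        using y by (intro lborel_mat_eqI[of _ n p]) (simp_all add: translate_apply)
      moreover have "translate n p (?T x) y = translate n p y (?T x)"
        by (intro lborel_mat_eqI[of _ n p]) (simp_all add: translate_apply)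
      ultimately show "?h (translate n p (?T x) y) = f (translate n p y (?T x)) * g y" by simp
    qed
    finally show "(\<integral>\<^sup>+ y. f (translate n p y (?T x)) * g y \<partial>?L) = (\<integral>\<^sup>+ y. ?h y \<partial>?L)" ..
  qed
  also have "\<dots> = (\<integral>\<^sup>+ y. (\<integral>\<^sup>+ x. f y * g (translate n p (\<lambda>i a. - ?T x i a) y) \<partial>?L) \<partial>?L)"
    by (rule Fubini'[symmetric]) measurable
  also have "\<dots> = (\<integral>\<^sup>+ y. f y \<partial>?L)"
  proof (rule nn_integral_cong)
    fix y assume y: "y \<in> space ?L"
    \<comment> \<open>Both symmetries of \<open>g\<close> enter here: in additive notation,
      \<open>g (y - ?T x) = g (?T y - x) = g (x - ?T y)\<close>. The integral over \<open>x\<close>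
      is then that of a translate of \<open>g\<close>, hence 1.\<close>
    have "g (translate n p (\<lambda>i a. - ?T x i a) y) = g (translate n p (\<lambda>i a. - ?T y i a) x)"
      if x: "x \<in> space ?L" for x
    proof -
      have "?T (translate n p (\<lambda>i a. - ?T x i a) y) = translate n p (\<lambda>i a. - ?T (?T x) i a) (?T y)"
        by (rule lborel_mat_eqI[of _ n p])
          (simp_all add: reflect_translate, simp add: reflect_apply translate_apply sum_negf sum_subtractf algebra_simps)
      then have "g (translate n p (\<lambda>i a. - ?T x i a) y) = g (translate n p (\<lambda>i a. - x i a) (?T y))"
        using g_reflect[of "translate n p (\<lambda>i a. - ?T x i a) y"] reflect_reflect[OF w x] by simp
      also have "\<dots> = g (translate n p (\<lambda>i a. - ?T y i a) x)" using x by (intro g_even) auto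
      finally show ?thesis .
    qed
    then have "(\<integral>\<^sup>+ x. f y * g (translate n p (\<lambda>i a. - ?T x i a) y) \<partial>?L) =
        (\<integral>\<^sup>+ x. f y * g (translate n p (\<lambda>i a. - ?T y i a) x) \<partial>?L)"
      by (intro nn_integral_cong) simp
    also have "\<dots> = f y * (\<integral>\<^sup>+ x. g (translate n p (\<lambda>i a. - ?T y i a) x) \<partial>?L)"
      by (rule nn_integral_cmult) measurable
    also have "\<dots> = f y" by (subst nn_integral_lborel_mat_translate) (simp_all add: g1)
    finally show "(\<integral>\<^sup>+ x. f y * g (translate n p (\<lambda>i a. - ?T x i a) y) \<partial>?L) = f y" .
  qed
  finally show ?thesis .
qed

section \<open>Gaussian noise\<close>

abbreviation noise_mat :: "nat \<Rightarrow> nat \<Rightarrow> (nat \<Rightarrow> nat \<Rightarrow> real) \<Rightarrow> real mat" where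
  "noise_mat n p z \<equiv> Matrix.mat n p (\<lambda>(i, a). z i a)"

text \<open>The trace of \<open>K\<close> times the Gram matrix of the columns, which is also the
  sum over the rows of their forms with matrix \<open>K\<close>. In this arrangement the noise
  enters only through inner products of columns, and these are preserved by reflections.\<close>

definition noise_qf :: "real mat \<Rightarrow> nat \<Rightarrow> nat \<Rightarrow> (nat \<Rightarrow> nat \<Rightarrow> real) \<Rightarrow> real" where
  "noise_qf K n p z = (\<Sum>a<p. \<Sum>b<p. K $$ (a, b) * (\<Sum>i<n. z i a * z i b))"

lemma noise_qf_measurable[measurable]: "noise_qf K n p \<in> borel_measurable (lborel_mat n p)"
  unfolding noise_qf_def
  by (intro borel_measurable_sum borel_measurable_times borel_measurable_const lborel_mat_entry[of "\<lambda>z. z" _ n p]) auto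

lemma noise_qf_reflect:
  assumes w: "(\<Sum>k<n. w k * w k) = 1"
  shows "noise_qf K n p (reflect n p w z) = noise_qf K n p z"
proof -
  define L where "L a = (\<Sum>k<n. w k * z k a)" for a
  have "(\<Sum>i<n. reflect n p w z i a * reflect n p w z i b) = (\<Sum>i<n. z i a * z i b)" if "a < p" "b < p" for a b
  proof -
    have "(\<Sum>i<n. reflect n p w z i a * reflect n p w z i b) =
      (\<Sum>i<n. z i a * z i b - 2 * L b * (w i * z i a) - 2 * L a * (w i * z i b) + 4 * L a * L b * (w i * w i))"
      using that unfolding L_def by (intro sum.cong) (auto simp: reflect_apply algebra_simps)
    also have "\<dots> = (\<Sum>i<n. z i a * z i b) - 2 * L b * L a - 2 * L a * L b + 4 * L a * L b * (\<Sum>i<n. w i * w i)"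
      unfolding L_def by (simp add: sum_subtractf sum.distrib sum_distrib_left)
    also have "\<dots> = (\<Sum>i<n. z i a * z i b)" unfolding w by simp
    finally show ?thesis .
  qed
  then show ?thesis unfolding noise_qf_def by simp
qed

lemma noise_qf_even:
  "noise_qf K n p (translate n p (\<lambda>i a. - y i a) z) = noise_qf K n p (translate n p (\<lambda>i a. - z i a) y)"
proof -
  have "(\<Sum>i<n. translate n p (\<lambda>i a. - y i a) z i a * translate n p (\<lambda>i a. - y i a) z i b) =
      (\<Sum>i<n. translate n p (\<lambda>i a. - z i a) y i a * translate n p (\<lambda>i a. - z i a) y i b)"
    if "a < p" "b < p" for a b
    using that by (intro sum.cong) (auto simp: translate_apply algebra_simps)
  then show ?thesis unfolding noise_qf_def by simp
qed

text \<open>Completing the square for a shift by \<open>t\<close> times the outer product of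
  \<open>u\<close> and \<open>\<beta>\<close>. With \<open>K \<beta> = \<alpha>\<close> given
  beforehand, the cross term is a linear form of the noise that involves only \<open>u\<close> and
  \<open>\<alpha>\<close>.\<close>

lemma noise_qf_translate:
  assumes K: "\<And>a b. a < p \<Longrightarrow> b < p \<Longrightarrow> K $$ (a, b) = K $$ (b, a)"
    and \<beta>: "\<And>a. a < p \<Longrightarrow> (\<Sum>b<p. K $$ (a, b) * \<beta> b) = \<alpha> a"
  shows "noise_qf K n p (translate n p (\<lambda>i a. t * (u i * \<beta> a)) z) =
    noise_qf K n p z + 2 * t * (\<Sum>a<p. \<alpha> a * (\<Sum>i<n. u i * z i a))
      + t\<^sup>2 * (\<Sum>i<n. u i * u i) * (\<Sum>a<p. \<alpha> a * \<beta> a)"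
proof -
  define U where "U a = (\<Sum>i<n. u i * z i a)" for a
  define u2 where "u2 = (\<Sum>i<n. u i * u i)"
  have ent: "(\<Sum>i<n. translate n p (\<lambda>i a. t * (u i * \<beta> a)) z i a * translate n p (\<lambda>i a. t * (u i * \<beta> a)) z i b)
      = (\<Sum>i<n. z i a * z i b) + t * (\<beta> b * U a) + t * (\<beta> a * U b) + t\<^sup>2 * u2 * (\<beta> a * \<beta> b)"
    if "a < p" "b < p" for a b
  proof -
    have "(\<Sum>i<n. translate n p (\<lambda>i a. t * (u i * \<beta> a)) z i a * translate n p (\<lambda>i a. t * (u i * \<beta> a)) z i b)
      = (\<Sum>i<n. z i a * z i b + t * \<beta> b * (u i * z i a) + t * \<beta> a * (u i * z i b)
          + t\<^sup>2 * (\<beta> a * \<beta> b) * (u i * u i))"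
      using that by (intro sum.cong) (auto simp: translate_apply power2_eq_square algebra_simps)
    also have "\<dots> = (\<Sum>i<n. z i a * z i b) + t * \<beta> b * U a + t * \<beta> a * U b + t\<^sup>2 * (\<beta> a * \<beta> b) * u2"
      unfolding U_def u2_def by (simp add: sum.distrib sum_distrib_left)
    finally show ?thesis by (simp add: mult_ac)
  qed
  have 1: "(\<Sum>a<p. \<Sum>b<p. K $$ (a, b) * (\<beta> b * U a)) = (\<Sum>a<p. \<alpha> a * U a)"
    by (intro sum.cong refl) (simp add: \<beta>[symmetric] sum_distrib_left sum_distrib_right mult_ac)
  have 2: "(\<Sum>a<p. \<Sum>b<p. K $$ (a, b) * (\<beta> a * U b)) = (\<Sum>a<p. \<alpha> a * U a)"
    unfolding 1[symmetric] by (subst sum.swap) (auto simp: K intro!: sum.cong)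
  have 3: "(\<Sum>a<p. \<Sum>b<p. K $$ (a, b) * (\<beta> a * \<beta> b)) = (\<Sum>a<p. \<alpha> a * \<beta> a)"
    by (intro sum.cong refl) (simp add: \<beta>[symmetric] sum_distrib_left sum_distrib_right mult_ac)
  have "noise_qf K n p (translate n p (\<lambda>i a. t * (u i * \<beta> a)) z) =
    (\<Sum>a<p. \<Sum>b<p. K $$ (a, b) * (\<Sum>i<n. z i a * z i b) + t * (K $$ (a, b) * (\<beta> b * U a))
      + t * (K $$ (a, b) * (\<beta> a * U b)) + t\<^sup>2 * u2 * (K $$ (a, b) * (\<beta> a * \<beta> b)))"
    unfolding noise_qf_def by (intro sum.cong refl)
      (simp only: lessThan_iff ent, simp add: distrib_left mult_ac)
  also have "\<dots> = noise_qf K n p z + t * (\<Sum>a<p. \<alpha> a * U a) + t * (\<Sum>a<p. \<alpha> a * U a)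
      + t\<^sup>2 * u2 * (\<Sum>a<p. \<alpha> a * \<beta> a)"
    unfolding noise_qf_def by (simp only: sum.distrib sum_distrib_left[symmetric] 1 2 3)
  finally show ?thesis unfolding U_def u2_def by simp
qed

section \<open>Almost sure nonsingularity\<close>

lemma det_measurable:
  assumes "\<And>x. A x \<in> carrier_mat p p"
    and "\<And>i j. i < p \<Longrightarrow> j < p \<Longrightarrow> (\<lambda>x. A x $$ (i, j)) \<in> borel_measurable N"
  shows "(\<lambda>x. det (A x)) \<in> borel_measurable N"
  unfolding det_def'[OF assms(1)]
  by (intro borel_measurable_sum borel_measurable_times borel_measurable_const borel_measurable_prod
      assms(2)) (auto simp: permutes_in_image)

text \<open>Along the line \<open>z + t D\<close> the determinant is a characteristic polynomial in \<open>t\<close>, hence has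
  finitely many zeros, and the reference measure is invariant under translation.\<close>

lemma det_noise_null:
  assumes A: "A \<in> carrier_mat p n" and D: "D \<in> carrier_mat n p" and AD: "A * D = 1\<^sub>m p"
  shows "AE z in lborel_mat n p. det (A * noise_mat n p z) \<noteq> 0"
proof -
  interpret L: sigma_finite_measure "lborel_mat n p" by (rule sigma_finite_lborel_mat)
  interpret pair_sigma_finite lborel "lborel_mat n p" ..
  let ?L = "lborel_mat n p"
  define B where "B z = (if det (A * noise_mat n p z) = 0 then 1 else 0 :: ennreal)" for z
  define s where "s t = (\<lambda>i a. t * D $$ (i, a))" for t :: real
  have det_meas: "(\<lambda>z. det (A * noise_mat n p z)) \<in> borel_measurable ?L"
  proof (rule det_measurable)
    fix i j assume ij: "i < p" "j < p"
    have "(\<lambda>z. (A * noise_mat n p z) $$ (i, j)) = (\<lambda>z. \<Sum>k<n. A $$ (i, k) * z k j)"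
      using ij A by (auto simp: scalar_prod_def lessThan_atLeast0 intro!: sum.cong)
    then show "(\<lambda>z. (A * noise_mat n p z) $$ (i, j)) \<in> borel_measurable ?L"
      by (rule ssubst) (intro borel_measurable_sum borel_measurable_times borel_measurable_const
          lborel_mat_entry[of "\<lambda>z. z" _ n p], use ij in auto)
  qed (use A in auto)
  note [measurable] = det_meas
  have B_meas[measurable]: "B \<in> borel_measurable ?L" unfolding B_def by measurable
  have zero: "(\<integral>\<^sup>+ t. B (translate n p (s t) z) * indicator {0..1} t \<partial>lborel) = 0" for z
  proof -
    define C where "C = A * noise_mat n p z"
    have C: "C \<in> carrier_mat p p" unfolding C_def using A by auto
    have "A * noise_mat n p (translate n p (s t) z) = char_matrix C (- t)" for t
    proof -
      have "noise_mat n p (translate n p (s t) z) = noise_mat n p z + t \<cdot>\<^sub>m D"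
        using D by (intro eq_matI) (auto simp: translate_apply s_def)
      then have "A * noise_mat n p (translate n p (s t) z) = C + t \<cdot>\<^sub>m (A * D)"
        using A D unfolding C_def
        by (simp add: mult_add_distrib_mat[of _ p n _ p] mult_smult_distrib[of _ p n _ p])
      then show ?thesis using C AD unfolding char_matrix_def by simp
    qed
    moreover have "t \<in> uminus ` spectrum C \<longleftrightarrow> eigenvalue C (- t)" for t
      unfolding spectrum_def by (auto simp: image_iff intro!: exI[of _ "- t"])
    ultimately have eq: "B (translate n p (s t) z) = indicator (uminus ` spectrum C) t" for t
      unfolding B_def using eigenvalue_det[OF C, of "- t"] by (auto simp: indicator_def)
    have fin: "finite (uminus ` spectrum C)" using card_finite_spectrum[OF C] by simp
    have "(\<integral>\<^sup>+ t. B (translate n p (s t) z) * indicator {0..1} t \<partial>lborel)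
        \<le> (\<integral>\<^sup>+ t. indicator (uminus ` spectrum C) t \<partial>lborel)"
      by (intro nn_integral_mono) (auto simp: eq indicator_def)
    also have "\<dots> = 0" using fin by (simp add: finite_imp_closed emeasure_lborel_countable countable_finite)
    finally show ?thesis by simp
  qed
  have s_meas: "(\<lambda>x. translate n p (s (fst x)) (snd x)) \<in> measurable (lborel \<Otimes>\<^sub>M ?L) ?L"
    unfolding s_def by (intro translate_measurable) auto
  \<comment> \<open>The indicator has integral 1. It averages the translation-invariant integral
    over shifts \<open>t\<close> in the unit interval, after which the order of integration can be
    exchanged.\<close>
  have "(\<integral>\<^sup>+ z. B z \<partial>?L) = (\<integral>\<^sup>+ t. (\<integral>\<^sup>+ z. B z \<partial>?L) * indicator {0..1::real} t \<partial>lborel)"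
    by (simp add: nn_integral_cmult)
  also have "\<dots> = (\<integral>\<^sup>+ t. (\<integral>\<^sup>+ z. B (translate n p (s t) z) * indicator {0..1} t \<partial>?L) \<partial>lborel)"
    by (intro nn_integral_cong, subst nn_integral_multc)
      (auto simp: nn_integral_lborel_mat_translate intro!: measurable_compose[OF _ B_meas] translate_measurable)
  also have "\<dots> = (\<integral>\<^sup>+ z. (\<integral>\<^sup>+ t. B (translate n p (s t) z) * indicator {0..1} t \<partial>lborel) \<partial>?L)"
    using measurable_compose[OF s_meas B_meas]
    by (intro Fubini'[symmetric]) (auto simp: case_prod_beta')
  also have "\<dots> = 0" unfolding zero by simp
  finally have "AE z in ?L. B z = 0" by (subst (asm) nn_integral_0_iff_AE) auto
  then show ?thesis by eventually_elim (auto simp: B_def split: if_splits)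
qed

text \<open>Second moments are bounded through exponential moments at two opposite arguments. In the
  sum of \<open>exp x \<ge> 1 + x + x^2 / 2\<close> and \<open>exp (- x) \<ge> 1 - x\<close> the
  linear terms cancel.\<close>

lemma square_le_exp: "(x :: real)\<^sup>2 \<le> 2 * (exp x + exp (- x))"
proof -
  have *: "x\<^sup>2 \<le> 2 * (exp x + exp (- x))" if "x \<ge> 0" for x :: real
  proof -
    have "1 + x + x\<^sup>2 / 2 \<le> exp x" using exp_lower_Taylor_quadratic[OF that] by simp
    moreover have "1 - x \<le> exp (- x)" using exp_ge_add_one_self[of "- x"] by simp
    ultimately show ?thesis by simp
  qed
  show ?thesis using *[of x] *[of "- x"] by (cases "x \<ge> 0") auto
qed

text \<open>The joint density of all rows replaces their independence. The factor \<open>c\<close>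
  is left abstract: what matters about it is fixed by the total mass one.\<close>

locale gaussian_noise = prob_space M for M :: "'a measure" +
  fixes n p :: nat and S :: "real mat" and E :: "'a \<Rightarrow> nat \<Rightarrow> nat \<Rightarrow> real" and c :: real
  assumes S: "pos_def p S"
    and E_meas[measurable]: "E \<in> measurable M (lborel_mat n p)"
    and c: "c \<ge> 0"
    and E_law: "distr M (lborel_mat n p) E =
      density (lborel_mat n p) (\<lambda>z. ennreal (c * exp (- noise_qf (inv_mat S) n p z / 2)))"
begin

abbreviation "dens z \<equiv> ennreal (c * exp (- noise_qf (inv_mat S) n p z / 2))"
abbreviation "Z x \<equiv> noise_mat n p (E x)"

lemma S_inv:
  "S \<in> carrier_mat p p" "inv_mat S \<in> carrier_mat p p" "S * inv_mat S = 1\<^sub>m p" "inv_mat S * S = 1\<^sub>m p"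
  "(inv_mat S)\<^sup>T = inv_mat S"
proof -
  have S': "S \<in> carrier_mat p p" "S\<^sup>T = S" using S unfolding pos_def_def by auto
  have d: "det S \<noteq> 0" using pos_def_det[OF S] by simp
  show "S \<in> carrier_mat p p" by fact
  show "inv_mat S \<in> carrier_mat p p" "S * inv_mat S = 1\<^sub>m p" "inv_mat S * S = 1\<^sub>m p"
    using inv_mat[OF S'(1) d] by auto
  show "(inv_mat S)\<^sup>T = inv_mat S" by (rule inv_mat_transpose[OF S'(1) d S'(2)])
qed

lemma nn_integral_noise:
  assumes [measurable]: "f \<in> borel_measurable (lborel_mat n p)"
  shows "(\<integral>\<^sup>+ x. f (E x) \<partial>M) = (\<integral>\<^sup>+ z. dens z * f z \<partial>lborel_mat n p)"
proof -
  have "(\<integral>\<^sup>+ x. f (E x) \<partial>M) = (\<integral>\<^sup>+ z. f z \<partial>distr M (lborel_mat n p) E)"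
    by (subst nn_integral_distr) auto
  also have "\<dots> = (\<integral>\<^sup>+ z. dens z * f z \<partial>lborel_mat n p)"
    unfolding E_law by (subst nn_integral_density) auto
  finally show ?thesis .
qed

lemma nn_integral_dens: "(\<integral>\<^sup>+ z. dens z \<partial>lborel_mat n p) = 1"
  using nn_integral_noise[of "\<lambda>_. 1"] emeasure_space_1 by simp

text \<open>The density plays two roles: it is the weight in the integral, and it is the even and
  reflection-invariant function of integral 1 that the invariance of the reference measure asks
  for.\<close>

lemma noise_reflect:
  assumes w: "(\<Sum>k<n. w k * w k) = 1" and [measurable]: "f \<in> borel_measurable (lborel_mat n p)"
  shows "(\<integral>\<^sup>+ x. f (reflect n p w (E x)) \<partial>M) = (\<integral>\<^sup>+ x. f (E x) \<partial>M)"
proof -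
  have "(\<integral>\<^sup>+ x. f (reflect n p w (E x)) \<partial>M) = (\<integral>\<^sup>+ z. dens z * f (reflect n p w z) \<partial>lborel_mat n p)"
    by (rule nn_integral_noise) measurable
  also have "\<dots> = (\<integral>\<^sup>+ z. dens (reflect n p w z) * f (reflect n p w z) \<partial>lborel_mat n p)"
    by (simp add: noise_qf_reflect[OF w])
  also have "\<dots> = (\<integral>\<^sup>+ z. dens z * f z \<partial>lborel_mat n p)"
  proof (rule nn_integral_lborel_mat_reflect[where f = "\<lambda>z. dens z * f z" and g = dens, OF w])
    show "dens (reflect n p w z) = dens z" for z by (simp only: noise_qf_reflect[OF w])
    show "dens (translate n p (\<lambda>i a. - y i a) z) = dens (translate n p (\<lambda>i a. - z i a) y)" for y z
      by (subst noise_qf_even) (rule HOL.refl)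
  qed (use nn_integral_dens in simp_all)
  also have "\<dots> = (\<integral>\<^sup>+ x. f (E x) \<partial>M)" by (rule nn_integral_noise[symmetric]) measurable
  finally show ?thesis .
qed

lemma AE_det_noise:
  assumes "A \<in> carrier_mat p n" "D \<in> carrier_mat n p" "A * D = 1\<^sub>m p"
  shows "AE x in M. det (A * Z x) \<noteq> 0"
proof -
  have "AE z in lborel_mat n p. det (A * noise_mat n p z) \<noteq> 0" by (rule det_noise_null[OF assms])
  then have "AE z in density (lborel_mat n p) dens. det (A * noise_mat n p z) \<noteq> 0"
    by (subst AE_density) auto
  then have "AE z in distr M (lborel_mat n p) E. det (A * noise_mat n p z) \<noteq> 0"
    unfolding E_law .
  then show ?thesis by (rule AE_distrD[OF E_meas])
qed

lemma linear_form_measurable: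
  assumes "u \<in> carrier_vec n" "\<alpha> \<in> carrier_vec p"
  shows "(\<lambda>z. u \<bullet> (noise_mat n p z *\<^sub>v \<alpha>)) \<in> borel_measurable (lborel_mat n p)"
proof -
  have "(\<lambda>z. u \<bullet> (noise_mat n p z *\<^sub>v \<alpha>)) = (\<lambda>z. \<Sum>i<n. u $ i * (\<Sum>a<p. z i a * \<alpha> $ a))"
    using assms by (auto simp: scalar_prod_def lessThan_atLeast0 intro!: sum.cong)
  then show ?thesis
    by (rule ssubst) (intro borel_measurable_sum borel_measurable_times borel_measurable_const
        lborel_mat_entry[of "\<lambda>z. z" _ n p], auto)
qed

text \<open>Translating the noise by \<open>t u (S \<alpha>)\<^sup>T\<close> multiplies its density by
  \<open>exp (- t u \<bullet> Z \<alpha> - t\<^sup>2 |u|\<^sup>2 \<alpha> \<bullet> S \<alpha> / 2)\<close>.\<close>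

lemma noise_mgf:
  assumes u: "u \<in> carrier_vec n" and \<alpha>: "\<alpha> \<in> carrier_vec p"
  shows "(\<integral>\<^sup>+ x. ennreal (exp (- t * (u \<bullet> (Z x *\<^sub>v \<alpha>)))) \<partial>M) =
    ennreal (exp (t\<^sup>2 * (u \<bullet> u) * (\<alpha> \<bullet> (S *\<^sub>v \<alpha>)) / 2))"
proof -
  note [measurable] = linear_form_measurable[OF u \<alpha>]
  define \<beta> where "\<beta> = S *\<^sub>v \<alpha>"
  have \<beta>: "\<beta> \<in> carrier_vec p" unfolding \<beta>_def using S_inv \<alpha> by auto
  have K\<beta>: "inv_mat S *\<^sub>v \<beta> = \<alpha>"
    unfolding \<beta>_def using S_inv \<alpha> by (intro mult_vec_cancel_left[of _ p p]) auto
  define v where "v = (u \<bullet> u) * (\<alpha> \<bullet> \<beta>)"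
  let ?s = "\<lambda>i a. t * (u $ i * \<beta> $ a)"
  have qf: "noise_qf (inv_mat S) n p (translate n p ?s z) =
      noise_qf (inv_mat S) n p z + 2 * t * (u \<bullet> (noise_mat n p z *\<^sub>v \<alpha>)) + t\<^sup>2 * v" for z
  proof -
    have "(\<Sum>a<p. \<alpha> $ a * (\<Sum>i<n. u $ i * z i a)) = u \<bullet> (noise_mat n p z *\<^sub>v \<alpha>)"
      using u \<alpha> by (simp add: scalar_prod_def lessThan_atLeast0 sum_distrib_left, subst sum.swap)
        (simp add: mult_ac)
    moreover have "(\<Sum>i<n. u $ i * u $ i) * (\<Sum>a<p. \<alpha> $ a * \<beta> $ a) = v"
      unfolding v_def using u \<alpha> \<beta> by (simp add: scalar_prod_def lessThan_atLeast0)
    moreover have "inv_mat S $$ (a, b) = inv_mat S $$ (b, a)" if "a < p" "b < p" for a b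
      using S_inv that by (metis carrier_matD index_transpose_mat(1))
    moreover have "(\<Sum>b<p. inv_mat S $$ (a, b) * \<beta> $ b) = \<alpha> $ a" if "a < p" for a
      using arg_cong[OF K\<beta>, of "\<lambda>v. v $ a"] S_inv \<beta> that
      by (simp add: scalar_prod_def lessThan_atLeast0)
    ultimately show ?thesis
      using noise_qf_translate[of p "inv_mat S" "\<lambda>a. \<beta> $ a" "\<lambda>a. \<alpha> $ a" n t "\<lambda>i. u $ i" z]
      by (simp add: mult.assoc)
  qed
  have dens_translate: "dens (translate n p ?s z) * ennreal (exp (t\<^sup>2 * v / 2)) =
      dens z * ennreal (exp (- t * (u \<bullet> (noise_mat n p z *\<^sub>v \<alpha>))))" for z
    unfolding qf using c
    by (simp add: ennreal_mult'[symmetric] mult.assoc exp_add[symmetric] add_divide_distrib diff_divide_distrib algebra_simps)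
  have "(\<integral>\<^sup>+ x. ennreal (exp (- t * (u \<bullet> (Z x *\<^sub>v \<alpha>)))) \<partial>M) =
      (\<integral>\<^sup>+ z. dens z * ennreal (exp (- t * (u \<bullet> (noise_mat n p z *\<^sub>v \<alpha>)))) \<partial>lborel_mat n p)"
    by (rule nn_integral_noise) measurable
  also have "\<dots> = (\<integral>\<^sup>+ z. dens (translate n p ?s z) \<partial>lborel_mat n p) * ennreal (exp (t\<^sup>2 * v / 2))"
    unfolding dens_translate[symmetric] by (rule nn_integral_multc) measurable
  also have "(\<integral>\<^sup>+ z. dens (translate n p ?s z) \<partial>lborel_mat n p) = 1"
    using nn_integral_lborel_mat_translate[of dens n p ?s] nn_integral_dens by simp
  finally show ?thesis unfolding v_def \<beta>_def by (simp add: mult.assoc)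
qed

text \<open>The linear form is centred normal with variance \<open>v\<close>. The factor 8 is the
  price of bounding a square by exponentials; \<open>t\<close> is scaled so that the exponent in the
  generating function is \<open>1 / 2\<close>.\<close>

lemma noise_second_moment:
  assumes u: "u \<in> carrier_vec n" and \<alpha>: "\<alpha> \<in> carrier_vec p"
  shows "(\<integral>\<^sup>+ x. ennreal ((u \<bullet> (Z x *\<^sub>v \<alpha>))\<^sup>2) \<partial>M) \<le> ennreal (8 * (u \<bullet> u) * (\<alpha> \<bullet> (S *\<^sub>v \<alpha>)))"
proof -
  note [measurable] = linear_form_measurable[OF u \<alpha>]
  define v where "v = (u \<bullet> u) * (\<alpha> \<bullet> (S *\<^sub>v \<alpha>))"
  show ?thesis
  proof (cases "u = 0\<^sub>v n \<or> \<alpha> = 0\<^sub>v p")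
    case True
    then have "u \<bullet> (Z x *\<^sub>v \<alpha>) = 0" for x
    proof
      assume "u = 0\<^sub>v n"
      then show ?thesis using \<alpha> by (simp add: mult_mat_vec_carrier[of _ n p] scalar_prod_left_zero[of _ n])
    next
      assume "\<alpha> = 0\<^sub>v p"
      moreover have "Z x *\<^sub>v 0\<^sub>v p = 0\<^sub>v n" by (intro eq_vecI) auto
      ultimately show ?thesis using u by simp
    qed
    then show ?thesis by simp
  next
    case False
    then have v: "v > 0"
      unfolding v_def using u \<alpha> S scalar_prod_self_pos[OF u] unfolding pos_def_def by simp
    define t where "t = 1 / sqrt v"
    have t2: "t\<^sup>2 * v = 1" unfolding t_def using v by (simp add: power_divide)
    have mgf: "(\<integral>\<^sup>+ x. ennreal (exp (- r * (u \<bullet> (Z x *\<^sub>v \<alpha>)))) \<partial>M) = ennreal (exp (1/2))"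
      if "r\<^sup>2 = t\<^sup>2" for r
      unfolding noise_mgf[OF u \<alpha>] that using t2 unfolding v_def by (simp add: mult.assoc)
    have "ennreal ((u \<bullet> (Z x *\<^sub>v \<alpha>))\<^sup>2) \<le> ennreal (2 * v) *
        (ennreal (exp (- t * (u \<bullet> (Z x *\<^sub>v \<alpha>)))) + ennreal (exp (- (- t) * (u \<bullet> (Z x *\<^sub>v \<alpha>)))))" for x
    proof -
      let ?l = "u \<bullet> (Z x *\<^sub>v \<alpha>)"
      have "?l\<^sup>2 = v * (t * ?l)\<^sup>2" using t2 by (simp add: power_mult_distrib mult_ac)
      also have "\<dots> \<le> v * (2 * (exp (t * ?l) + exp (- (t * ?l))))"
        using v square_le_exp by (intro mult_left_mono) auto
      finally show ?thesis using v
        by (simp add: ennreal_plus[symmetric] ennreal_mult'[symmetric] del: ennreal_plus)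
          (simp add: algebra_simps)
    qed
    then have "(\<integral>\<^sup>+ x. ennreal ((u \<bullet> (Z x *\<^sub>v \<alpha>))\<^sup>2) \<partial>M) \<le> (\<integral>\<^sup>+ x. ennreal (2 * v) *
        (ennreal (exp (- t * (u \<bullet> (Z x *\<^sub>v \<alpha>)))) + ennreal (exp (- (- t) * (u \<bullet> (Z x *\<^sub>v \<alpha>))))) \<partial>M)"
      by (rule nn_integral_mono)
    also have "\<dots> = ennreal (2 * v) * ((\<integral>\<^sup>+ x. ennreal (exp (- t * (u \<bullet> (Z x *\<^sub>v \<alpha>)))) \<partial>M)
        + (\<integral>\<^sup>+ x. ennreal (exp (- (- t) * (u \<bullet> (Z x *\<^sub>v \<alpha>)))) \<partial>M))"
    proof -
      have [measurable]: "(\<lambda>x. u \<bullet> (Z x *\<^sub>v \<alpha>)) \<in> borel_measurable M"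
        by (rule measurable_compose[OF E_meas linear_form_measurable[OF u \<alpha>]])
      show ?thesis by (subst nn_integral_cmult, measurable, subst nn_integral_add) auto
    qed
    also have "\<dots> = ennreal (4 * exp (1/2) * v)"
      unfolding mgf[of t, OF refl] mgf[of "- t", simplified power2_minus, OF refl] using v
      by (simp add: ennreal_plus[symmetric] ennreal_mult'[symmetric] del: ennreal_plus)
    also have "\<dots> \<le> ennreal (8 * v)"
    proof (rule ennreal_leI)
      \<comment> \<open>From \<open>exp 1 \<le> 3 \<le> 4\<close>; hence
        \<open>4 * exp (1/2) \<le> 8\<close>.\<close>
      have "(exp (1/2 :: real))\<^sup>2 \<le> 2\<^sup>2"
        using exp_le by (simp add: power2_eq_square exp_add[symmetric])
      then have "exp (1/2 :: real) \<le> 2" by (rule power2_le_imp_le) simp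
      then show "4 * exp (1/2) * v \<le> 8 * v" using v by simp
    qed
    finally show ?thesis unfolding v_def by (simp add: mult.assoc)
  qed
qed

end

section \<open>Projections onto column spaces\<close>

definition tr :: "real mat \<Rightarrow> real" where
  "tr A = (\<Sum>i<dim_row A. A $$ (i, i))"

lemma tr_mult_commute:
  assumes "A \<in> carrier_mat n m" "B \<in> carrier_mat m n"
  shows "tr (A * B) = tr (B * A)"
proof -
  have "tr (A * B) = (\<Sum>i<n. \<Sum>j<m. A $$ (i, j) * B $$ (j, i))"
    using assms unfolding tr_def by (auto simp: scalar_prod_def lessThan_atLeast0 intro!: sum.cong)
  also have "\<dots> = (\<Sum>j<m. \<Sum>i<n. B $$ (j, i) * A $$ (i, j))"
    by (subst sum.swap) (simp add: mult.commute)
  also have "\<dots> = tr (B * A)"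
    using assms unfolding tr_def by (auto simp: scalar_prod_def lessThan_atLeast0 intro!: sum.cong)
  finally show ?thesis .
qed

lemma tr_one: "tr (1\<^sub>m n) = real n"
  unfolding tr_def by simp

lemma tr_minus: "A \<in> carrier_mat n n \<Longrightarrow> B \<in> carrier_mat n n \<Longrightarrow> tr (A - B) = tr A - tr B"
  unfolding tr_def by (auto simp: sum_subtractf)

lemma tr_outer: "u \<in> carrier_vec n \<Longrightarrow> tr (outer u) = u \<bullet> u"
  unfolding tr_def outer_def scalar_prod_def by (auto simp: lessThan_atLeast0)

definition orth_proj :: "nat \<Rightarrow> real mat \<Rightarrow> bool" where
  "orth_proj n Q \<longleftrightarrow> Q \<in> carrier_mat n n \<and> Q\<^sup>T = Q \<and> Q * Q = Q"

lemma orth_projD: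
  assumes "orth_proj n Q"
  shows "Q \<in> carrier_mat n n" "Q\<^sup>T = Q" "Q * Q = Q"
  using assms unfolding orth_proj_def by auto

lemma orth_proj_idem: "orth_proj n Q \<Longrightarrow> x \<in> carrier_vec n \<Longrightarrow> Q *\<^sub>v (Q *\<^sub>v x) = Q *\<^sub>v x"
  using orth_projD[of n Q] assoc_mult_mat_vec[of Q n n Q n x] by simp

lemma orth_proj_form:
  assumes Q: "orth_proj n Q" and x: "x \<in> carrier_vec n" and y: "y \<in> carrier_vec n"
  shows "y \<bullet> (Q *\<^sub>v x) = (Q *\<^sub>v y) \<bullet> (Q *\<^sub>v x)"
  using orth_projD[OF Q] transpose_vec_mult_scalar[of Q n n "Q *\<^sub>v x" y] orth_proj_idem[OF Q x] x y
  by simp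

lemma orth_proj_form_nonneg: "orth_proj n Q \<Longrightarrow> x \<in> carrier_vec n \<Longrightarrow> 0 \<le> x \<bullet> (Q *\<^sub>v x)"
  using orth_proj_form[of n Q x x] scalar_prod_self_nonneg by simp

text \<open>\<open>P R = R\<close> says that the range of \<open>R\<close> lies in that of
  \<open>P\<close>. Transposing gives \<open>R P = R\<close>, and the mixed products
  collapse.\<close>

lemma orth_proj_diff:
  assumes P: "orth_proj n P" and R: "orth_proj n R" and PR: "P * R = R"
  shows "orth_proj n (P - R)"
proof -
  note P' = orth_projD[OF P] and R' = orth_projD[OF R]
  have RP: "R * P = R"
    using transpose_mult[OF P'(1) R'(1)] P'(2) R'(2) PR by simp
  have "(P - R) * (P - R) = P - R"
  proof -
    have c: "P - R \<in> carrier_mat n n" using R'(1) by (rule minus_carrier_mat)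
    have "(P - R) * (P - R) = P * (P - R) - R * (P - R)"
      by (rule minus_mult_distrib_mat[OF P'(1) R'(1) c])
    also have "\<dots> = (P * P - P * R) - (R * P - R * R)"
      unfolding mult_minus_distrib_mat[OF P'(1) P'(1) R'(1)] mult_minus_distrib_mat[OF R'(1) P'(1) R'(1)] ..
    also have "\<dots> = P - R"
      unfolding P'(3) R'(3) PR RP using P'(1) R'(1) by (intro eq_matI) auto
    finally show ?thesis .
  qed
  then show ?thesis unfolding orth_proj_def using P' R'
    by (simp add: transpose_minus[of _ n n] minus_carrier_mat)
qed

lemma orth_proj_one: "orth_proj n (1\<^sub>m n)"
  unfolding orth_proj_def by simp

lemma orth_proj_form_le:
  assumes "orth_proj n Q" "x \<in> carrier_vec n"
  shows "x \<bullet> (Q *\<^sub>v x) \<le> x \<bullet> x"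
proof -
  have "orth_proj n (1\<^sub>m n - Q)"
    using assms orth_projD[OF assms(1)] by (intro orth_proj_diff orth_proj_one) auto
  from orth_proj_form_nonneg[OF this assms(2)] show ?thesis
    using orth_projD[OF assms(1)] assms(2)
    by (simp add: minus_mult_distrib_mat_vec[of _ n n] scalar_prod_minus_distrib[of _ n])
qed

lemma orth_proj_outer:
  assumes "u \<in> carrier_vec n" "u \<bullet> u = 1"
  shows "orth_proj n (outer u)"
proof -
  have "outer u * outer u = outer u"
    by (rule mat_eq_by_vec[of _ n n])
      (use assms in \<open>auto simp: outer_mult_vec mult_mat_vec[of _ n n] assoc_mult_mat_vec[of _ n n _ n]
        intro!: mult_carrier_mat[of _ n n]\<close>)
  then show ?thesis unfolding orth_proj_def using assms by simp
qed

lemma mult_outer: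
  assumes "A \<in> carrier_mat n n" "u \<in> carrier_vec n" "A *\<^sub>v u = u"
  shows "A * outer u = outer u"
  by (rule mat_eq_by_vec[of _ n n])
    (use assms in \<open>auto simp: outer_mult_vec mult_mat_vec[of _ n n] assoc_mult_mat_vec[of _ n n _ n]
      intro!: mult_carrier_mat[of _ n n]\<close>)

lemma orth_proj_minus_outer:
  assumes Q: "orth_proj n Q" and u: "u \<in> carrier_vec n" "u \<bullet> u = 1" "Q *\<^sub>v u = u"
  shows "orth_proj n (Q - outer u)" "tr (Q - outer u) = tr Q - 1"
  using orth_proj_diff[OF Q orth_proj_outer[OF u(1,2)]] mult_outer[OF orth_projD(1)[OF Q] u(1,3)]
    tr_minus[OF orth_projD(1)[OF Q], of "outer u"] tr_outer[OF u(1)] u by auto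

lemma normalize_vec:
  assumes "w \<in> carrier_vec n" "w \<bullet> w > (0 :: real)"
  shows "((1 / sqrt (w \<bullet> w)) \<cdot>\<^sub>v w) \<bullet> ((1 / sqrt (w \<bullet> w)) \<cdot>\<^sub>v w) = 1"
  using assms by simp

text \<open>A positive trace has a positive diagonal entry, and this entry is the squared length of
  the image of a coordinate vector.\<close>

lemma orth_proj_unit_vec:
  assumes Q: "orth_proj n Q" and "tr Q > 0"
  shows "\<exists>u \<in> carrier_vec n. u \<bullet> u = 1 \<and> Q *\<^sub>v u = u"
proof -
  note Q' = orth_projD[OF Q]
  have "\<exists>i<n. Q $$ (i, i) > 0"
  proof (rule ccontr)
    assume "\<not> ?thesis"
    then have "Q $$ (i, i) \<le> 0" if "i < n" for i using that by force
    then have "tr Q \<le> 0" unfolding tr_def using Q'(1) by (intro sum_nonpos) auto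
    then show False using assms(2) by simp
  qed
  then obtain i where i: "i < n" "Q $$ (i, i) > 0" by auto
  define w where "w = Q *\<^sub>v unit_vec n i"
  have w: "w \<in> carrier_vec n" unfolding w_def using Q' by auto
  have "unit_vec n i \<bullet> (Q *\<^sub>v unit_vec n i) = Q $$ (i, i)" using i Q' by simp
  then have pos: "w \<bullet> w > 0"
    unfolding w_def using orth_proj_form[OF Q, of "unit_vec n i" "unit_vec n i"] i by simp
  have Qw: "Q *\<^sub>v w = w" unfolding w_def by (rule orth_proj_idem[OF Q]) simp
  define c where "c = 1 / sqrt (w \<bullet> w)"
  have "Q *\<^sub>v (c \<cdot>\<^sub>v w) = c \<cdot>\<^sub>v w" using mult_mat_vec[OF Q'(1) w] Qw by simp
  moreover have "(c \<cdot>\<^sub>v w) \<bullet> (c \<cdot>\<^sub>v w) = 1"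
    using normalize_vec[OF w pos] unfolding c_def[symmetric] .
  moreover have "c \<cdot>\<^sub>v w \<in> carrier_vec n" using w by simp
  ultimately show ?thesis by blast
qed

lemma orth_proj_orthonormal:
  assumes "orth_proj n Q" "tr Q \<ge> real r"
  shows "\<exists>w :: nat \<Rightarrow> real vec. (\<forall>i<r. w i \<in> carrier_vec n \<and> Q *\<^sub>v w i = w i)
    \<and> (\<forall>i<r. \<forall>j<r. w i \<bullet> w j = (if i = j then 1 else 0))"
  using assms
proof (induction r arbitrary: Q)
  case (Suc r)
  note Q = Suc.prems(1)
  obtain u where u: "u \<in> carrier_vec n" "u \<bullet> u = 1" "Q *\<^sub>v u = u"
    using orth_proj_unit_vec[OF Q] Suc.prems(2) by auto
  note Q' = orth_proj_minus_outer[OF Q u]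
  have "real r \<le> tr (Q - outer u)" using Q'(2) Suc.prems(2) by simp
  then obtain w where w': "\<forall>i<r. w i \<in> carrier_vec n \<and> (Q - outer u) *\<^sub>v w i = w i"
    "\<forall>i<r. \<forall>j<r. w i \<bullet> w j = (if i = j then 1 else 0)"
    using Suc.IH[OF Q'(1)] by blast
  then have w: "\<And>i. i < r \<Longrightarrow> w i \<in> carrier_vec n" "\<And>i. i < r \<Longrightarrow> (Q - outer u) *\<^sub>v w i = w i"
    "\<And>i j. i < r \<Longrightarrow> j < r \<Longrightarrow> w i \<bullet> w j = (if i = j then 1 else 0)"
    by blast+
  \<comment> \<open>The reduced projection kills \<open>u\<close>, so the vectors that it fixes are
    orthogonal to \<open>u\<close> and therefore fixed by \<open>Q\<close> too.\<close>
  have Qu: "(Q - outer u) *\<^sub>v u = 0\<^sub>v n"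
    using orth_projD[OF Q] u
    by (auto simp: minus_mult_distrib_mat_vec[of _ n n] outer_mult_vec intro!: eq_vecI)
  have uw: "u \<bullet> w i = 0" if i: "i < r" for i
  proof -
    have "u \<bullet> w i = u \<bullet> ((Q - outer u) *\<^sub>v w i)" using w(2)[OF i] by simp
    also have "\<dots> = w i \<bullet> ((Q - outer u) *\<^sub>v u)"
      using sym_form[OF orth_projD(1,2)[OF Q'(1)] w(1)[OF i] u(1)] .
    finally show ?thesis unfolding Qu using w(1)[OF i] by simp
  qed
  have Qw: "Q *\<^sub>v w i = w i" if i: "i < r" for i
  proof -
    have "(Q - outer u) *\<^sub>v w i = Q *\<^sub>v w i - (u \<bullet> w i) \<cdot>\<^sub>v u"
      using orth_projD[OF Q] u w(1)[OF i]
      by (simp add: minus_mult_distrib_mat_vec[of _ n n] outer_mult_vec)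
    also have "\<dots> = Q *\<^sub>v w i"
      using uw[OF i] u(1) orth_projD(1)[OF Q] by (intro eq_vecI) auto
    finally show ?thesis using w(2)[OF i] by simp
  qed
  have "w i \<bullet> u = 0" if "i < r" for i
    using uw[OF that] comm_scalar_prod[OF u(1) w(1)[OF that]] by simp
  then show ?case
    using u w Qw uw
    by (intro exI[of _ "\<lambda>i. if i < r then w i else u"]) (auto simp: less_Suc_eq)
qed auto

text \<open>The columns of \<open>D\<close> are orthonormal vectors in the range of
  \<open>Q\<close>. With \<open>D^T Q\<close> as the left factor, \<open>D\<close> is the direction
  of translation that the null-set argument for determinants asks for.\<close>

lemma orth_proj_section:
  assumes Q: "orth_proj n Q" and "tr Q \<ge> real p"
  shows "\<exists>D \<in> carrier_mat n p. D\<^sup>T * Q * D = 1\<^sub>m p"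
proof -
  obtain w where w: "\<And>i. i < p \<Longrightarrow> w i \<in> carrier_vec n" "\<And>i. i < p \<Longrightarrow> Q *\<^sub>v w i = w i"
    "\<And>i j. i < p \<Longrightarrow> j < p \<Longrightarrow> w i \<bullet> w j = (if i = j then 1 else 0)"
    using orth_proj_orthonormal[OF assms] by blast
  define D where "D = Matrix.mat n p (\<lambda>(i, j). w j $ i)"
  have D: "D \<in> carrier_mat n p" unfolding D_def by auto
  have col: "Matrix.col D j = w j" if "j < p" for j
    using that w(1)[OF that] unfolding D_def by (intro eq_vecI) auto
  note Q' = orth_projD[OF Q]
  have QD: "Q * D = D"
  proof (rule eq_matI)
    fix i j assume "i < dim_row D" "j < dim_col D"
    then have ij: "i < n" "j < p" using D by auto
    have "(Q * D) $$ (i, j) = (Q *\<^sub>v Matrix.col D j) $ i" using ij Q' D by simp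
    also have "\<dots> = D $$ (i, j)" unfolding col[OF ij(2)] w(2)[OF ij(2)] using ij by (simp add: D_def)
    finally show "(Q * D) $$ (i, j) = D $$ (i, j)" .
  qed (use Q' D in auto)
  have "D\<^sup>T * D = 1\<^sub>m p"
    by (rule eq_matI) (use D col w(3) in auto)
  then have "D\<^sup>T * Q * D = 1\<^sub>m p"
    using D Q' QD by (simp add: assoc_mult_mat[of _ p n _ n _ p])
  then show ?thesis using D by auto
qed

section \<open>The projection onto the columns of the projected noise\<close>

definition gram_proj :: "real mat \<Rightarrow> real mat \<Rightarrow> real mat" where
  "gram_proj Q Z = Q * Z * inv_mat (Z\<^sup>T * Q * Z) * (Z\<^sup>T * Q)"

text \<open>With \<open>A = Q Z\<close> the Gram matrix is \<open>A^T A\<close>, and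
  \<open>gram_proj\<close> is the usual projection onto the columns of \<open>A\<close>. Cyclicity
  reduces its trace to that of the identity, so the trace does not depend on the noise.\<close>

lemma gram_proj:
  assumes Q: "orth_proj n Q" and Z: "Z \<in> carrier_mat n p" and d: "det (Z\<^sup>T * Q * Z) \<noteq> 0"
  shows "orth_proj n (gram_proj Q Z)" "tr (gram_proj Q Z) = real p" "Q * gram_proj Q Z = gram_proj Q Z"
proof -
  note Q' = orth_projD[OF Q]
  define W where "W = Z\<^sup>T * Q * Z"
  define A where "A = Q * Z"
  have A: "A \<in> carrier_mat n p" unfolding A_def using Q' Z by auto
  have AT: "A\<^sup>T = Z\<^sup>T * Q" unfolding A_def using Q' Z by (simp add: transpose_mult[of _ n n])
  have QA: "Q * A = A" unfolding A_def using Q' Z assoc_mult_mat[of Q n n Q n Z p] by simp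
  have W: "W \<in> carrier_mat p p" unfolding W_def using Q' Z by auto
  have WA: "W = A\<^sup>T * A"
  proof -
    have "A\<^sup>T * A = Z\<^sup>T * (Q * A)" unfolding AT using Z Q' A by (simp add: assoc_mult_mat[of _ p n _ n _ p])
    also have "\<dots> = W" unfolding QA unfolding A_def W_def using Z Q' by (simp add: assoc_mult_mat[of _ p n _ n _ p])
    finally show ?thesis ..
  qed
  have d: "det W \<noteq> 0" using d unfolding W_def .
  note i = inv_mat[OF W d]
  have Ws: "W\<^sup>T = W" unfolding WA using A by (simp add: transpose_mult[of _ p n])
  note isym = inv_mat_transpose[OF W d Ws]
  have G: "gram_proj Q Z = A * (inv_mat W * A\<^sup>T)"
    unfolding gram_proj_def W_def[symmetric] unfolding A_def[symmetric] unfolding AT[symmetric]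
    using A i by (simp add: assoc_mult_mat[of _ n p _ p _ n])
  have c: "inv_mat W * A\<^sup>T \<in> carrier_mat p n" using A i by auto
  have "A\<^sup>T * (A * (inv_mat W * A\<^sup>T)) = A\<^sup>T"
  proof -
    have "A\<^sup>T * (A * (inv_mat W * A\<^sup>T)) = W * (inv_mat W * A\<^sup>T)"
      using assoc_mult_mat[of "A\<^sup>T" p n A p "inv_mat W * A\<^sup>T" n] A c unfolding WA[symmetric]
      by (simp del: assoc_mult_mat)
    also have "\<dots> = A\<^sup>T" using W i A by (intro mult_mat_cancel_left[of _ p p]) auto
    finally show ?thesis .
  qed
  then have "gram_proj Q Z * gram_proj Q Z = gram_proj Q Z"
    unfolding G using A i c
    by (simp add: assoc_mult_mat[of A n p _ n _ n] assoc_mult_mat[of _ p p "A\<^sup>T" n _ n]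
        assoc_mult_mat[of A n p "inv_mat W * A\<^sup>T" n _ n])
  moreover have "(gram_proj Q Z)\<^sup>T = gram_proj Q Z"
    unfolding G using A i c isym
    by (simp add: transpose_mult[of _ n p _ n] transpose_mult[of _ p p _ n] assoc_mult_mat[of _ n p _ p _ n])
  moreover have gc: "gram_proj Q Z \<in> carrier_mat n n" unfolding G using A c by auto
  ultimately show "orth_proj n (gram_proj Q Z)" unfolding orth_proj_def by simp
  have "tr (gram_proj Q Z) = tr (inv_mat W * A\<^sup>T * A)"
    unfolding G by (rule tr_mult_commute[OF A c])
  also have "inv_mat W * A\<^sup>T * A = 1\<^sub>m p"
    using A i unfolding WA[symmetric] by (simp add: assoc_mult_mat[of _ p p _ n _ p] WA[symmetric])
  finally show "tr (gram_proj Q Z) = real p" by (simp add: tr_one)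
  show "Q * gram_proj Q Z = gram_proj Q Z"
    unfolding G using assoc_mult_mat[OF Q'(1) A c] QA by simp
qed

text \<open>Subtracting the outer product of \<open>Q y\<close> from \<open>Q\<close> subtracts that
  of \<open>v = Z^T Q y\<close> from the Gram matrix \<open>W\<close>. The matrix determinant lemma
  turns the quotient of determinants into \<open>1 - v \<bullet> W^(-1) v\<close>.\<close>

lemma gram_proj_form:
  assumes Q: "orth_proj n Q" and Z: "Z \<in> carrier_mat n p" and d: "det (Z\<^sup>T * Q * Z) \<noteq> 0"
    and y: "y \<in> carrier_vec n"
  shows "y \<bullet> (gram_proj Q Z *\<^sub>v y) = 1 - det (Z\<^sup>T * (Q - outer (Q *\<^sub>v y)) * Z) / det (Z\<^sup>T * Q * Z)"
proof -
  note Q' = orth_projD[OF Q]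
  define W where "W = Z\<^sup>T * Q * Z"
  have W: "W \<in> carrier_mat p p" unfolding W_def using Q' Z by auto
  have dW: "det W \<noteq> 0" using d unfolding W_def .
  note i = inv_mat[OF W dW]
  define q where "q = Q *\<^sub>v y"
  define v where "v = Z\<^sup>T *\<^sub>v q"
  have q: "q \<in> carrier_vec n" unfolding q_def using Q' y by auto
  have v: "v \<in> carrier_vec p" unfolding v_def using Z q by auto
  have oc: "outer q \<in> carrier_mat n n" using q by simp
  have "Z\<^sup>T * outer q * Z = outer v"
  proof (rule mat_eq_by_vec[of _ p p])
    fix x :: "real vec" assume x: "x \<in> carrier_vec p"
    have Zx: "Z *\<^sub>v x \<in> carrier_vec n" using Z x by auto
    have "Z\<^sup>T * outer q * Z *\<^sub>v x = Z\<^sup>T *\<^sub>v (outer q *\<^sub>v (Z *\<^sub>v x))"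
      using Z x oc by (simp add: assoc_mult_mat_vec[of _ p n _ p] assoc_mult_mat_vec[of _ p n _ n])
    also have "\<dots> = (q \<bullet> (Z *\<^sub>v x)) \<cdot>\<^sub>v v"
      unfolding v_def using q Zx Z by (simp add: outer_mult_vec mult_mat_vec[of _ p n])
    also have "q \<bullet> (Z *\<^sub>v x) = v \<bullet> x"
      unfolding v_def using transpose_vec_mult_scalar[OF Z x q] by simp
    finally show "Z\<^sup>T * outer q * Z *\<^sub>v x = outer v *\<^sub>v x" using v x by (simp add: outer_mult_vec)
  qed (use Z oc v in auto)
  then have "Z\<^sup>T * (Q - outer q) * Z = W - outer v"
    unfolding W_def using Z Q' oc
    by (simp add: minus_mult_distrib_mat[of _ p n _ _ p] mult_minus_distrib_mat[of _ p n _ n] mult_carrier_mat[of _ p n _ n] del: assoc_mult_mat)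
  then have 1: "det (Z\<^sup>T * (Q - outer q) * Z) = det W * (1 - v \<bullet> (inv_mat W *\<^sub>v v))"
    using det_minus_outer[OF W dW v] by simp
  have "gram_proj Q Z *\<^sub>v y = Q *\<^sub>v (Z *\<^sub>v (inv_mat W *\<^sub>v v))"
  proof -
    have "(Z\<^sup>T * Q) *\<^sub>v y = v" unfolding v_def q_def using Z Q' y by (simp add: assoc_mult_mat_vec[of _ p n _ n])
    moreover have "Q * Z \<in> carrier_mat n p" "Z\<^sup>T * Q \<in> carrier_mat p n" using Q' Z by auto
    ultimately have "gram_proj Q Z *\<^sub>v y = Q * Z *\<^sub>v (inv_mat W *\<^sub>v v)"
      unfolding gram_proj_def W_def[symmetric] using i y
      by (simp add: assoc_mult_mat_vec[of _ n p _ n] assoc_mult_mat_vec[of _ n p _ p] mult_carrier_mat[of _ n p _ p] v del: assoc_mult_mat)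
    then show ?thesis using i v Q' Z by (simp add: assoc_mult_mat_vec[of Q n n Z p])
  qed
  then have "y \<bullet> (gram_proj Q Z *\<^sub>v y) = q \<bullet> (Z *\<^sub>v (inv_mat W *\<^sub>v v))"
    unfolding q_def using transpose_vec_mult_scalar[OF Q'(1), of "Z *\<^sub>v (inv_mat W *\<^sub>v v)" y] Q' y Z i v
    by simp
  also have "\<dots> = v \<bullet> (inv_mat W *\<^sub>v v)"
    unfolding v_def using transpose_vec_mult_scalar[OF Z _ q, of "inv_mat W *\<^sub>v v"] i v unfolding v_def
    by simp
  finally show ?thesis using 1 dW unfolding W_def[symmetric] q_def[symmetric] by (simp add: field_simps)
qed

text \<open>For random \<open>P\<close>, invariance under reflections makes the expectation of the squared form
  \<open>(y \<bullet> (P *\<^sub>v y))\<^sup>2\<close> a constant multiple of \<open>(y \<bullet> (Q *\<^sub>v y))\<^sup>2\<close>. The left-hand side of the second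
  identity is linear in the squared form, so comparing it for \<open>P\<close> and \<open>Q\<close> yields the constant.\<close>

lemma orth_proj_sum_identity:
  assumes P: "orth_proj n P"
  defines "e i \<equiv> unit_vec n i :: real vec"
  shows "(\<Sum>i<n. e i \<bullet> (P *\<^sub>v e i)) = tr P"
    and "(\<Sum>i<n. \<Sum>j<n. ((e i + e j) \<bullet> (P *\<^sub>v (e i + e j)))\<^sup>2 + ((e i - e j) \<bullet> (P *\<^sub>v (e i - e j)))\<^sup>2)
      - 4 * real n * (\<Sum>i<n. (e i \<bullet> (P *\<^sub>v e i))\<^sup>2) = 4 * (tr P)\<^sup>2 + 8 * tr P"
proof -
  note P' = orth_projD[OF P]
  have ent: "e i \<bullet> (P *\<^sub>v e j) = P $$ (i, j)" if "i < n" "j < n" for i j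
    unfolding e_def using that P' by simp
  show 1: "(\<Sum>i<n. e i \<bullet> (P *\<^sub>v e i)) = tr P"
    unfolding tr_def using P' by (auto simp: ent)
  have sym: "P $$ (j, i) = P $$ (i, j)" if "i < n" "j < n" for i j
    using P' that by (metis carrier_matD index_transpose_mat(1))
  have ec: "e i \<in> carrier_vec n" for i unfolding e_def by simp
  have plus: "(e i + e j) \<bullet> (P *\<^sub>v (e i + e j)) = P $$ (i, i) + P $$ (j, j) + 2 * P $$ (i, j)"
    if "i < n" "j < n" for i j
    using quadratic_form_add_smult[OF P'(1,2) ec ec, of i 1 j] ent[OF that(2,1)] ent[OF that(1,1)]
      ent[OF that(2,2)] sym[OF that] by simp
  have minus: "(e i - e j) \<bullet> (P *\<^sub>v (e i - e j)) = P $$ (i, i) + P $$ (j, j) - 2 * P $$ (i, j)"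
    if "i < n" "j < n" for i j
  proof -
    have "e i - e j = e i + (-1) \<cdot>\<^sub>v e j" unfolding e_def by (intro eq_vecI) auto
    then show ?thesis
      using quadratic_form_add_smult[OF P'(1,2) ec ec, of i "-1" j] ent[OF that(2,1)] ent[OF that(1,1)]
        ent[OF that(2,2)] sym[OF that] by simp
  qed
  have trP: "tr P = (\<Sum>i<n. P $$ (i, i))" unfolding tr_def using P' by simp
  \<comment> \<open>Here idempotence enters: the squares of all entries add up to the trace.\<close>
  have "tr P = tr (P * P)" using P' by simp
  also have "\<dots> = (\<Sum>i<n. \<Sum>j<n. (P $$ (i, j))\<^sup>2)"
    unfolding tr_def using P'(1) sym
    by (auto simp: scalar_prod_def lessThan_atLeast0 power2_eq_square intro!: sum.cong)
  finally have trsq: "(\<Sum>i<n. \<Sum>j<n. (P $$ (i, j))\<^sup>2) = tr P" ..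
  \<comment> \<open>Adding the squares for the sum and the difference cancels the products of
    diagonal with off-diagonal entries.\<close>
  have "(\<Sum>i<n. \<Sum>j<n. ((e i + e j) \<bullet> (P *\<^sub>v (e i + e j)))\<^sup>2 + ((e i - e j) \<bullet> (P *\<^sub>v (e i - e j)))\<^sup>2)
    = (\<Sum>i<n. \<Sum>j<n. 2 * (P $$ (i, i))\<^sup>2 + 2 * (P $$ (j, j))\<^sup>2 + 4 * (P $$ (i, i) * P $$ (j, j))
        + 8 * (P $$ (i, j))\<^sup>2)"
    by (intro sum.cong refl) (simp add: plus minus power2_eq_square algebra_simps)
  also have "\<dots> = 4 * real n * (\<Sum>i<n. (P $$ (i, i))\<^sup>2) + 4 * (tr P)\<^sup>2 + 8 * tr P"
  proof -
    have "(\<Sum>i<n. \<Sum>j<n. P $$ (i, i) * P $$ (j, j)) = (tr P)\<^sup>2"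
      unfolding trP power2_eq_square sum_product ..
    then show ?thesis
      by (simp add: sum.distrib sum_distrib_left[symmetric] trsq)
  qed
  finally show "(\<Sum>i<n. \<Sum>j<n. ((e i + e j) \<bullet> (P *\<^sub>v (e i + e j)))\<^sup>2 + ((e i - e j) \<bullet> (P *\<^sub>v (e i - e j)))\<^sup>2)
      - 4 * real n * (\<Sum>i<n. (e i \<bullet> (P *\<^sub>v e i))\<^sup>2) = 4 * (tr P)\<^sup>2 + 8 * tr P"
    by (simp add: ent)
qed

text \<open>A vector killed by \<open>Q Z\<close> would be killed by \<open>D^T Q Z\<close> too. The
  point is to pass from the Gram matrix, which is quadratic in \<open>Z\<close>, to a matrix linear
  in \<open>Z\<close>, to which the null-set argument applies.\<close>

lemma gram_det_nonzero:
  assumes Q: "orth_proj n Q" and Z: "Z \<in> carrier_mat n p" and D: "D \<in> carrier_mat n p"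
    and d: "det (D\<^sup>T * Q * Z) \<noteq> 0"
  shows "pos_def p (Z\<^sup>T * Q * Z)"
  unfolding pos_def_def
proof (intro conjI ballI impI)
  note Q' = orth_projD[OF Q]
  show "Z\<^sup>T * Q * Z \<in> carrier_mat p p" using Q' Z by auto
  show "(Z\<^sup>T * Q * Z)\<^sup>T = Z\<^sup>T * Q * Z"
    using Q' Z by (simp add: transpose_mult[of _ p n _ p] transpose_mult[of _ p n _ n] transpose_mult[of _ n n _ p]
        assoc_mult_mat[of _ p n _ n _ p] mult_carrier_mat[of _ n n _ p])
  fix v :: "real vec" assume v: "v \<in> carrier_vec p" "v \<noteq> 0\<^sub>v p"
  define z where "z = Z *\<^sub>v v"
  have z: "z \<in> carrier_vec n" unfolding z_def using Z v by auto
  have "v \<bullet> (Z\<^sup>T * Q * Z *\<^sub>v v) = v \<bullet> (Z\<^sup>T *\<^sub>v (Q *\<^sub>v z))"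
    unfolding z_def using Z Q' v
    by (simp add: assoc_mult_mat_vec[of _ p n _ p] assoc_mult_mat_vec[of _ n n _ p] assoc_mult_mat[of _ p n _ n _ p] mult_carrier_mat[of _ n n _ p])
  also have "\<dots> = z \<bullet> (Q *\<^sub>v z)"
    using transpose_vec_mult_scalar[of "Z\<^sup>T" p n "Q *\<^sub>v z" v] Z Q' z v unfolding z_def by simp
  also have "\<dots> = (Q *\<^sub>v z) \<bullet> (Q *\<^sub>v z)" by (rule orth_proj_form[OF Q z z])
  finally have eq: "v \<bullet> (Z\<^sup>T * Q * Z *\<^sub>v v) = (Q *\<^sub>v z) \<bullet> (Q *\<^sub>v z)" .
  have Qz: "Q *\<^sub>v z \<in> carrier_vec n" using Q' z by auto
  have "Q *\<^sub>v z \<noteq> 0\<^sub>v n"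
  proof
    assume "Q *\<^sub>v z = 0\<^sub>v n"
    then have "D\<^sup>T *\<^sub>v (Q *\<^sub>v z) = 0\<^sub>v p" using D by (auto intro!: eq_vecI)
    moreover have "D\<^sup>T *\<^sub>v (Q *\<^sub>v z) = D\<^sup>T * Q * Z *\<^sub>v v"
      unfolding z_def using D Z Q' v
      by (simp add: assoc_mult_mat_vec[of _ p n _ p] assoc_mult_mat_vec[of _ n n _ p] assoc_mult_mat[of _ p n _ n _ p] mult_carrier_mat[of _ n n _ p])
    moreover have "D\<^sup>T * Q * Z \<in> carrier_mat p p" using D Z Q' by auto
    ultimately show False using det_0_iff_vec_prod_zero_field d v by metis
  qed
  then show "0 < v \<bullet> (Z\<^sup>T * Q * Z *\<^sub>v v)" unfolding eq by (rule scalar_prod_self_pos[OF Qz])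
qed

section \<open>Moments of the leverage\<close>

text \<open>This is \<open>y \<bullet> (P *\<^sub>v y)\<close> for the projection \<open>P = gram_proj Q Z\<close> onto the column space of \<open>Q Z\<close>,
  see \<open>gram_proj_form\<close>. The quotient of determinants is visibly measurable; where the denominator
  vanishes, which has probability \<open>0\<close>, its value is the junk value \<open>1\<close>.\<close>

definition leverage :: "nat \<Rightarrow> nat \<Rightarrow> real mat \<Rightarrow> real vec \<Rightarrow> (nat \<Rightarrow> nat \<Rightarrow> real) \<Rightarrow> real" where
  "leverage n p Q y z = 1 - det ((noise_mat n p z)\<^sup>T * (Q - outer (Q *\<^sub>v y)) * noise_mat n p z)
    / det ((noise_mat n p z)\<^sup>T * Q * noise_mat n p z)"

lemma det_gram_measurable:
  assumes A: "A \<in> carrier_mat n n"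
  shows "(\<lambda>z. det ((noise_mat n p z)\<^sup>T * A * noise_mat n p z)) \<in> borel_measurable (lborel_mat n p)"
proof (rule det_measurable)
  fix i j assume ij: "i < p" "j < p"
  have "(\<lambda>z. ((noise_mat n p z)\<^sup>T * A * noise_mat n p z) $$ (i, j)) =
      (\<lambda>z. \<Sum>l<n. (\<Sum>k<n. z k i * A $$ (k, l)) * z l j)"
    using ij A by (auto simp: scalar_prod_def lessThan_atLeast0 intro!: sum.cong)
  then show "(\<lambda>z. ((noise_mat n p z)\<^sup>T * A * noise_mat n p z) $$ (i, j)) \<in> borel_measurable (lborel_mat n p)"
    by (rule ssubst) (intro borel_measurable_sum borel_measurable_times borel_measurable_const
      lborel_mat_entry[of "\<lambda>z. z" _ n p], use ij in auto)
qed (use A in auto)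

lemma leverage_measurable[measurable]:
  assumes "Q \<in> carrier_mat n n" "y \<in> carrier_vec n"
  shows "leverage n p Q y \<in> borel_measurable (lborel_mat n p)"
  unfolding leverage_def
  using assms det_gram_measurable[of "Q - outer (Q *\<^sub>v y)" n p] det_gram_measurable[of Q n p]
  by (auto simp: minus_carrier_mat mult_mat_vec_carrier[of _ n n])

lemma noise_mat_reflect:
  assumes "w \<in> carrier_vec n"
  shows "noise_mat n p (reflect n p (\<lambda>i. w $ i) z) = householder w * noise_mat n p z"
proof (rule eq_matI)
  fix i j assume "i < dim_row (householder w * noise_mat n p z)" "j < dim_col (householder w * noise_mat n p z)"
  then have ij: "i < n" "j < p" using householder_carrier[OF assms] by auto
  have "(householder w * noise_mat n p z) $$ (i, j) = (householder w *\<^sub>v Matrix.col (noise_mat n p z) j) $ i"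
    using ij householder_carrier[OF assms] by simp
  also have "\<dots> = z i j - 2 * w $ i * (\<Sum>k<n. w $ k * z k j)"
    using assms ij by (subst householder_mult_vec[of _ n]) (auto simp: scalar_prod_def lessThan_atLeast0)
  finally show "noise_mat n p (reflect n p (\<lambda>i. w $ i) z) $$ (i, j) = (householder w * noise_mat n p z) $$ (i, j)"
    using ij by (simp add: reflect_apply)
qed (use householder_carrier[OF assms] in auto)

lemma conj_outer:
  assumes H: "H \<in> carrier_mat n n" "H\<^sup>T = H" and v: "v \<in> carrier_vec n"
  shows "H * outer v * H = outer (H *\<^sub>v v)"
proof (rule mat_eq_by_vec[of _ n n])
  fix x :: "real vec" assume x: "x \<in> carrier_vec n"
  have oc: "outer v \<in> carrier_mat n n" using v by simp
  have Hx: "H *\<^sub>v x \<in> carrier_vec n" using H x by auto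
  have "H * outer v * H *\<^sub>v x = H *\<^sub>v (outer v *\<^sub>v (H *\<^sub>v x))"
    using assoc_mult_mat_vec[of "H * outer v" n n H n x] assoc_mult_mat_vec[of H n n "outer v" n "H *\<^sub>v x"]
      H oc x Hx by (simp del: assoc_mult_mat)
  also have "\<dots> = (v \<bullet> (H *\<^sub>v x)) \<cdot>\<^sub>v (H *\<^sub>v v)"
    using v Hx H by (simp add: outer_mult_vec mult_mat_vec[of _ n n])
  also have "v \<bullet> (H *\<^sub>v x) = (H *\<^sub>v v) \<bullet> x"
    using transpose_vec_mult_scalar[OF H(1) x v] H(2) by simp
  finally show "H * outer v * H *\<^sub>v x = outer (H *\<^sub>v v) *\<^sub>v x"
    using H v x by (simp add: outer_mult_vec[of _ n])
qed (use assms in auto)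

text \<open>As \<open>w\<close> lies in the range of \<open>Q\<close>, the reflection
  \<open>H\<close> commutes with \<open>Q\<close> and \<open>H Q H = Q\<close>. Reflecting the noise
  conjugates both middle matrices with \<open>H\<close>, which leaves \<open>Q\<close> alone and
  moves \<open>y\<close> to \<open>H y\<close>.\<close>

lemma leverage_reflect:
  assumes Q: "orth_proj n Q" and w: "w \<in> carrier_vec n" "w \<bullet> w = 1" "Q *\<^sub>v w = w" and y: "y \<in> carrier_vec n"
  shows "leverage n p Q y (reflect n p (\<lambda>i. w $ i) z) = leverage n p Q (householder w *\<^sub>v y) z"
proof -
  define H where "H = householder w"
  have H: "H \<in> carrier_mat n n" "H\<^sup>T = H" "H * H = 1\<^sub>m n"
    unfolding H_def using w householder_involution by auto
  note Q' = orth_projD[OF Q]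
  define Z where "Z = noise_mat n p z"
  have Z: "Z \<in> carrier_mat n p" unfolding Z_def by simp
  have QH: "Q *\<^sub>v (H *\<^sub>v x) = H *\<^sub>v (Q *\<^sub>v x)" if x: "x \<in> carrier_vec n" for x
  proof -
    have "w \<bullet> (Q *\<^sub>v x) = w \<bullet> x"
      using sym_form[OF Q'(1,2) x w(1)] w(3) comm_scalar_prod[OF x w(1)] by simp
    moreover have "Q *\<^sub>v (x - (2 * (w \<bullet> x)) \<cdot>\<^sub>v w) = Q *\<^sub>v x - (2 * (w \<bullet> x)) \<cdot>\<^sub>v w"
      using Q'(1) x w by (simp add: mult_minus_distrib_mat_vec[of _ n n] mult_mat_vec[of _ n n])
    ultimately show ?thesis
      unfolding H_def using w x Q'(1) by (simp add: householder_mult_vec[of _ n])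
  qed
  have HQH: "H * Q * H = Q"
  proof (rule mat_eq_by_vec[of _ n n])
    fix x :: "real vec" assume x: "x \<in> carrier_vec n"
    have "H * Q * H *\<^sub>v x = H *\<^sub>v (Q *\<^sub>v (H *\<^sub>v x))"
      using assoc_mult_mat_vec[of "H * Q" n n H n x] assoc_mult_mat_vec[of H n n Q n "H *\<^sub>v x"] H Q' x
      by (simp del: assoc_mult_mat)
    also have "\<dots> = Q *\<^sub>v x"
      unfolding QH[OF x] using H Q' x by (intro mult_vec_cancel_left[of _ n n]) auto
    finally show "H * Q * H *\<^sub>v x = Q *\<^sub>v x" .
  qed (use H Q' in auto)
  have conj: "(H * Z)\<^sup>T * A * (H * Z) = Z\<^sup>T * (H * A * H) * Z" if A: "A \<in> carrier_mat n n" for A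
    using H Z A
    by (simp add: transpose_mult[of _ n n _ p] assoc_mult_mat[of _ p n _ n _ p] assoc_mult_mat[of _ p n _ n _ n]
        assoc_mult_mat[of _ n n _ n _ p] assoc_mult_mat[of _ n n _ n _ n] mult_carrier_mat[of _ n n _ p] mult_carrier_mat[of _ n n _ n]
        mult_carrier_mat[of _ p n _ n])
  have oc: "outer (Q *\<^sub>v y) \<in> carrier_mat n n" using Q' y by (simp add: mult_mat_vec_carrier[of _ n n])
  have "H * (Q - outer (Q *\<^sub>v y)) * H = H * Q * H - H * outer (Q *\<^sub>v y) * H"
    using H Q' oc
    by (simp add: mult_minus_distrib_mat[of _ n n _ n] minus_mult_distrib_mat[of _ n n _ _ n] mult_carrier_mat[of _ n n _ n] del: assoc_mult_mat)
  also have "\<dots> = Q - outer (Q *\<^sub>v (H *\<^sub>v y))"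
    unfolding HQH QH[OF y] using conj_outer[OF H(1,2), of "Q *\<^sub>v y"] Q' y by (simp add: mult_mat_vec_carrier[of _ n n])
  finally have eq: "H * (Q - outer (Q *\<^sub>v y)) * H = Q - outer (Q *\<^sub>v (H *\<^sub>v y))" .
  show ?thesis
    unfolding leverage_def noise_mat_reflect[OF w(1)] H_def[symmetric] Z_def[symmetric]
    using conj[OF minus_carrier_mat[OF oc, of Q]] conj[OF Q'(1)] eq HQH by simp
qed

context gaussian_noise
begin

context
  fixes Q :: "real mat"
  assumes Q: "orth_proj n Q" and trQ: "tr Q \<ge> real p"
begin

text \<open>The condition on the trace leaves room for \<open>p\<close> orthonormal vectors in the
  range of \<open>Q\<close>. They form \<open>D\<close>, and the Gram matrix is positive definite
  wherever the determinant of \<open>D^T Q Z\<close> does not vanish.\<close>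

lemma AE_gram_pos_def: "AE x in M. pos_def p ((Z x)\<^sup>T * Q * Z x)"
proof -
  obtain D where D: "D \<in> carrier_mat n p" "D\<^sup>T * Q * D = 1\<^sub>m p"
    using orth_proj_section[OF Q trQ] by auto
  have "D\<^sup>T * Q \<in> carrier_mat p n" using D orth_projD[OF Q] by auto
  from AE_det_noise[OF this D] show ?thesis
    by eventually_elim (rule gram_det_nonzero[OF Q _ D(1)], auto)
qed

abbreviation "lev y x \<equiv> leverage n p Q y (E x)"

text \<open>The exceptional set is where the Gram matrix degenerates and does not depend on
  \<open>y\<close>. The sums over coordinate vectors below need forms of one and the same
  projection.\<close>

lemma AE_leverage_form:
  "AE x in M. pos_def p ((Z x)\<^sup>T * Q * Z x) \<and> orth_proj n (gram_proj Q (Z x)) \<and> tr (gram_proj Q (Z x)) = real p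
    \<and> Q * gram_proj Q (Z x) = gram_proj Q (Z x)
    \<and> (\<forall>y \<in> carrier_vec n. lev y x = y \<bullet> (gram_proj Q (Z x) *\<^sub>v y))"
  using AE_gram_pos_def
proof eventually_elim
  case (elim x)
  then have d: "det ((Z x)\<^sup>T * Q * Z x) \<noteq> 0" using pos_def_det by fastforce
  have Zc: "Z x \<in> carrier_mat n p" by simp
  show ?case
    using elim gram_proj[OF Q Zc d] gram_proj_form[OF Q Zc d] unfolding leverage_def by simp
qed

lemma lev_measurable: "y \<in> carrier_vec n \<Longrightarrow> lev y \<in> borel_measurable M"
  by (rule measurable_compose[OF E_meas leverage_measurable[OF orth_projD(1)[OF Q]]])

lemma AE_lev_bounds: "y \<in> carrier_vec n \<Longrightarrow> AE x in M. 0 \<le> lev y x \<and> lev y x \<le> y \<bullet> y"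
  using AE_leverage_form
  by eventually_elim (use orth_proj_form_nonneg orth_proj_form_le in auto)

lemma lev_integrable: "y \<in> carrier_vec n \<Longrightarrow> integrable M (\<lambda>x. lev y x ^ k)"
proof -
  assume y: "y \<in> carrier_vec n"
  have "AE x in M. norm (lev y x ^ k) \<le> (y \<bullet> y) ^ k"
    using AE_lev_bounds[OF y] by eventually_elim (auto simp: norm_power intro!: power_mono)
  then show ?thesis
    using lev_measurable[OF y] by (intro integrable_const_bound) auto
qed

text \<open>Both vectors lie in the range of \<open>Q\<close>, hence so does their normalised
  difference \<open>w\<close>. The reflection along \<open>w\<close> exchanges them and preserves
  the law of the noise.\<close>

lemma lev_equidistributed:
  assumes y: "y \<in> carrier_vec n" "Q *\<^sub>v y = y" and y': "y' \<in> carrier_vec n" "Q *\<^sub>v y' = y'" and eq: "y \<bullet> y = y' \<bullet> y'"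
  shows "expectation (\<lambda>x. lev y x ^ k) = expectation (\<lambda>x. lev y' x ^ k)"
proof (cases "y = y'")
  case False
  define w where "w = (1 / sqrt ((y - y') \<bullet> (y - y'))) \<cdot>\<^sub>v (y - y')"
  note w = householder_swap[OF y(1) y'(1) eq False, folded w_def]
  note Q' = orth_projD[OF Q]
  have Qw: "Q *\<^sub>v w = w"
    unfolding w_def using Q'(1) y y'
    by (simp add: mult_mat_vec[of _ n n] mult_minus_distrib_mat_vec[of _ n n])
  \<comment> \<open>Reflection invariance is available for nonnegative integrals; the leverage is
    nonnegative almost surely.\<close>
  have nn: "expectation (\<lambda>x. lev v x ^ k) = enn2real (\<integral>\<^sup>+ x. ennreal (lev v x ^ k) \<partial>M)"
    if v: "v \<in> carrier_vec n" for v
  proof (rule integral_eq_nn_integral)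
    show "(\<lambda>x. lev v x ^ k) \<in> borel_measurable M" using lev_measurable[OF v] by simp
    show "AE x in M. 0 \<le> lev v x ^ k" using AE_lev_bounds[OF v] by eventually_elim auto
  qed
  have ww: "(\<Sum>k<n. w $ k * w $ k) = 1"
    using w(1,2) by (simp add: scalar_prod_def lessThan_atLeast0)
  have [measurable]: "leverage n p Q y' \<in> borel_measurable (lborel_mat n p)"
    using Q' y' by (intro leverage_measurable)
  have "(\<integral>\<^sup>+ x. ennreal (lev y x ^ k) \<partial>M) = (\<integral>\<^sup>+ x. ennreal (leverage n p Q y' (reflect n p (\<lambda>i. w $ i) (E x)) ^ k) \<partial>M)"
    using leverage_reflect[OF Q w(1,2) Qw y'(1)] w(3) by simp
  also have "\<dots> = (\<integral>\<^sup>+ x. ennreal (lev y' x ^ k) \<partial>M)"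
    by (rule noise_reflect[OF ww, where f = "\<lambda>z. ennreal (leverage n p Q y' z ^ k)"]) measurable
  finally show ?thesis unfolding nn[OF y(1)] nn[OF y'(1)] by simp
qed simp

text \<open>The random projection satisfies \<open>P Q = P\<close>, so \<open>y\<close> and
  \<open>Q y\<close> have the same leverage, which is homogeneous of degree two. Normalising
  \<open>Q y\<close> reduces the claim to equidistribution.\<close>

lemma lev_scaling:
  assumes u: "u \<in> carrier_vec n" "u \<bullet> u = 1" "Q *\<^sub>v u = u" and y: "y \<in> carrier_vec n" and k: "k > 0"
  shows "expectation (\<lambda>x. lev y x ^ k) = (y \<bullet> (Q *\<^sub>v y)) ^ k * expectation (\<lambda>x. lev u x ^ k)"
proof -
  note Q' = orth_projD[OF Q]
  define q where "q = Q *\<^sub>v y"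
  have q: "q \<in> carrier_vec n" "Q *\<^sub>v q = q" unfolding q_def using Q' y orth_proj_idem[OF Q y] by auto
  have qq: "y \<bullet> (Q *\<^sub>v y) = q \<bullet> q" unfolding q_def by (rule orth_proj_form[OF Q y y])
  have form: "AE x in M. lev y x = q \<bullet> (gram_proj Q (Z x) *\<^sub>v q)"
    using AE_leverage_form
  proof eventually_elim
    case (elim x)
    let ?P = "gram_proj Q (Z x)"
    have P: "orth_proj n ?P" and QP: "Q * ?P = ?P" and f: "lev y x = y \<bullet> (?P *\<^sub>v y)"
      using elim y by auto
    note P' = orth_projD[OF P]
    have PQ: "?P * Q = ?P" using transpose_mult[OF Q'(1) P'(1)] QP Q'(2) P'(2) by simp
    have "?P *\<^sub>v q = ?P *\<^sub>v y"
      unfolding q_def using assoc_mult_mat_vec[OF P'(1) Q'(1) y] PQ by simp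
    then have "q \<bullet> (?P *\<^sub>v q) = (?P *\<^sub>v q) \<bullet> (?P *\<^sub>v q)" "y \<bullet> (?P *\<^sub>v y) = (?P *\<^sub>v q) \<bullet> (?P *\<^sub>v q)"
      using orth_proj_form[OF P q(1) q(1)] orth_proj_form[OF P y y] by auto
    then show ?case using f by simp
  qed
  show ?thesis
  proof (cases "q = 0\<^sub>v n")
    case True
    have "AE x in M. lev y x ^ k = 0"
      using form AE_leverage_form
    proof eventually_elim
      case (elim x)
      then have "gram_proj Q (Z x) *\<^sub>v q \<in> carrier_vec n"
        using q orth_projD(1)[of n "gram_proj Q (Z x)"] by auto
      then show ?case using elim True k by simp
    qed
    then have "expectation (\<lambda>x. lev y x ^ k) = expectation (\<lambda>_. 0)"
      using lev_measurable[OF y] by (intro integral_cong_AE) auto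
    then show ?thesis unfolding qq using True k by simp
  next
    case False
    have pos: "q \<bullet> q > 0" by (rule scalar_prod_self_pos[OF q(1) False])
    define c where "c = 1 / sqrt (q \<bullet> q)"
    define v where "v = c \<cdot>\<^sub>v q"
    have v: "v \<in> carrier_vec n" unfolding v_def using q by simp
    have Qv: "Q *\<^sub>v v = v" unfolding v_def using mult_mat_vec[OF Q'(1) q(1)] q(2) by simp
    have vv: "v \<bullet> v = u \<bullet> u" unfolding v_def c_def u(2) by (rule normalize_vec[OF q(1) pos])
    have "AE x in M. lev y x ^ k = (q \<bullet> q) ^ k * lev v x ^ k"
      using form AE_leverage_form
    proof eventually_elim
      case (elim x)
      let ?P = "gram_proj Q (Z x)"
      have P: "?P \<in> carrier_mat n n" using elim orth_projD(1) by auto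
      have "lev v x = v \<bullet> (?P *\<^sub>v v)" using elim v by auto
      also have "\<dots> = c\<^sup>2 * (q \<bullet> (?P *\<^sub>v q))"
        unfolding v_def using mult_mat_vec[OF P q(1)] q(1) P by (simp add: power2_eq_square mult_mat_vec_carrier[of _ n n])
      finally have "lev v x = c\<^sup>2 * lev y x" using elim by simp
      then have "lev y x = (q \<bullet> q) * lev v x" unfolding c_def using pos by (simp add: power_divide)
      then show ?case by (simp add: power_mult_distrib)
    qed
    then have "expectation (\<lambda>x. lev y x ^ k) = expectation (\<lambda>x. (q \<bullet> q) ^ k * lev v x ^ k)"
      using lev_measurable[OF y] lev_measurable[OF v] by (intro integral_cong_AE) auto
    also have "\<dots> = (q \<bullet> q) ^ k * expectation (\<lambda>x. lev v x ^ k)" by simp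
    also have "expectation (\<lambda>x. lev v x ^ k) = expectation (\<lambda>x. lev u x ^ k)"
      by (rule lev_equidistributed[OF v Qv u(1,3) vv])
    finally show ?thesis unfolding qq .
  qed
qed

text \<open>The vectors \<open>e i\<close>, \<open>e i + e j\<close> and \<open>e i - e j\<close>
  need not lie in the range of \<open>Q\<close>; \<open>lev_scaling\<close> admits them and turns
  each expected power into the same power of the form of \<open>Q\<close> times the moment for
  \<open>u\<close>. For the random projection of trace \<open>p\<close> the same sums are constant
  almost surely.\<close>

lemma lev_moments:
  assumes u: "u \<in> carrier_vec n" "u \<bullet> u = 1" "Q *\<^sub>v u = u"
  shows "tr Q * expectation (lev u) = real p"
    and "tr Q * (tr Q + 2) * expectation (\<lambda>x. (lev u x)\<^sup>2) = real p * (real p + 2)"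
proof -
  define e where "e i = (unit_vec n i :: real vec)" for i
  have ec: "e i \<in> carrier_vec n" "e i + e j \<in> carrier_vec n" "e i - e j \<in> carrier_vec n" for i j
    unfolding e_def by auto
  define a1 a2 where "a1 = expectation (lev u)" "a2 = expectation (\<lambda>x. (lev u x)\<^sup>2)"
  have m1: "expectation (lev y) = (y \<bullet> (Q *\<^sub>v y)) * a1" if "y \<in> carrier_vec n" for y
    using lev_scaling[OF u that, of 1] unfolding a1_a2_def by simp
  have m2: "expectation (\<lambda>x. (lev y x)\<^sup>2) = (y \<bullet> (Q *\<^sub>v y))\<^sup>2 * a2" if "y \<in> carrier_vec n" for y
    using lev_scaling[OF u that, of 2] unfolding a1_a2_def by simp
  have i1: "integrable M (lev y)" if "y \<in> carrier_vec n" for y using lev_integrable[OF that, of 1] by simp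
  have i2: "integrable M (\<lambda>x. (lev y x)\<^sup>2)" if "y \<in> carrier_vec n" for y using lev_integrable[OF that, of 2] .
  have "AE x in M. (\<Sum>i<n. lev (e i) x) = real p"
    using AE_leverage_form
  proof eventually_elim
    case (elim x)
    then show ?case using orth_proj_sum_identity(1)[of n "gram_proj Q (Z x)"] ec by (simp add: e_def)
  qed
  then have "expectation (\<lambda>x. \<Sum>i<n. lev (e i) x) = expectation (\<lambda>_. real p)"
    by (intro integral_cong_AE borel_measurable_sum borel_measurable_const lev_measurable ec)
  also have "expectation (\<lambda>x. \<Sum>i<n. lev (e i) x) = (\<Sum>i<n. expectation (lev (e i)))"
    using ec i1 by (intro Bochner_Integration.integral_sum) auto
  also have "\<dots> = (\<Sum>i<n. e i \<bullet> (Q *\<^sub>v e i)) * a1"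
    using ec by (simp add: m1 sum_distrib_right)
  also have "(\<Sum>i<n. e i \<bullet> (Q *\<^sub>v e i)) = tr Q" using orth_proj_sum_identity(1)[OF Q] unfolding e_def .
  finally show "tr Q * expectation (lev u) = real p" unfolding a1_a2_def by (simp add: prob_space)
  let ?F = "\<lambda>x. (\<Sum>i<n. \<Sum>j<n. (lev (e i + e j) x)\<^sup>2 + (lev (e i - e j) x)\<^sup>2) - 4 * real n * (\<Sum>i<n. (lev (e i) x)\<^sup>2)"
  have "AE x in M. ?F x = 4 * (real p)\<^sup>2 + 8 * real p"
    using AE_leverage_form
  proof eventually_elim
    case (elim x)
    then show ?case using orth_proj_sum_identity(2)[of n "gram_proj Q (Z x)"] ec by (simp add: e_def)
  qed
  note AE_F = this
  have "expectation ?F = expectation (\<lambda>_. 4 * (real p)\<^sup>2 + 8 * real p)"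
  proof (rule integral_cong_AE)
    show "?F \<in> borel_measurable M"
      by (intro borel_measurable_sum borel_measurable_diff borel_measurable_add borel_measurable_times
          borel_measurable_power borel_measurable_const lev_measurable ec)
  qed (rule borel_measurable_const, rule AE_F)
  also have "expectation ?F = (\<Sum>i<n. \<Sum>j<n. expectation (\<lambda>x. (lev (e i + e j) x)\<^sup>2) + expectation (\<lambda>x. (lev (e i - e j) x)\<^sup>2))
      - 4 * real n * (\<Sum>i<n. expectation (\<lambda>x. (lev (e i) x)\<^sup>2))"
    using ec i2 by (simp add: Bochner_Integration.integral_sum Bochner_Integration.integral_add
        Bochner_Integration.integral_diff)
  also have "\<dots> = ((\<Sum>i<n. \<Sum>j<n. ((e i + e j) \<bullet> (Q *\<^sub>v (e i + e j)))\<^sup>2 + ((e i - e j) \<bullet> (Q *\<^sub>v (e i - e j)))\<^sup>2)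
      - 4 * real n * (\<Sum>i<n. (e i \<bullet> (Q *\<^sub>v e i))\<^sup>2)) * a2"
    using ec by (simp add: m2 sum_distrib_right left_diff_distrib distrib_right mult.assoc)
  also have "\<dots> = (4 * (tr Q)\<^sup>2 + 8 * tr Q) * a2"
    unfolding e_def orth_proj_sum_identity(2)[OF Q] ..
  finally show "tr Q * (tr Q + 2) * expectation (\<lambda>x. (lev u x)\<^sup>2) = real p * (real p + 2)"
    unfolding a1_a2_def by (simp add: power2_eq_square algebra_simps prob_space)
qed

lemma lev_markov:
  assumes u: "u \<in> carrier_vec n" "u \<bullet> u = 1" "Q *\<^sub>v u = u" and K: "K > 0" and p: "p \<ge> 1"
  shows "prob {x \<in> space M. lev u x \<ge> K} \<le> real p / tr Q / K"
proof -
  have "prob {x \<in> space M. K \<le> lev u x} \<le> expectation (lev u) / K"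
    using lev_integrable[OF u(1), of 1] AE_lev_bounds[OF u(1)] K
    by (intro integral_Markov_inequality_measure[where A = "{}"]) auto
  also have "expectation (lev u) = real p / tr Q"
    using lev_moments(1)[OF u] trQ p by (simp add: field_simps)
  finally show ?thesis .
qed

text \<open>With \<open>N = tr Q\<close> the variance is \<open>2 p (N - p) / (N^2 (N + 2))\<close>,
  as for a beta variable with parameters \<open>p / 2\<close> and \<open>(N - p) / 2\<close>, and
  hence at most \<open>2 p / N^2\<close>. A fixed relative deviation from the mean thus has
  probability of order \<open>1 / p\<close>, which is small if \<open>p\<close> is large.\<close>

lemma lev_chebyshev:
  assumes u: "u \<in> carrier_vec n" "u \<bullet> u = 1" "Q *\<^sub>v u = u" and \<eta>: "\<eta> > 0" and p: "p \<ge> 1"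
  shows "prob {x \<in> space M. lev u x \<ge> (1 + \<eta>) * (real p / tr Q)} \<le> 2 / (\<eta>\<^sup>2 * real p)"
proof -
  define N where "N = tr Q"
  have N: "N \<ge> real p" "N > 0" using trQ p unfolding N_def by auto
  have rv: "random_variable borel (lev u)" by (rule lev_measurable[OF u(1)])
  have e1: "expectation (lev u) = real p / N"
    using lev_moments(1)[OF u] N unfolding N_def by (simp add: field_simps)
  have e2: "expectation (\<lambda>x. (lev u x)\<^sup>2) = real p * (real p + 2) / (N * (N + 2))"
  proof -
    have "N * (N + 2) \<noteq> 0" using N by simp
    then show ?thesis using lev_moments(2)[OF u] unfolding N_def[symmetric]
      by (simp add: nonzero_eq_divide_eq mult_ac)
  qed
  have int2: "integrable M (\<lambda>x. (lev u x)\<^sup>2)" by (rule lev_integrable[OF u(1)])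
  have "variance (lev u) = expectation (\<lambda>x. (lev u x)\<^sup>2) - (expectation (lev u))\<^sup>2"
    using lev_integrable[OF u(1), of 1] int2 by (intro variance_eq) auto
  also have "\<dots> = 2 * real p * (N - real p) / (N\<^sup>2 * (N + 2))"
  proof -
    have 1: "real p * (real p + 2) / (N * (N + 2)) = real p * (real p + 2) * N / (N\<^sup>2 * (N + 2))"
      and 2: "(real p / N)\<^sup>2 = (real p)\<^sup>2 * (N + 2) / (N\<^sup>2 * (N + 2))"
      using N by (simp_all add: power2_eq_square)
    have 3: "real p * (real p + 2) * N - (real p)\<^sup>2 * (N + 2) = 2 * real p * (N - real p)"
      by (simp add: power2_eq_square algebra_simps)
    show ?thesis unfolding e1 e2 1 2 diff_divide_distrib[symmetric] 3 ..
  qed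
  also have "\<dots> \<le> 2 * real p * (N + 2) / (N\<^sup>2 * (N + 2))"
    using N by (intro divide_right_mono mult_left_mono) auto
  also have "\<dots> = 2 * real p / N\<^sup>2" using N by simp
  finally have var: "variance (lev u) \<le> 2 * real p / N\<^sup>2" .
  define t where "t = \<eta> * (real p / N)"
  have t: "t > 0" unfolding t_def using \<eta> p N by auto
  have "prob {x \<in> space M. lev u x \<ge> (1 + \<eta>) * (real p / N)} \<le> prob {x \<in> space M. t \<le> \<bar>lev u x - expectation (lev u)\<bar>}"
  proof (rule finite_measure_mono)
    show "{x \<in> space M. lev u x \<ge> (1 + \<eta>) * (real p / N)} \<subseteq> {x \<in> space M. t \<le> \<bar>lev u x - expectation (lev u)\<bar>}"
    proof (rule Collect_mono, intro impI conjI; elim conjE)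
      fix x assume "x \<in> space M" "(1 + \<eta>) * (real p / N) \<le> lev u x"
      then have "t \<le> lev u x - expectation (lev u)" unfolding e1 t_def by (simp add: algebra_simps add_divide_distrib)
      then show "t \<le> \<bar>lev u x - expectation (lev u)\<bar>" by linarith
    qed simp
    show "{x \<in> space M. t \<le> \<bar>lev u x - expectation (lev u)\<bar>} \<in> sets M"
      using rv by measurable
  qed
  also have "\<dots> \<le> variance (lev u) / t\<^sup>2"
    by (rule Chebyshev_inequality[OF rv int2 t])
  also have "\<dots> \<le> (2 * real p / N\<^sup>2) / t\<^sup>2" using var t by (intro divide_right_mono) auto
  also have "\<dots> = 2 / (\<eta>\<^sup>2 * real p)"
    unfolding t_def using N p \<eta> by (simp add: field_simps power2_eq_square)
  finally show ?thesis unfolding N_def .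
qed

end

text \<open>The trace is a sum of squared linear forms of the noise, with the vectors
  \<open>R e_i\<close> on the left and the columns of \<open>A\<close> on the right. The squared
  lengths of the former add up to \<open>tr R\<close>, the forms of \<open>S\<close> at the latter
  to \<open>tr (A^T S A)\<close>. The 8 is inherited from \<open>noise_second_moment\<close>;
  Markov's inequality concludes.\<close>

lemma frobenius_bound:
  assumes R: "orth_proj n R" and A: "A \<in> carrier_mat p g" and K: "K > 0"
  shows "prob {x \<in> space M. tr ((Z x * A)\<^sup>T * R * (Z x * A)) \<ge> K} \<le> 8 * tr R * tr (A\<^sup>T * S * A) / K"
    and "{x \<in> space M. tr ((Z x * A)\<^sup>T * R * (Z x * A)) \<ge> K} \<in> sets M"
proof -
  note R' = orth_projD[OF R]
  let ?r = "\<lambda>i. R *\<^sub>v unit_vec n i" and ?a = "\<lambda>b. Matrix.col A b"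
  let ?F = "\<lambda>x. tr ((Z x * A)\<^sup>T * R * (Z x * A))"
  have rc: "?r i \<in> carrier_vec n" for i using R' by auto
  have ac: "?a b \<in> carrier_vec p" for b using A by auto
  have F: "?F x = (\<Sum>b<g. \<Sum>i<n. (?r i \<bullet> (Z x *\<^sub>v ?a b))\<^sup>2)" for x
  proof -
    have G: "Z x * A \<in> carrier_mat n g" using A by auto
    have col: "Matrix.col (Z x * A) b = Z x *\<^sub>v ?a b" if "b < g" for b
      using that A by (intro eq_vecI) auto
    have "((Z x * A)\<^sup>T * R * (Z x * A)) $$ (b, b) = (\<Sum>i<n. (?r i \<bullet> (Z x *\<^sub>v ?a b))\<^sup>2)" if b: "b < g" for b
    proof -
      define y where "y = Z x *\<^sub>v ?a b"
      have y: "y \<in> carrier_vec n" unfolding y_def using ac by (simp add: mult_mat_vec_carrier[of _ n p])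
      have "(Z x * A)\<^sup>T * R * (Z x * A) = (Z x * A)\<^sup>T * (R * (Z x * A))"
        using G R' by (intro assoc_mult_mat[of _ g n _ n _ g]) auto
      then have "((Z x * A)\<^sup>T * R * (Z x * A)) $$ (b, b) = Matrix.col (Z x * A) b \<bullet> Matrix.col (R * (Z x * A)) b"
        using b G R' A by (simp del: assoc_mult_mat)
      also have "Matrix.col (R * (Z x * A)) b = R *\<^sub>v Matrix.col (Z x * A) b"
        using b G R' by (intro eq_vecI) auto
      also have "Matrix.col (Z x * A) b \<bullet> (R *\<^sub>v Matrix.col (Z x * A) b) = y \<bullet> (R *\<^sub>v y)"
        unfolding col[OF b] y_def ..
      also have "\<dots> = (R *\<^sub>v y) \<bullet> (R *\<^sub>v y)" by (rule orth_proj_form[OF R y y])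
      also have "\<dots> = (\<Sum>i<n. ((R *\<^sub>v y) $ i)\<^sup>2)"
        using R' by (simp add: scalar_prod_def lessThan_atLeast0 power2_eq_square)
      also have "\<dots> = (\<Sum>i<n. (?r i \<bullet> y)\<^sup>2)"
      proof (rule sum.cong[OF HOL.refl])
        fix i assume "i \<in> {..<n}"
        then have i: "i < n" by simp
        have "?r i \<bullet> y = unit_vec n i \<bullet> (R *\<^sub>v y)"
          using transpose_vec_mult_scalar[OF R'(1) y, of "unit_vec n i"] R'(2) by simp
        also have "\<dots> = (R *\<^sub>v y) $ i" using i R' y by (simp add: scalar_prod_left_unit[of _ n] mult_mat_vec_carrier[of _ n n] del: index_mult_mat_vec)
        finally show "((R *\<^sub>v y) $ i)\<^sup>2 = (?r i \<bullet> y)\<^sup>2" by simp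
      qed
      finally show ?thesis unfolding y_def .
    qed
    then show ?thesis unfolding tr_def using G A by simp
  qed
  have lm: "(\<lambda>x. ?r i \<bullet> (Z x *\<^sub>v ?a b)) \<in> borel_measurable M" for i b
    by (rule measurable_compose[OF E_meas linear_form_measurable[OF rc ac]])
  have Fm: "?F \<in> borel_measurable M"
    unfolding F by (intro borel_measurable_sum borel_measurable_power lm)
  then show "{x \<in> space M. ?F x \<ge> K} \<in> sets M" by measurable
  have Sc: "S \<in> carrier_mat p p" using S_inv by simp
  have sumr: "(\<Sum>i<n. ?r i \<bullet> ?r i) = tr R"
    using orth_proj_sum_identity(1)[OF R] orth_proj_form[OF R, of "unit_vec n _" "unit_vec n _"] by simp
  have suma: "(\<Sum>b<g. ?a b \<bullet> (S *\<^sub>v ?a b)) = tr (A\<^sup>T * S * A)"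
  proof -
    have "(A\<^sup>T * S * A) $$ (b, b) = ?a b \<bullet> (S *\<^sub>v ?a b)" if b: "b < g" for b
    proof -
      have "A\<^sup>T * S * A = A\<^sup>T * (S * A)" using A Sc by (intro assoc_mult_mat[of _ g p _ p _ g]) auto
      moreover have "Matrix.col (S * A) b = S *\<^sub>v ?a b" using A Sc b by (intro eq_vecI) auto
      ultimately show ?thesis using A Sc b by (simp del: assoc_mult_mat)
    qed
    then show ?thesis unfolding tr_def using A by simp
  qed
  have Snn: "0 \<le> ?a b \<bullet> (S *\<^sub>v ?a b)" for b
    using pos_def_psd[OF S] ac unfolding psd_def by auto
  have "(\<integral>\<^sup>+ x. ennreal (?F x) \<partial>M) = (\<Sum>b<g. \<Sum>i<n. \<integral>\<^sup>+ x. ennreal ((?r i \<bullet> (Z x *\<^sub>v ?a b))\<^sup>2) \<partial>M)"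
    unfolding F using lm
    by (simp add: sum_ennreal[symmetric] sum_nonneg nn_integral_sum del: sum_ennreal)
  also have "\<dots> \<le> (\<Sum>b<g. \<Sum>i<n. ennreal (8 * (?r i \<bullet> ?r i) * (?a b \<bullet> (S *\<^sub>v ?a b))))"
    by (intro sum_mono noise_second_moment rc ac)
  also have "\<dots> = ennreal (\<Sum>b<g. \<Sum>i<n. 8 * (?r i \<bullet> ?r i) * (?a b \<bullet> (S *\<^sub>v ?a b)))"
    using Snn scalar_prod_self_nonneg by (simp add: sum_ennreal sum_nonneg)
  also have "(\<Sum>b<g. \<Sum>i<n. 8 * (?r i \<bullet> ?r i) * (?a b \<bullet> (S *\<^sub>v ?a b))) = 8 * tr R * tr (A\<^sup>T * S * A)"
    unfolding sumr[symmetric] suma[symmetric]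
    by (subst sum.swap) (simp add: sum_distrib_left sum_distrib_right mult_ac)
  finally have le: "(\<integral>\<^sup>+ x. ennreal (?F x) \<partial>M) \<le> ennreal (8 * tr R * tr (A\<^sup>T * S * A))" .
  have nn: "8 * tr R * tr (A\<^sup>T * S * A) \<ge> 0"
    unfolding sumr[symmetric] suma[symmetric] using Snn scalar_prod_self_nonneg by (simp add: sum_nonneg)
  have Fnn: "0 \<le> ?F x" for x unfolding F by (intro sum_nonneg) simp
  have eq: "{x \<in> space M. K \<le> ?F x} = {x \<in> space M. 1 \<le> ennreal (1 / K) * ennreal (?F x)}"
    using K Fnn by (auto simp: ennreal_mult'[symmetric] ennreal_1[symmetric] field_simps simp del: ennreal_1)
  have "emeasure M {x \<in> space M. K \<le> ?F x} \<le> ennreal (1 / K) * (\<integral>\<^sup>+ x. ennreal (?F x) * indicator (space M) x \<partial>M)"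
    unfolding eq using Fm by (intro nn_integral_Markov_inequality) auto
  also have "(\<integral>\<^sup>+ x. ennreal (?F x) * indicator (space M) x \<partial>M) = (\<integral>\<^sup>+ x. ennreal (?F x) \<partial>M)"
    by (intro nn_integral_cong) auto
  also have "ennreal (1 / K) * (\<integral>\<^sup>+ x. ennreal (?F x) \<partial>M) \<le> ennreal (1 / K) * ennreal (8 * tr R * tr (A\<^sup>T * S * A))"
    using le by (intro mult_left_mono) auto
  also have "\<dots> = ennreal (8 * tr R * tr (A\<^sup>T * S * A) / K)"
    using K by (simp add: ennreal_mult'[symmetric])
  finally show "prob {x \<in> space M. ?F x \<ge> K} \<le> 8 * tr R * tr (A\<^sup>T * S * A) / K"
    using nn K by (simp add: emeasure_eq_measure)
qed

end

section \<open>Residual projections of a design matrix\<close>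

text \<open>A repeated column would leave fewer than \<open>k\<close> different columns, hence a
  maximal independent set of them with fewer than \<open>k\<close> elements, against the rank. So
  the columns are distinct, and then a nonzero kernel vector is a linear dependence among
  them.\<close>

lemma mat_rank_full_kernel:
  assumes A: "A \<in> carrier_mat n k" and r: "mat_rank A = k"
    and v: "v \<in> carrier_vec k" "A *\<^sub>v v = 0\<^sub>v n"
  shows "v = 0\<^sub>v k"
proof (rule ccontr)
  assume ne: "v \<noteq> 0\<^sub>v k"
  interpret vec_space "TYPE(real)" n .
  have r: "rank A = k" using r A unfolding mat_rank_def by auto
  have dist: "distinct (cols A)"
  proof (rule ccontr)
    assume nd: "\<not> distinct (cols A)"
    obtain S where S: "maximal S (\<lambda>T. T \<subseteq> set (cols A) \<and> lin_indpt T)"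
      using maximal_exists[of "(\<lambda>T. T \<subseteq> set (cols A) \<and> lin_indpt T)" "card (set (cols A))" "{}"]
      by (meson List.finite_set card_mono empty_iff empty_subsetI finite_lin_indpt2 rev_finite_subset)
    then have "card S \<le> card (set (cols A))" by (simp add: card_mono maximal_def)
    then have "card S < k"
      using A nd card_distinct[of "cols A"] card_length[of "cols A"] by (auto simp: nat_less_le)
    then show False using rank_card_indpt[OF A S] r by simp
  qed
  show False
    using full_rank_lin_indpt[OF A r dist] lin_depI[OF A v(1) ne v(2) dist] by blast
qed

section \<open>Selected columns and the projections onto their spans\<close>

lemma sub_cols_carrier:
  assumes "X \<in> carrier_mat n k" "j \<subseteq> {..<k}"
  shows "sub_cols X j \<in> carrier_mat n (card j)"
proof -
  have "{i. i < k \<and> i \<in> j} = j" using assms by auto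
  then show ?thesis using assms unfolding sub_cols_def by (intro carrier_matI) (simp_all add: dim_submatrix)
qed

lemma sub_cols_col:
  assumes X: "X \<in> carrier_mat n k" and j: "j \<subseteq> {..<k}" and c: "c < card j"
  shows "Matrix.col (sub_cols X j) c = Matrix.col X (pick j c)"
proof (rule eq_vecI)
  have e: "{i. i < k \<and> i \<in> j} = j" using j by auto
  have pj: "pick j c < k" using pick_in_set_le[OF c] j by auto
  fix r assume "r < dim_vec (Matrix.col X (pick j c))"
  then have r: "r < n" using X by simp
  then show "Matrix.col (sub_cols X j) c $ r = Matrix.col X (pick j c) $ r"
    using sub_cols_carrier[OF X j] X c pj e unfolding sub_cols_def
    by (simp add: submatrix_index pick_UNIV)
qed (use sub_cols_carrier[OF X j] X in simp)

text \<open>The vector is padded with zeros outside \<open>j\<close>; the position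
  \<open>card {a \<in> j. a < i}\<close> inverts the enumeration \<open>pick j\<close>.\<close>

lemma sub_cols_mult_vec:
  assumes X: "X \<in> carrier_mat n k" and j: "j \<subseteq> {..<k}" and v: "v \<in> carrier_vec (card j)"
  shows "sub_cols X j *\<^sub>v v = X *\<^sub>v Matrix.vec k (\<lambda>i. if i \<in> j then v $ card {a \<in> j. a < i} else 0)"
proof (rule eq_vecI)
  have fin: "finite j" using j finite_subset by auto
  fix r assume "r < dim_vec (X *\<^sub>v Matrix.vec k (\<lambda>i. if i \<in> j then v $ card {a \<in> j. a < i} else 0))"
  then have r: "r < n" using X by simp
  have inj: "inj_on (pick j) {..<card j}"
    proof (rule linorder_inj_onI')
    fix a b assume "a \<in> {..<card j}" "b \<in> {..<card j}" "a < b"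
    then show "pick j a \<noteq> pick j b" using pick_mono_le[of b j a] by simp
  qed
  have img: "pick j ` {..<card j} = j"
  proof
    show "pick j ` {..<card j} \<subseteq> j" using pick_in_set_le by auto
    show "j \<subseteq> pick j ` {..<card j}"
    proof
      fix i assume i: "i \<in> j"
      have "card {a \<in> j. a < i} < card j" using i fin by (intro psubset_card_mono) auto
      then show "i \<in> pick j ` {..<card j}"
        using pick_card_in_set[OF i] by (intro image_eqI[where x = "card {a \<in> j. a < i}"]) auto
    qed
  qed
  have "(X *\<^sub>v Matrix.vec k (\<lambda>i. if i \<in> j then v $ card {a \<in> j. a < i} else 0)) $ r =
      (\<Sum>i<k. if i \<in> j then X $$ (r, i) * v $ card {a \<in> j. a < i} else 0)"
    using X r by (auto simp: scalar_prod_def lessThan_atLeast0 intro!: sum.cong)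
  also have "\<dots> = (\<Sum>i\<in>j. X $$ (r, i) * v $ card {a \<in> j. a < i})"
    using j by (simp add: sum.inter_restrict[symmetric] Int_absorb1)
  also have "\<dots> = (\<Sum>c<card j. X $$ (r, pick j c) * v $ card {a \<in> j. a < pick j c})"
    using sum.reindex[OF inj, of "\<lambda>i. X $$ (r, i) * v $ card {a \<in> j. a < i}"] unfolding img by simp
  also have "\<dots> = (\<Sum>c<card j. sub_cols X j $$ (r, c) * v $ c)"
  proof (intro sum.cong HOL.refl)
    fix c assume "c \<in> {..<card j}"
    then have c: "c < card j" by simp
    have "pick j c < k" using pick_in_set_le[OF c] j by auto
    then have "sub_cols X j $$ (r, c) = X $$ (r, pick j c)"
      using arg_cong[OF sub_cols_col[OF X j c], of "\<lambda>v. v $ r"] sub_cols_carrier[OF X j] X r c by simp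
    then show "X $$ (r, pick j c) * v $ card {a \<in> j. a < pick j c} = sub_cols X j $$ (r, c) * v $ c"
      using card_pick_le[OF c] by simp
  qed
  also have "\<dots> = (sub_cols X j *\<^sub>v v) $ r"
    using sub_cols_carrier[OF X j] r v by (simp add: scalar_prod_def lessThan_atLeast0)
  finally show "(sub_cols X j *\<^sub>v v) $ r = (X *\<^sub>v Matrix.vec k (\<lambda>i. if i \<in> j then v $ card {a \<in> j. a < i} else 0)) $ r" ..
qed (use sub_cols_carrier[OF X j] X in simp)

text \<open>The projection onto the span of the columns in \<open>j\<close>, described by its values
  on these columns and on their orthogonal complement. Nesting, uniqueness and the effect of a new
  column follow from this description rather than from the formula with the inverse.\<close>

definition col_proj :: "nat \<Rightarrow> real mat \<Rightarrow> nat set \<Rightarrow> real mat \<Rightarrow> bool" where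
  "col_proj n X j P \<longleftrightarrow> P \<in> carrier_mat n n \<and> P\<^sup>T = P \<and>
    (\<forall>i\<in>j. P *\<^sub>v Matrix.col X i = Matrix.col X i) \<and>
    (\<forall>v\<in>carrier_vec n. (\<forall>i\<in>j. Matrix.col X i \<bullet> v = 0) \<longrightarrow> P *\<^sub>v v = 0\<^sub>v n)"

locale design =
  fixes n k :: nat and X :: "real mat"
  assumes X: "X \<in> carrier_mat n k" and rank: "mat_rank X = k"
begin

lemma col_carrier: "Matrix.col X i \<in> carrier_vec n"
  using X by (simp add: carrier_vecI)

text \<open>A kernel vector of the Gram matrix is one of the selected columns and, padded with
  zeros, one of \<open>X\<close>, whose columns are independent.\<close>

lemma gram_sub_cols:
  assumes j: "j \<subseteq> {..<k}"
  shows "det ((sub_cols X j)\<^sup>T * sub_cols X j) \<noteq> 0"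
proof
  note c = sub_cols_carrier[OF X j]
  let ?A = "sub_cols X j"
  have fin: "finite j" using j finite_subset by auto
  assume "det (?A\<^sup>T * ?A) = 0"
  moreover have "?A\<^sup>T * ?A \<in> carrier_mat (card j) (card j)" using c by auto
  ultimately obtain v where v: "v \<in> carrier_vec (card j)" "v \<noteq> 0\<^sub>v (card j)" "?A\<^sup>T * ?A *\<^sub>v v = 0\<^sub>v (card j)"
    using det_0_iff_vec_prod_zero_field by blast
  have Av: "?A *\<^sub>v v \<in> carrier_vec n" using c v by auto
  have "(?A *\<^sub>v v) \<bullet> (?A *\<^sub>v v) = v \<bullet> (?A\<^sup>T *\<^sub>v (?A *\<^sub>v v))"
    using transpose_vec_mult_scalar[of "?A\<^sup>T" "card j" n "?A *\<^sub>v v" v] c Av v by simp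
  also have "?A\<^sup>T *\<^sub>v (?A *\<^sub>v v) = 0\<^sub>v (card j)"
    using v c by (simp add: assoc_mult_mat_vec[of _ "card j" n _ "card j"])
  finally have "(?A *\<^sub>v v) \<bullet> (?A *\<^sub>v v) = 0" using v by simp
  then have "?A *\<^sub>v v = 0\<^sub>v n" using scalar_prod_self_eq_0[OF Av] by simp
  then have v0: "Matrix.vec k (\<lambda>i. if i \<in> j then v $ card {a \<in> j. a < i} else 0) = 0\<^sub>v k"
    unfolding sub_cols_mult_vec[OF X j v(1)] by (intro mat_rank_full_kernel[OF X rank]) auto
  have z: "(if i \<in> j then v $ card {a \<in> j. a < i} else 0) = 0" if "i < k" for i
    using arg_cong[OF v0, of "\<lambda>v. v $ i"] that by simp
  have "v $ c = 0" if c: "c < card j" for c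
    using z[of "pick j c"] pick_in_set_le[OF c] card_pick_le[OF c] j by auto
  then have "v = 0\<^sub>v (card j)" using v(1) by (intro eq_vecI) auto
  then show False using v(2) by simp
qed

lemma proj_mat_cols:
  assumes j: "j \<subseteq> {..<k}"
  shows "proj_mat X j * sub_cols X j = sub_cols X j"
    and "proj_mat X j \<in> carrier_mat n n" "(proj_mat X j)\<^sup>T = proj_mat X j"
    and "v \<in> carrier_vec n \<Longrightarrow> \<exists>y \<in> carrier_vec (card j). proj_mat X j *\<^sub>v v = sub_cols X j *\<^sub>v y"
    and "v \<in> carrier_vec n \<Longrightarrow> (sub_cols X j)\<^sup>T *\<^sub>v v = 0\<^sub>v (card j) \<Longrightarrow> proj_mat X j *\<^sub>v v = 0\<^sub>v n"
proof -
  let ?A = "sub_cols X j" let ?k = "card j"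
  note A = sub_cols_carrier[OF X j]
  define G where "G = ?A\<^sup>T * ?A"
  have G: "G \<in> carrier_mat ?k ?k" "G\<^sup>T = G" unfolding G_def using A by (auto simp: transpose_mult[of _ ?k n])
  have d: "det G \<noteq> 0" unfolding G_def by (rule gram_sub_cols[OF j])
  note i = inv_mat[OF G(1) d]
  have P: "proj_mat X j = ?A * (inv_mat G * ?A\<^sup>T)"
    unfolding proj_mat_def G_def[symmetric] using A i by (simp add: assoc_mult_mat[of _ n ?k _ ?k _ n])
  have c: "inv_mat G * ?A\<^sup>T \<in> carrier_mat ?k n" using A i by auto
  show "proj_mat X j \<in> carrier_mat n n" unfolding P using A c by auto
  show "(proj_mat X j)\<^sup>T = proj_mat X j"
    unfolding P using A c i inv_mat_transpose[OF G(1) d G(2)]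
    by (simp add: transpose_mult[of _ n ?k _ n] transpose_mult[of _ ?k ?k _ n] assoc_mult_mat[of _ n ?k _ ?k _ n])
  have "inv_mat G * ?A\<^sup>T * ?A = 1\<^sub>m ?k"
    using i A unfolding G_def[symmetric] by (simp add: assoc_mult_mat[of _ ?k ?k _ n _ ?k] G_def[symmetric])
  then show "proj_mat X j * ?A = ?A"
    unfolding P using assoc_mult_mat[OF A c A] A by simp
  {
    assume v: "v \<in> carrier_vec n"
    have Pv: "proj_mat X j *\<^sub>v v = ?A *\<^sub>v (inv_mat G *\<^sub>v (?A\<^sup>T *\<^sub>v v))"
      unfolding P using A c i v by (simp add: assoc_mult_mat_vec[of _ n ?k _ n] assoc_mult_mat_vec[of _ ?k ?k _ n])
    show "\<exists>y \<in> carrier_vec (card j). proj_mat X j *\<^sub>v v = ?A *\<^sub>v y"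
      unfolding Pv using A i v by (intro bexI[of _ "inv_mat G *\<^sub>v (?A\<^sup>T *\<^sub>v v)"]) auto
    assume "?A\<^sup>T *\<^sub>v v = 0\<^sub>v ?k"
    moreover have "inv_mat G *\<^sub>v 0\<^sub>v ?k = 0\<^sub>v ?k" "?A *\<^sub>v 0\<^sub>v ?k = 0\<^sub>v n" using A i by (auto intro!: eq_vecI)
    ultimately show "proj_mat X j *\<^sub>v v = 0\<^sub>v n" unfolding Pv by simp
  }
qed

lemma col_proj_proj_mat:
  assumes j: "j \<subseteq> {..<k}"
  shows "col_proj n X j (proj_mat X j)"
  unfolding col_proj_def
proof (intro conjI ballI impI)
  note A = sub_cols_carrier[OF X j]
  have fin: "finite j" using j finite_subset by auto
  note pm = proj_mat_cols[OF j]
  show "proj_mat X j \<in> carrier_mat n n" "(proj_mat X j)\<^sup>T = proj_mat X j" using pm by auto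
  fix i assume i: "i \<in> j"
  define c where "c = card {a \<in> j. a < i}"
  have c: "c < card j" unfolding c_def using i fin by (intro psubset_card_mono) auto
  have pc: "pick j c = i" unfolding c_def by (rule pick_card_in_set[OF i])
  have "proj_mat X j *\<^sub>v Matrix.col (sub_cols X j) c = Matrix.col (proj_mat X j * sub_cols X j) c"
    using c A pm(2) by (intro eq_vecI) auto
  then show "proj_mat X j *\<^sub>v Matrix.col X i = Matrix.col X i"
    unfolding pm(1) sub_cols_col[OF X j c] pc .
next
  note A = sub_cols_carrier[OF X j]
  fix v :: "real vec" assume v: "v \<in> carrier_vec n" "\<forall>i\<in>j. Matrix.col X i \<bullet> v = 0"
  have "(sub_cols X j)\<^sup>T *\<^sub>v v = 0\<^sub>v (card j)"
    using A v sub_cols_col[OF X j] pick_in_set_le by (intro eq_vecI) auto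
  then show "proj_mat X j *\<^sub>v v = 0\<^sub>v n" by (rule proj_mat_cols(5)[OF j v(1)])
qed

text \<open>\<open>v - P' v\<close> is orthogonal to the columns in \<open>j\<close>, in particular
  to those in \<open>i\<close>, so \<open>P\<close> kills it. The case \<open>i = j\<close> yields
  idempotence and uniqueness.\<close>

lemma col_proj_absorb:
  assumes P: "col_proj n X i P" and P': "col_proj n X j P'" and ij: "i \<subseteq> j"
  shows "P * P' = P" "P' * P = P"
proof -
  have c: "P \<in> carrier_mat n n" "P' \<in> carrier_mat n n" "P\<^sup>T = P" "P'\<^sup>T = P'"
    using P P' unfolding col_proj_def by auto
  show 1: "P * P' = P"
  proof (rule mat_eq_by_vec[of _ n n])
    fix v :: "real vec" assume v: "v \<in> carrier_vec n"
    have P'v: "P' *\<^sub>v v \<in> carrier_vec n" using c v by auto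
    have "Matrix.col X l \<bullet> (v - P' *\<^sub>v v) = 0" if l: "l \<in> j" for l
    proof -
      have "Matrix.col X l \<bullet> (P' *\<^sub>v v) = (P' *\<^sub>v Matrix.col X l) \<bullet> v"
        using transpose_vec_mult_scalar[OF c(2) v col_carrier[of l]] c(4) by simp
      also have "\<dots> = Matrix.col X l \<bullet> v" using P' l unfolding col_proj_def by simp
      finally show ?thesis using v P'v col_carrier[of l] by (simp add: scalar_prod_minus_distrib[of _ n])
    qed
    then have "P *\<^sub>v (v - P' *\<^sub>v v) = 0\<^sub>v n"
      using P ij v P'v unfolding col_proj_def by (simp add: subset_iff)
    then have e: "P *\<^sub>v v - P *\<^sub>v (P' *\<^sub>v v) = 0\<^sub>v n"
      using mult_minus_distrib_mat_vec[OF c(1) v P'v] by simp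
    have "P *\<^sub>v v = P *\<^sub>v (P' *\<^sub>v v)"
    proof (rule eq_vecI)
      fix r assume "r < dim_vec (P *\<^sub>v (P' *\<^sub>v v))"
      then have r: "r < n" using c by simp
      have "(P *\<^sub>v v - P *\<^sub>v (P' *\<^sub>v v)) $ r = 0" unfolding e using r by simp
      then show "(P *\<^sub>v v) $ r = (P *\<^sub>v (P' *\<^sub>v v)) $ r" using r c by (simp del: index_mult_mat_vec)
    qed (use c in auto)
    then show "P * P' *\<^sub>v v = P *\<^sub>v v" using c v by (simp add: assoc_mult_mat_vec[of _ n n _ n])
  qed (use c in auto)
  show "P' * P = P"
    using transpose_mult[OF c(1,2)] 1 c(3,4) by simp
qed

lemma col_proj_orth_proj: "col_proj n X j P \<Longrightarrow> orth_proj n P"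
  using col_proj_absorb(1)[of j P j P] unfolding orth_proj_def col_proj_def by auto

lemma col_proj_unique: "col_proj n X j P \<Longrightarrow> col_proj n X j P' \<Longrightarrow> P = P'"
  using col_proj_absorb[of j P j P'] col_proj_absorb[of j P' j P] by auto

section \<open>Residual projections and degrees of freedom\<close>

definition res_proj :: "nat set \<Rightarrow> real mat" where
  "res_proj j = 1\<^sub>m n - proj_mat X j"

lemma orth_proj_res_proj:
  assumes j: "j \<subseteq> {..<k}"
  shows "orth_proj n (res_proj j)"
  unfolding res_proj_def using proj_mat_cols(2)[OF j]
  by (intro orth_proj_diff orth_proj_one col_proj_orth_proj[OF col_proj_proj_mat[OF j]]) simp

text \<open>A Gram-Schmidt step: \<open>u\<close> is the normalised residual of the new column, and
  the old projection plus the outer product of \<open>u\<close> satisfies the characterisation for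
  \<open>insert i j\<close>.\<close>

lemma res_proj_insert:
  assumes i: "i < k" "i \<notin> j" and j: "j \<subseteq> {..<k}"
  shows "\<exists>u\<in>carrier_vec n. u \<bullet> u = 1 \<and> res_proj j *\<^sub>v u = u \<and> res_proj (insert i j) = res_proj j - outer u"
proof -
  let ?P = "proj_mat X j"
  note pm = proj_mat_cols[OF j] and cp = col_proj_proj_mat[OF j]
  have ij: "insert i j \<subseteq> {..<k}" using i j by auto
  define c where "c = Matrix.col X i"
  have c: "c \<in> carrier_vec n" unfolding c_def by (rule col_carrier)
  define w where "w = c - ?P *\<^sub>v c"
  have Pc: "?P *\<^sub>v c \<in> carrier_vec n" using pm c by auto
  have w: "w \<in> carrier_vec n" unfolding w_def using c Pc by auto
  have op: "orth_proj n ?P" by (rule col_proj_orth_proj[OF cp])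
  have "w \<noteq> 0\<^sub>v n"
  proof
    \<comment> \<open>A vanishing residual would express column \<open>i\<close> through the columns
      in \<open>j\<close>. The vector \<open>e_i - y'\<close> would then be in the kernel of
      \<open>X\<close>, although its entry at \<open>i \<notin> j\<close> is 1.\<close>
    assume w0: "w = 0\<^sub>v n"
    obtain y where y: "y \<in> carrier_vec (card j)" "?P *\<^sub>v c = sub_cols X j *\<^sub>v y" using pm(4)[OF c] by auto
    define y' where "y' = Matrix.vec k (\<lambda>l. if l \<in> j then y $ card {a \<in> j. a < l} else 0)"
    have y': "y' \<in> carrier_vec k" unfolding y'_def by simp
    have "?P *\<^sub>v c = X *\<^sub>v y'" unfolding y(2) y'_def by (rule sub_cols_mult_vec[OF X j y(1)])
    moreover have "c = X *\<^sub>v unit_vec k i" unfolding c_def using X i by (intro eq_vecI) auto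
    ultimately have "X *\<^sub>v (unit_vec k i - y') = w"
      unfolding w_def using mult_minus_distrib_mat_vec[OF X _ y', of "unit_vec k i"] by simp
    then have "unit_vec k i - y' = 0\<^sub>v k"
      using w0 y' by (intro mat_rank_full_kernel[OF X rank]) auto
    then have "(unit_vec k i - y') $ i = (0\<^sub>v k :: real vec) $ i" by simp
    then show False using i y' unfolding y'_def by simp
  qed
  then have pos: "w \<bullet> w > 0" by (rule scalar_prod_self_pos[OF w])
  define s where "s = 1 / sqrt (w \<bullet> w)"
  define u where "u = s \<cdot>\<^sub>v w"
  have u: "u \<in> carrier_vec n" "u \<bullet> u = 1"
    unfolding u_def s_def using w normalize_vec[OF w pos] by auto
  have Pw: "?P *\<^sub>v w = 0\<^sub>v n"
    unfolding w_def using mult_minus_distrib_mat_vec[OF pm(2) c Pc] orth_proj_idem[OF op c] Pc by simp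
  have Pu: "?P *\<^sub>v u = 0\<^sub>v n" unfolding u_def using mult_mat_vec[OF pm(2) w] Pw by auto
  have wl: "w \<bullet> Matrix.col X l = 0" if "l \<in> j" for l
  proof -
    have "w \<bullet> Matrix.col X l = w \<bullet> (?P *\<^sub>v Matrix.col X l)" using cp that unfolding col_proj_def by simp
    also have "\<dots> = (?P *\<^sub>v w) \<bullet> Matrix.col X l"
      using transpose_vec_mult_scalar[OF pm(2) col_carrier w] pm(3) by simp
    finally show ?thesis unfolding Pw using col_carrier by simp
  qed
  have wc: "w \<bullet> c = w \<bullet> w"
  proof -
    have "w \<bullet> (?P *\<^sub>v c) = (?P *\<^sub>v w) \<bullet> c" using transpose_vec_mult_scalar[OF pm(2) c w] pm(3) by simp
    then have "w \<bullet> (?P *\<^sub>v c) = 0" unfolding Pw using c by simp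
    then show ?thesis using scalar_prod_minus_distrib[OF w c Pc] unfolding w_def[symmetric] by simp
  qed
  have "col_proj n X (insert i j) (?P + outer u)"
    unfolding col_proj_def
  proof (intro conjI ballI impI)
    show "?P + outer u \<in> carrier_mat n n" using pm u by auto
    show "(?P + outer u)\<^sup>T = ?P + outer u" using pm u by (simp add: transpose_add[of _ n n])
    have ap: "(?P + outer u) *\<^sub>v x = ?P *\<^sub>v x + (u \<bullet> x) \<cdot>\<^sub>v u" if "x \<in> carrier_vec n" for x
      using that pm u by (simp add: add_mult_distrib_mat_vec[of _ n n] outer_mult_vec)
    fix l assume l: "l \<in> insert i j"
    show "(?P + outer u) *\<^sub>v Matrix.col X l = Matrix.col X l"
    proof (cases "l = i")
      case True
      have "(u \<bullet> c) \<cdot>\<^sub>v u = w"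
      proof -
        have "u \<bullet> c = s * (w \<bullet> w)" unfolding u_def using w c wc by simp
        moreover have "s * (w \<bullet> w) * s = 1" unfolding s_def using pos by simp
        ultimately show ?thesis unfolding u_def by (simp add: smult_smult_assoc)
      qed
      moreover have "a + (b - a) = b" if "a \<in> carrier_vec n" "b \<in> carrier_vec n" for a b :: "real vec"
        using that by (intro eq_vecI) auto
      ultimately show ?thesis unfolding True c_def[symmetric] ap[OF c] w_def using c Pc by simp
    next
      case False
      then have l: "l \<in> j" using l by simp
      have "u \<bullet> Matrix.col X l = 0" unfolding u_def using wl[OF l] w col_carrier[of l] by simp
      moreover have "?P *\<^sub>v Matrix.col X l = Matrix.col X l" using cp l unfolding col_proj_def by simp
      moreover have "a + 0 \<cdot>\<^sub>v u = a" if "a \<in> carrier_vec n" for a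
        using that u(1) by (intro eq_vecI) auto
      ultimately show ?thesis unfolding ap[OF col_carrier] using col_carrier[of l] by simp
    qed
  next
    fix v :: "real vec" assume v: "v \<in> carrier_vec n" "\<forall>l\<in>insert i j. Matrix.col X l \<bullet> v = 0"
    have Pv: "?P *\<^sub>v v = 0\<^sub>v n" using cp v unfolding col_proj_def by simp
    have "w \<bullet> v = 0"
    proof -
      have "(?P *\<^sub>v c) \<bullet> v = c \<bullet> (?P *\<^sub>v v)" using transpose_vec_mult_scalar[OF pm(2) v(1) c] pm(3) by simp
      then show ?thesis unfolding w_def using minus_scalar_prod_distrib[OF c Pc v(1)] v c Pv unfolding c_def by simp
    qed
    then have "u \<bullet> v = 0" unfolding u_def using w v by simp
    then show "(?P + outer u) *\<^sub>v v = 0\<^sub>v n"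
      using v(1) pm u Pv by (simp add: add_mult_distrib_mat_vec[of _ n n] outer_mult_vec) (auto intro!: eq_vecI)
  qed
  then have eq: "proj_mat X (insert i j) = ?P + outer u"
    using col_proj_unique[OF col_proj_proj_mat[OF ij]] by simp
  have "res_proj (insert i j) = res_proj j - outer u"
    unfolding res_proj_def eq using pm(2) outer_carrier[OF u(1)] by (intro eq_matI) auto
  moreover have "res_proj j *\<^sub>v u = u"
    unfolding res_proj_def using pm(2) u Pu
    by (simp add: minus_mult_distrib_mat_vec[of _ n n])
  ultimately show ?thesis using u by blast
qed

lemma tr_res_proj:
  assumes "j \<subseteq> {..<k}"
  shows "tr (res_proj j) = real n - real (card j)"
proof -
  have "finite j" using assms finite_subset by auto
  then show ?thesis using assms
  proof (induction j rule: finite_induct)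
    case empty
    \<comment> \<open>Without columns the formula for the projection runs over matrices with a
      dimension 0; the characterisation says that it kills every vector.\<close>
    have "proj_mat X {} = 0\<^sub>m n n"
    proof (rule mat_eq_by_vec[of _ n n])
      fix v :: "real vec" assume v: "v \<in> carrier_vec n"
      have "proj_mat X {} *\<^sub>v v = 0\<^sub>v n" using col_proj_proj_mat[of "{}"] v unfolding col_proj_def by simp
      then show "proj_mat X {} *\<^sub>v v = 0\<^sub>m n n *\<^sub>v v" using v by (auto intro!: eq_vecI)
    qed (use proj_mat_cols(2)[of "{}"] in auto)
    then have "res_proj {} = 1\<^sub>m n" unfolding res_proj_def by auto
    then show ?case by (simp add: tr_one)
  next
    case (insert i j)
    obtain u where u: "u \<in> carrier_vec n" "u \<bullet> u = 1" "res_proj j *\<^sub>v u = u"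
      "res_proj (insert i j) = res_proj j - outer u"
      using res_proj_insert[of i j] insert by auto
    show ?case
      unfolding u(4) using orth_proj_minus_outer(2)[OF orth_proj_res_proj u(1-3)] insert by simp
  qed
qed

lemma res_proj_kills:
  assumes "i \<subseteq> j" "j \<subseteq> {..<k}"
  shows "res_proj j * sub_cols X i = 0\<^sub>m n (card i)"
proof -
  have i: "i \<subseteq> {..<k}" using assms by auto
  note A = sub_cols_carrier[OF X i] and pj = proj_mat_cols(2)[OF assms(2)] and pi = proj_mat_cols[OF i]
  have "proj_mat X j * sub_cols X i = proj_mat X j * (proj_mat X i * sub_cols X i)" using pi(1) by simp
  also have "\<dots> = proj_mat X j * proj_mat X i * sub_cols X i"
    using pj pi(2) A by (simp add: assoc_mult_mat[of _ n n _ n _ "card i"])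
  also have "proj_mat X j * proj_mat X i = proj_mat X i"
    using col_proj_absorb(2)[OF col_proj_proj_mat[OF i] col_proj_proj_mat[OF assms(2)] assms(1)] .
  finally have "proj_mat X j * sub_cols X i = sub_cols X i" using pi(1) by simp
  then show ?thesis
    unfolding res_proj_def using pj A by (simp add: minus_mult_distrib_mat[of _ n n _ _ "card i"])
qed

text \<open>The difference projects onto the part of the span of \<open>j\<close> that is orthogonal
  to the span of \<open>i\<close>. Its trace counts the added columns and so stays bounded as
  \<open>n\<close> grows.\<close>

lemma res_proj_diff:
  assumes "i \<subseteq> j" "j \<subseteq> {..<k}"
  shows "orth_proj n (res_proj i - res_proj j)" "tr (res_proj i - res_proj j) = real (card j) - real (card i)"
proof -
  have i: "i \<subseteq> {..<k}" using assms by auto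
  note pj = proj_mat_cols(2)[OF assms(2)] and pi = proj_mat_cols(2)[OF i]
  have eq: "res_proj i - res_proj j = proj_mat X j - proj_mat X i"
    unfolding res_proj_def using pi pj by (intro eq_matI) auto
  have "proj_mat X j * proj_mat X i = proj_mat X i"
    using col_proj_absorb(2)[OF col_proj_proj_mat[OF i] col_proj_proj_mat[OF assms(2)] assms(1)] .
  then show "orth_proj n (res_proj i - res_proj j)"
    unfolding eq by (intro orth_proj_diff col_proj_orth_proj[OF col_proj_proj_mat] assms i)
  show "tr (res_proj i - res_proj j) = real (card j) - real (card i)"
    using tr_minus[OF orth_projD(1) orth_projD(1), OF orth_proj_res_proj orth_proj_res_proj, OF i assms(2)]
      tr_res_proj[OF i] tr_res_proj[OF assms(2)] by simp
qed

end

section \<open>The noise of a matrix normal distribution\<close>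

text \<open>Compared on boxes, where the integral of a product of functions of single coordinates
  factorises. The family \<open>P\<close> is a separate parameter because the measures must be
  sigma-finite at every index, also outside \<open>I\<close>.\<close>

lemma PiM_density:
  assumes I: "finite I" and sf: "\<And>i. sigma_finite_measure (N i)"
    and f: "\<And>i. i \<in> I \<Longrightarrow> f i \<in> borel_measurable (N i)"
    and P: "\<And>i. sigma_finite_measure (P i)" and eq: "\<And>i. i \<in> I \<Longrightarrow> P i = density (N i) (f i)"
  shows "PiM I P = density (PiM I N) (\<lambda>x. \<Prod>i\<in>I. f i (x i))"
proof -
  interpret N: product_sigma_finite N unfolding product_sigma_finite_def using sf by auto
  interpret P: product_sigma_finite P unfolding product_sigma_finite_def using P by auto
  have meas: "(\<lambda>x. \<Prod>i\<in>I. f i (x i)) \<in> borel_measurable (PiM I N)"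
  proof (rule borel_measurable_prod_ennreal)
    fix i assume i: "i \<in> I"
    show "(\<lambda>x. f i (x i)) \<in> borel_measurable (PiM I N)"
      by (rule measurable_compose[where f = "\<lambda>x. x i" and g = "f i", OF measurable_component_singleton[OF i, of N] f[OF i]])
  qed
  have "density (PiM I N) (\<lambda>x. \<Prod>i\<in>I. f i (x i)) = PiM I P"
  proof (rule P.PiM_eqI[OF I])
    show "sets (density (PiM I N) (\<lambda>x. \<Prod>i\<in>I. f i (x i))) = sets (PiM I P)"
      by (simp, intro sets_PiM_cong) (simp_all add: eq)
    fix A assume A: "\<And>i. i \<in> I \<Longrightarrow> A i \<in> sets (P i)"
    then have A': "\<And>i. i \<in> I \<Longrightarrow> A i \<in> sets (N i)" by (simp add: eq)
    have "emeasure (density (PiM I N) (\<lambda>x. \<Prod>i\<in>I. f i (x i))) (Pi\<^sub>E I A)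
        = (\<integral>\<^sup>+ x. (\<Prod>i\<in>I. f i (x i)) * indicator (Pi\<^sub>E I A) x \<partial>PiM I N)"
      using meas A' I by (subst emeasure_density) (auto intro!: sets_PiM_I_finite)
    also have "\<dots> = (\<integral>\<^sup>+ x. (\<Prod>i\<in>I. f i (x i) * indicator (A i) (x i)) \<partial>PiM I N)"
    proof (rule nn_integral_cong)
      fix x assume x: "x \<in> space (PiM I N)"
      have "(indicator (Pi\<^sub>E I A) x :: ennreal) = (\<Prod>i\<in>I. indicator (A i) (x i))"
      proof (cases "x \<in> Pi\<^sub>E I A")
        case False
        then obtain i where "i \<in> I" "x i \<notin> A i" using x by (auto simp: space_PiM PiE_def Pi_def)
        then show ?thesis using False I by (auto simp: indicator_def)
      qed (auto simp: indicator_def PiE_def Pi_def)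
      then show "(\<Prod>i\<in>I. f i (x i)) * indicator (Pi\<^sub>E I A) x = (\<Prod>i\<in>I. f i (x i) * indicator (A i) (x i))"
        by (simp add: prod.distrib)
    qed
    also have "\<dots> = (\<Prod>i\<in>I. \<integral>\<^sup>+ x. f i x * indicator (A i) x \<partial>N i)"
      using I f A' by (intro N.product_nn_integral_prod) auto
    also have "\<dots> = (\<Prod>i\<in>I. emeasure (P i) (A i))"
      using f A' by (intro prod.cong HOL.refl) (simp add: eq emeasure_density)
    finally show "emeasure (density (PiM I N) (\<lambda>x. \<Prod>i\<in>I. f i (x i))) (Pi\<^sub>E I A)
      = (\<Prod>i\<in>I. emeasure (P i) (A i))" .
  qed
  then show ?thesis ..
qed

definition centred_rows :: "nat \<Rightarrow> nat \<Rightarrow> ('a \<Rightarrow> real mat) \<Rightarrow> real mat \<Rightarrow> 'a \<Rightarrow> nat \<Rightarrow> nat \<Rightarrow> real" where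
  "centred_rows n p Y B x = (\<lambda>i\<in>{..<n}. \<lambda>a\<in>{..<p}. Y x $$ (i, a) - B $$ (i, a))"

lemma noise_mat_centred_rows:
  assumes "Y x \<in> carrier_mat n p" "B \<in> carrier_mat n p"
  shows "noise_mat n p (centred_rows n p Y B x) = Y x - B"
  using assms by (intro eq_matI) (auto simp: centred_rows_def)

text \<open>Independence makes the joint law of the rows a product, and thus gives it the product of
  the row densities. Translation by the mean centres the rows, and the product of the exponentials
  becomes a single exponential of \<open>noise_qf\<close>.\<close>

lemma matrix_normal_gaussian_noise:
  assumes M: "prob_space M" and n: "n > 0" and S: "pos_def p S" and B: "B \<in> carrier_mat n p"
    and Y: "matrix_normal M n p Y B S"
  shows "gaussian_noise M n p S (centred_rows n p Y B) ((1 / sqrt ((2 * pi) ^ p * det S)) ^ n)"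
proof -
  interpret prob_space M by (rule M)
  define row where "row i x = (\<lambda>a\<in>{..<p}. Y x $$ (i, a))" for i x
  define L where "L = PiM {..<p} (\<lambda>_. lborel :: real measure)"
  define f where "f i y = ennreal (mvn_density p (Matrix.row B i) S y)" for i y
  have indep: "indep_vars (\<lambda>_. PiM {..<p} (\<lambda>_. borel)) row {..<n}"
    and dist: "\<And>i. i < n \<Longrightarrow> distributed M L (row i) (f i)"
    using Y unfolding matrix_normal_def row_def L_def f_def by auto
  \<comment> \<open>Independence refers to the Borel product and the densities to the Lebesgue
    product; equality of the sigma-algebras connects the two.\<close>
  have setsL: "sets L = sets (PiM {..<p} (\<lambda>_. borel))"
    unfolding L_def by (intro sets_PiM_cong) auto
  have rv: "row i \<in> measurable M (PiM {..<p} (\<lambda>_. borel))" if "i < n" for i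
    using distributed_measurable[OF dist[OF that]] setsL by (simp cong: measurable_cong_sets)
  have rvL: "row i \<in> measurable M L" if "i < n" for i
    using distributed_measurable[OF dist[OF that]] .
  define R where "R x = (\<lambda>i\<in>{..<n}. row i x)" for x
  \<comment> \<open>A point mass fills the indices from \<open>n\<close> on, so that every member of
    the family is a probability measure.\<close>
  define P where "P i = (if i < n then distr M L (row i) else return L (\<lambda>_\<in>{..<p}. 0))" for i
  have Pprob: "prob_space (P i)" for i
    unfolding P_def using rvL by (auto intro!: prob_space_distr prob_space_return simp: L_def space_PiM)
  have setsLam: "sets (lborel_mat n p) = sets (PiM {..<n} (\<lambda>_. PiM {..<p} (\<lambda>_. borel)))"
    by (intro sets_PiM_cong HOL.refl) (use setsL in \<open>simp add: L_def\<close>)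
  have R_meas: "R \<in> measurable M (lborel_mat n p)"
    unfolding R_def using rvL by (intro measurable_restrict) (auto simp: L_def)
  have "distr M (lborel_mat n p) R = distr M (PiM {..<n} (\<lambda>_. PiM {..<p} (\<lambda>_. borel))) (\<lambda>x. \<lambda>i\<in>{..<n}. row i x)"
    unfolding R_def by (intro distr_cong setsLam) auto
  also have "\<dots> = PiM {..<n} (\<lambda>i. distr M (PiM {..<p} (\<lambda>_. borel)) (row i))"
    using indep_vars_iff_distr_eq_PiM'[of "{..<n}" row "\<lambda>_. PiM {..<p} (\<lambda>_. borel)"] indep rv n by auto
  also have "\<dots> = PiM {..<n} P"
    unfolding P_def by (intro PiM_cong HOL.refl) (auto intro!: distr_cong simp: setsL)
  also have "\<dots> = density (lborel_mat n p) (\<lambda>y. \<Prod>i<n. f i (y i))"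
  proof (rule PiM_density)
    show "sigma_finite_measure (PiM {..<p} (\<lambda>_. lborel :: real measure))" by (rule sigma_finite_PiM_lborel)
    show "f i \<in> borel_measurable (PiM {..<p} (\<lambda>_. lborel))" if "i \<in> {..<n}" for i
      using distributed_borel_measurable[OF dist] that unfolding L_def by auto
    show "sigma_finite_measure (P i)" for i
      using Pprob[of i] by (simp add: prob_space_imp_sigma_finite)
    show "P i = density (PiM {..<p} (\<lambda>_. lborel)) (f i)" if "i \<in> {..<n}" for i
      using distributed_distr_eq_density[OF dist] that unfolding P_def L_def by auto
  qed simp
  finally have law: "distr M (lborel_mat n p) R = density (lborel_mat n p) (\<lambda>y. \<Prod>i<n. f i (y i))" .
  let ?E = "centred_rows n p Y B"
  let ?c = "(1 / sqrt ((2 * pi) ^ p * det S)) ^ n"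
  let ?dens = "\<lambda>z. ennreal (?c * exp (- noise_qf (inv_mat S) n p z / 2))"
  let ?mB = "\<lambda>i a. - B $$ (i, a)" and ?pB = "\<lambda>i a. B $$ (i, a)"
  have E: "?E = (\<lambda>x. translate n p ?mB (R x))"
    unfolding centred_rows_def translate_def R_def row_def by (intro ext) (auto simp: restrict_def)
  have E_meas: "?E \<in> measurable M (lborel_mat n p)"
    unfolding E by (intro translate_measurable R_meas) auto
  have det_pos: "det S > 0" by (rule pos_def_det[OF S])
  have prod_f: "(\<Prod>i<n. f i (translate n p ?pB z i)) = ?dens z" for z
  proof -
    have K: "inv_mat S \<in> carrier_mat p p"
      using inv_mat(1)[of S p] S det_pos unfolding pos_def_def by simp
    have d: "Matrix.vec p (translate n p ?pB z i) - Matrix.row B i = Matrix.vec p (z i)" if "i < n" for i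
      using that B by (intro eq_vecI) (auto simp: translate_apply)
    have q: "Matrix.vec p (z i) \<bullet> (inv_mat S *\<^sub>v Matrix.vec p (z i)) = (\<Sum>a<p. \<Sum>b<p. inv_mat S $$ (a, b) * (z i a * z i b))" for i
      using K by (auto simp: scalar_prod_def lessThan_atLeast0 sum_distrib_left mult_ac intro!: sum.cong)
    have "(\<Prod>i<n. f i (translate n p ?pB z i)) = (\<Prod>i<n. ennreal (exp (- (\<Sum>a<p. \<Sum>b<p. inv_mat S $$ (a, b) * (z i a * z i b)) / 2)
        * (1 / sqrt ((2 * pi) ^ p * det S))))"
      unfolding f_def mvn_density_def Let_def by (intro prod.cong HOL.refl) (simp add: d q)
    also have "\<dots> = ennreal (\<Prod>i<n. exp (- (\<Sum>a<p. \<Sum>b<p. inv_mat S $$ (a, b) * (z i a * z i b)) / 2)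
        * (1 / sqrt ((2 * pi) ^ p * det S)))"
      using det_pos by (intro prod_ennreal) simp
    also have "(\<Prod>i<n. exp (- (\<Sum>a<p. \<Sum>b<p. inv_mat S $$ (a, b) * (z i a * z i b)) / 2)
        * (1 / sqrt ((2 * pi) ^ p * det S))) = exp (\<Sum>i<n. - (\<Sum>a<p. \<Sum>b<p. inv_mat S $$ (a, b) * (z i a * z i b)) / 2) * ?c"
      by (simp only: prod.distrib exp_sum[OF finite_lessThan] prod_constant card_lessThan)
    also have "(\<Sum>i<n. - (\<Sum>a<p. \<Sum>b<p. inv_mat S $$ (a, b) * (z i a * z i b)) / 2) = - noise_qf (inv_mat S) n p z / 2"
    proof -
      have "(\<Sum>i<n. \<Sum>a<p. \<Sum>b<p. inv_mat S $$ (a, b) * (z i a * z i b)) = noise_qf (inv_mat S) n p z"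
      proof -
        have "(\<Sum>i<n. \<Sum>a<p. \<Sum>b<p. inv_mat S $$ (a, b) * (z i a * z i b)) =
            (\<Sum>a<p. \<Sum>i<n. \<Sum>b<p. inv_mat S $$ (a, b) * (z i a * z i b))"
          by (rule sum.swap)
        also have "\<dots> = (\<Sum>a<p. \<Sum>b<p. \<Sum>i<n. inv_mat S $$ (a, b) * (z i a * z i b))"
          by (intro sum.cong HOL.refl sum.swap)
        finally show ?thesis unfolding noise_qf_def sum_distrib_left .
      qed
      then show ?thesis by (simp add: sum_divide_distrib[symmetric] sum_negf)
    qed
    finally show ?thesis by (simp add: mult.commute)
  qed
  have F_meas: "(\<lambda>y. \<Prod>i<n. f i (y i)) \<in> borel_measurable (lborel_mat n p)"
  proof (rule borel_measurable_prod_ennreal)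
    fix i assume i: "i \<in> {..<n}"
    have fi: "f i \<in> borel_measurable (PiM {..<p} (\<lambda>_. lborel))"
      using distributed_borel_measurable[OF dist] i unfolding L_def by auto
    show "(\<lambda>y. f i (y i)) \<in> borel_measurable (lborel_mat n p)"
      by (rule measurable_compose[where f = "\<lambda>x. x i" and g = "f i", OF measurable_component_singleton[OF i] fi])
  qed
  have "distr M (lborel_mat n p) ?E = density (lborel_mat n p) ?dens"
  proof (rule measure_eqI)
    fix A assume "A \<in> sets (distr M (lborel_mat n p) ?E)"
    then have A[measurable]: "A \<in> sets (lborel_mat n p)" by simp
    have sm: "translate n p ?mB \<in> measurable (lborel_mat n p) (lborel_mat n p)" by (intro translate_measurable) auto
    have h: "(\<lambda>y. (\<Prod>i<n. f i (y i)) * indicator A (translate n p ?mB y)) \<in> borel_measurable (lborel_mat n p)"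
      using F_meas measurable_compose[OF sm borel_measurable_indicator[OF A]] by simp
    have "distr M (lborel_mat n p) ?E = distr (distr M (lborel_mat n p) R) (lborel_mat n p) (translate n p ?mB)"
      unfolding E using R_meas sm by (subst distr_distr) (auto simp: comp_def)
    then have "emeasure (distr M (lborel_mat n p) ?E) A = emeasure (density (lborel_mat n p) (\<lambda>y. \<Prod>i<n. f i (y i))) (translate n p ?mB -` A \<inter> space (lborel_mat n p))"
      unfolding law using sm A by (simp add: emeasure_distr)
    also have "\<dots> = (\<integral>\<^sup>+ y. (\<Prod>i<n. f i (y i)) * indicator (translate n p ?mB -` A \<inter> space (lborel_mat n p)) y \<partial>lborel_mat n p)"
      using F_meas measurable_sets[OF sm A] by (subst emeasure_density) auto
    also have "\<dots> = (\<integral>\<^sup>+ y. (\<Prod>i<n. f i (y i)) * indicator A (translate n p ?mB y) \<partial>lborel_mat n p)"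
      by (intro nn_integral_cong) (auto simp: indicator_def)
    also have "\<dots> = (\<integral>\<^sup>+ z. (\<Prod>i<n. f i (translate n p ?pB z i)) * indicator A (translate n p ?mB (translate n p ?pB z)) \<partial>lborel_mat n p)"
      by (rule nn_integral_lborel_mat_translate[OF h, symmetric])
    also have "\<dots> = (\<integral>\<^sup>+ z. ?dens z * indicator A z \<partial>lborel_mat n p)"
    proof (rule nn_integral_cong)
      fix z assume z: "z \<in> space (lborel_mat n p)"
      have "translate n p ?mB (translate n p ?pB z) = z"
        using z by (intro lborel_mat_eqI[of _ n p]) (simp_all add: translate_apply)
      then show "(\<Prod>i<n. f i (translate n p ?pB z i)) * indicator A (translate n p ?mB (translate n p ?pB z)) = ?dens z * indicator A z"
        unfolding prod_f by simp
    qed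
    also have "\<dots> = emeasure (density (lborel_mat n p) ?dens) A"
      by (subst emeasure_density) auto
    finally show "emeasure (distr M (lborel_mat n p) ?E) A = emeasure (density (lborel_mat n p) ?dens) A" .
  qed simp
  then show ?thesis
    using S E_meas det_pos by unfold_locales auto
qed

section \<open>Determinant ratios of underspecified models\<close>

lemma pos_defD:
  assumes "pos_def n A"
  shows "A \<in> carrier_mat n n" "A\<^sup>T = A" "\<And>v. v \<in> carrier_vec n \<Longrightarrow> v \<noteq> 0\<^sub>v n \<Longrightarrow> v \<bullet> (A *\<^sub>v v) > 0"
    "\<And>v. v \<in> carrier_vec n \<Longrightarrow> v \<bullet> (A *\<^sub>v v) \<ge> 0" "det A \<noteq> 0"
  using assms pos_def_psd[OF assms] pos_def_det[OF assms] unfolding pos_def_def psd_def by auto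

lemma inv_mat_cancel:
  assumes "A \<in> carrier_mat n n" "det A \<noteq> 0" "v \<in> carrier_vec n"
  shows "A *\<^sub>v (inv_mat A *\<^sub>v v) = v" "inv_mat A *\<^sub>v v \<in> carrier_vec n"
  using mult_vec_cancel_left[OF assms(1) inv_mat(1,2)[OF assms(1,2)] assms(3)] inv_mat(1)[OF assms(1,2)] assms(3)
  by auto

lemma gram_form:
  assumes "H \<in> carrier_mat n g" "R \<in> carrier_mat n n" "x \<in> carrier_vec g"
  shows "x \<bullet> (H\<^sup>T * R * H *\<^sub>v x) = (H *\<^sub>v x) \<bullet> (R *\<^sub>v (H *\<^sub>v (x :: real vec)))"
proof -
  have "H\<^sup>T * R * H *\<^sub>v x = H\<^sup>T *\<^sub>v (R *\<^sub>v (H *\<^sub>v x))"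
    using assoc_mult_mat_vec[of "H\<^sup>T * R" g n H g x] assoc_mult_mat_vec[of "H\<^sup>T" g n R n "H *\<^sub>v x"] assms
    by (simp del: assoc_mult_mat)
  then show ?thesis
    using transpose_vec_mult_scalar[of "H\<^sup>T" g n "R *\<^sub>v (H *\<^sub>v x)" x] assms by simp
qed

text \<open>The largest eigenvalue is at most the trace; here through Cauchy-Schwarz for each row of
  \<open>R H\<close>.\<close>

lemma gram_form_le_tr:
  assumes H: "H \<in> carrier_mat n g" and R: "orth_proj n R" and x: "x \<in> carrier_vec g"
  shows "(H *\<^sub>v x) \<bullet> (R *\<^sub>v (H *\<^sub>v x)) \<le> tr (H\<^sup>T * R * H) * (x \<bullet> x)"
proof -
  note R' = orth_projD[OF R]
  define G where "G = R * H"
  have G: "G \<in> carrier_mat n g" unfolding G_def using R' H by auto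
  have Hx: "H *\<^sub>v x \<in> carrier_vec n" using H x by auto
  have Gx: "R *\<^sub>v (H *\<^sub>v x) = G *\<^sub>v x" unfolding G_def using R' H x by (simp add: assoc_mult_mat_vec[of _ n n _ g])
  have "(H *\<^sub>v x) \<bullet> (R *\<^sub>v (H *\<^sub>v x)) = (G *\<^sub>v x) \<bullet> (G *\<^sub>v x)"
    using orth_proj_form[OF R Hx Hx] unfolding Gx .
  also have "\<dots> = (\<Sum>i<n. (Matrix.row G i \<bullet> x)\<^sup>2)"
    using G by (simp add: scalar_prod_def[of "G *\<^sub>v x" "G *\<^sub>v x"] lessThan_atLeast0 power2_eq_square)
  also have "\<dots> \<le> (\<Sum>i<n. (x \<bullet> x) * (Matrix.row G i \<bullet> Matrix.row G i))"
    using G x by (intro sum_mono cauchy_schwarz_vec[of _ g]) auto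
  also have "\<dots> = (x \<bullet> x) * tr (G * G\<^sup>T)"
    unfolding tr_def sum_distrib_left[symmetric] using G by simp
  also have "tr (G * G\<^sup>T) = tr (G\<^sup>T * G)" using G by (intro tr_mult_commute[of _ n g]) auto
  also have "G\<^sup>T * G = H\<^sup>T * R * H"
  proof -
    have "G\<^sup>T = H\<^sup>T * R" unfolding G_def using transpose_mult[OF R'(1) H] R'(2) by simp
    then have "G\<^sup>T * G = H\<^sup>T * (R * (R * H))"
      unfolding G_def using R' H by (simp add: assoc_mult_mat[of _ g n _ n _ g])
    also have "R * (R * H) = R * H" using assoc_mult_mat[OF R'(1) R'(1) H] R'(3) by simp
    finally show ?thesis using R' H by (simp add: assoc_mult_mat[of _ g n _ n _ g])
  qed
  finally show ?thesis by (simp add: mult.commute)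
qed

text \<open>The form of \<open>W\<close> is nonnegative at \<open>z - A w\<close>, where
  \<open>z = W^(-1) v\<close> and \<open>w\<close> solves the compressed system with right-hand side
  \<open>A^T v\<close>. Expanding it gives the inequality between
  \<open>A (A^T W A)^(-1) A^T\<close> and \<open>W^(-1)\<close> as forms.\<close>

lemma pos_def_congruence_cauchy_schwarz:
  assumes W: "pos_def p W" and A: "A \<in> carrier_mat p g" and d: "det (A\<^sup>T * W * A) \<noteq> 0" and v: "v \<in> carrier_vec p"
  shows "(A\<^sup>T *\<^sub>v v) \<bullet> (inv_mat (A\<^sup>T * W * A) *\<^sub>v (A\<^sup>T *\<^sub>v v)) \<le> v \<bullet> (inv_mat W *\<^sub>v v)"
proof -
  note W' = pos_defD[OF W]
  define N where "N = A\<^sup>T * W * A"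
  have N: "N \<in> carrier_mat g g" unfolding N_def using A W' by auto
  have d: "det N \<noteq> 0" using d unfolding N_def .
  define a where "a = A\<^sup>T *\<^sub>v v"
  have a: "a \<in> carrier_vec g" unfolding a_def using A v by auto
  define w where "w = inv_mat N *\<^sub>v a"
  note w = inv_mat_cancel[OF N d a, folded w_def]
  define z where "z = inv_mat W *\<^sub>v v"
  note z = inv_mat_cancel[OF W'(1,5) v, folded z_def]
  have Aw: "A *\<^sub>v w \<in> carrier_vec p" using A w by auto
  have y: "z + (-1) \<cdot>\<^sub>v (A *\<^sub>v w) \<in> carrier_vec p" using z Aw by auto
  have 1: "(A *\<^sub>v w) \<bullet> v = w \<bullet> a"
    unfolding a_def using transpose_vec_mult_scalar[of "A\<^sup>T" g p v w] A w v by simp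
  have 2: "(A *\<^sub>v w) \<bullet> (W *\<^sub>v (A *\<^sub>v w)) = w \<bullet> a"
    using gram_form[OF A W'(1) w(2)] unfolding N_def[symmetric] w(1) by simp
  have "0 \<le> z \<bullet> (W *\<^sub>v z) + 2 * (-1) * ((A *\<^sub>v w) \<bullet> (W *\<^sub>v z)) + (-1)\<^sup>2 * ((A *\<^sub>v w) \<bullet> (W *\<^sub>v (A *\<^sub>v w)))"
    using W'(4)[OF y] unfolding quadratic_form_add_smult[OF W'(1,2) z(2) Aw] .
  then have "w \<bullet> a \<le> z \<bullet> v" unfolding z(1) 1 2 by simp
  then show ?thesis
    unfolding N_def[symmetric] a_def[symmetric] w_def[symmetric] z_def[symmetric]
    using comm_scalar_prod[OF a w(2)] comm_scalar_prod[OF v z(2)] by simp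
qed

lemma det_one_plus_form:
  fixes x :: "real vec"
  assumes C: "C \<in> carrier_mat n g" and I: "I \<in> carrier_mat g g" and x: "x \<in> carrier_vec n"
  shows "x \<bullet> ((1\<^sub>m n + C * (I * C\<^sup>T)) *\<^sub>v x) = x \<bullet> x + (C\<^sup>T *\<^sub>v x) \<bullet> (I *\<^sub>v (C\<^sup>T *\<^sub>v x))"
proof -
  have c: "C * (I * C\<^sup>T) \<in> carrier_mat n n" using C I by auto
  have "C * (I * C\<^sup>T) *\<^sub>v x = C *\<^sub>v (I *\<^sub>v (C\<^sup>T *\<^sub>v x))"
    using C I x by (simp add: assoc_mult_mat_vec[of _ n g _ n] assoc_mult_mat_vec[of _ g g _ n])
  moreover have "C *\<^sub>v (I *\<^sub>v (C\<^sup>T *\<^sub>v x)) \<in> carrier_vec n" "I *\<^sub>v (C\<^sup>T *\<^sub>v x) \<in> carrier_vec g" using C I x by auto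
  ultimately show ?thesis
    using x c transpose_vec_mult_scalar[OF C, of "I *\<^sub>v (C\<^sup>T *\<^sub>v x)" x]
    by (simp add: add_mult_distrib_mat_vec[of _ n n] scalar_prod_add_distrib[of _ n])
qed

text \<open>The determinants on the two sides have sizes \<open>g\<close> and \<open>p\<close>. The
  matrix determinant lemma turns both quotients into determinants of size \<open>n\<close>, where
  the two matrices are ordered as forms by the matrix Cauchy-Schwarz inequality.\<close>

lemma det_ratio_compress:
  assumes W: "pos_def p W" and V: "V \<in> carrier_mat n p" and A: "A \<in> carrier_mat p g"
    and N: "pos_def g (A\<^sup>T * W * A)"
  shows "det (A\<^sup>T * W * A + (V * A)\<^sup>T * (V * A)) / det (A\<^sup>T * W * A) \<le> det (W + V\<^sup>T * V) / det W"
proof -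
  note W' = pos_defD[OF W] and N' = pos_defD[OF N]
  define C where "C = V * A"
  define N0 where "N0 = A\<^sup>T * W * A"
  note N' = N'[folded N0_def]
  have C: "C \<in> carrier_mat n g" unfolding C_def using V A by auto
  have CT: "C\<^sup>T = A\<^sup>T * V\<^sup>T" unfolding C_def using V A by (simp add: transpose_mult[of _ n p])
  note iW = inv_mat[OF W'(1,5)] and iN = inv_mat[OF N'(1,5)]
  have iWs: "(inv_mat W)\<^sup>T = inv_mat W" by (rule inv_mat_transpose[OF W'(1,5,2)])
  have iNs: "(inv_mat N0)\<^sup>T = inv_mat N0" by (rule inv_mat_transpose[OF N'(1,5,2)])
  let ?P = "1\<^sub>m n + C * (inv_mat N0 * C\<^sup>T)" and ?R = "1\<^sub>m n + V * (inv_mat W * V\<^sup>T)"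
  have 1: "det (N0 + C\<^sup>T * C) = det N0 * det ?P"
    using C N' by (intro det_add_mult[of _ g]) auto
  have 2: "det (W + V\<^sup>T * V) = det W * det ?R"
    using V W' by (intro det_add_mult[of _ p]) auto
  have sym: "(1\<^sub>m n + D * (I * D\<^sup>T))\<^sup>T = 1\<^sub>m n + D * (I * D\<^sup>T)"
    if "D \<in> carrier_mat n q" "I \<in> carrier_mat q q" "I\<^sup>T = I" for D I :: "real mat" and q
    using that by (simp add: transpose_add[of _ n n] transpose_mult[of _ n q _ n] transpose_mult[of _ q q _ n]
        mult_carrier_mat[of _ n q _ n] mult_carrier_mat[of _ q q _ n] assoc_mult_mat[of _ n q _ q _ n])
  have "det ?P \<le> det ?R"
  proof (rule det_mono[of n])
    show "pos_def n ?P"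
      unfolding pos_def_def
    proof (intro conjI ballI impI)
      show "?P \<in> carrier_mat n n" using C iN by auto
      show "?P\<^sup>T = ?P" by (rule sym[OF C iN(1) iNs])
      fix x :: "real vec" assume x: "x \<in> carrier_vec n" "x \<noteq> 0\<^sub>v n"
      define a where "a = C\<^sup>T *\<^sub>v x"
      have a: "a \<in> carrier_vec g" unfolding a_def using C x by auto
      note c = inv_mat_cancel[OF N'(1,5) a]
      have "a \<bullet> (inv_mat N0 *\<^sub>v a) = (inv_mat N0 *\<^sub>v a) \<bullet> (N0 *\<^sub>v (inv_mat N0 *\<^sub>v a))"
        using comm_scalar_prod[OF a c(2)] c(1) by simp
      then have "a \<bullet> (inv_mat N0 *\<^sub>v a) \<ge> 0" using N'(4)[OF c(2)] by simp
      then show "0 < x \<bullet> (?P *\<^sub>v x)"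
        using det_one_plus_form[OF C iN(1) x(1)] scalar_prod_self_pos[OF x] unfolding a_def by simp
    qed
    show "?R \<in> carrier_mat n n" using V iW by auto
    show "?R\<^sup>T = ?R" by (rule sym[OF V iW(1) iWs])
    fix x :: "real vec" assume x: "x \<in> carrier_vec n"
    have Vx: "V\<^sup>T *\<^sub>v x \<in> carrier_vec p" using V x by auto
    have "C\<^sup>T *\<^sub>v x = A\<^sup>T *\<^sub>v (V\<^sup>T *\<^sub>v x)" unfolding CT using V A x by (simp add: assoc_mult_mat_vec[of _ g p _ n])
    then show "x \<bullet> (?P *\<^sub>v x) \<le> x \<bullet> (?R *\<^sub>v x)"
      using det_one_plus_form[OF C iN(1) x] det_one_plus_form[OF V iW(1) x]
        pos_def_congruence_cauchy_schwarz[OF W A N'(5)[unfolded N0_def] Vx] unfolding N0_def by simp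
  qed
  then show ?thesis
    unfolding N0_def[symmetric] C_def[symmetric] 1 2 using W'(5) N'(5) by simp
qed

lemma gram_expand:
  assumes "orth_proj n Q" "Y \<in> carrier_mat n p"
  shows "Y\<^sup>T * Q * Y = (Q * Y)\<^sup>T * (Q * Y)"
proof -
  note Q' = orth_projD[OF assms(1)]
  have "(Q * Y)\<^sup>T * (Q * Y) = Y\<^sup>T * (Q * (Q * Y))"
    using Q' assms(2) by (simp add: transpose_mult[of _ n n _ p] assoc_mult_mat[of _ p n _ n _ p])
  also have "Q * (Q * Y) = Q * Y" using assoc_mult_mat[OF Q'(1) Q'(1) assms(2)] Q'(3) by simp
  finally show ?thesis using Q' assms(2) by (simp add: assoc_mult_mat[of _ p n _ n _ p])
qed

text \<open>\<open>B\<close> is the mean, \<open>Z\<close> the noise, \<open>Q\<close> the residual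
  projection of the larger model and \<open>Q + R\<close> that of the smaller one. After compression
  by \<open>A\<close> the signal in the range of \<open>R\<close> preserves lengths, and the noise
  there is at most half as long; this gives \<open>C^T C\<close> the lower bound
  \<open>1 / 4\<close> as a form. The compressed residual matrix \<open>N\<close> has the upper
  bound \<open>K\<close>. So \<open>C^T C\<close> dominates \<open>N / (4 K)\<close>, and a scalar
  factor of a matrix of size \<open>g\<close> enters the determinant to the power
  \<open>g\<close>.\<close>

lemma det_ratio_lower:
  assumes Q: "orth_proj n Q" and R: "orth_proj n R" and B: "B \<in> carrier_mat n p" and Z: "Z \<in> carrier_mat n p"
    and QB: "Q * B = 0\<^sub>m n p" and W: "pos_def p (Z\<^sup>T * Q * Z)" and A: "A \<in> carrier_mat p g"
    and BA: "(B * A)\<^sup>T * R * (B * A) = 1\<^sub>m g"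
    and small: "tr ((Z * A)\<^sup>T * R * (Z * A)) \<le> 1 / 4" and bound: "tr ((Z * A)\<^sup>T * 1\<^sub>m n * (Z * A)) \<le> K" and K: "K > 0"
  shows "det (Z\<^sup>T * Q * Z) * (1 + 1 / (4 * K)) ^ g \<le> det ((B + Z)\<^sup>T * (Q + R) * (B + Z))"
proof -
  note Q' = orth_projD[OF Q] and R' = orth_projD[OF R]
  define Y where "Y = B + Z"
  have Y: "Y \<in> carrier_mat n p" unfolding Y_def using B Z by auto
  define W0 where "W0 = Z\<^sup>T * Q * Z"
  note W = W[folded W0_def] note W' = pos_defD[OF W]
  define V where "V = R * Y"
  have V: "V \<in> carrier_mat n p" unfolding V_def using R' Y by auto
  have QY: "Q * Y = Q * Z" unfolding Y_def using Q' B Z QB by (simp add: mult_add_distrib_mat[of _ n n _ p])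
  have YW: "Y\<^sup>T * (Q + R) * Y = W0 + V\<^sup>T * V"
  proof -
    have "Y\<^sup>T * (Q + R) * Y = Y\<^sup>T * Q * Y + Y\<^sup>T * R * Y"
      using Y Q' R'
      by (simp add: mult_add_distrib_mat[of _ p n _ n] add_mult_distrib_mat[of _ p n _ _ p] mult_carrier_mat[of _ p n _ n] del: assoc_mult_mat)
    also have "Y\<^sup>T * R * Y = V\<^sup>T * V" unfolding V_def by (rule gram_expand[OF R Y])
    also have "Y\<^sup>T * Q * Y = W0" unfolding gram_expand[OF Q Y] QY W0_def gram_expand[OF Q Z] ..
    finally show ?thesis .
  qed
  have ZA: "Z * A \<in> carrier_mat n g" and BAc: "B * A \<in> carrier_mat n g" using Z B A by auto
  define N where "N = A\<^sup>T * W0 * A"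
  have Nc: "N \<in> carrier_mat g g" unfolding N_def using A W' by auto
  have Ns: "N\<^sup>T = N" unfolding N_def using A W'
    by (simp add: transpose_mult[of _ g p _ g] transpose_mult[of _ p p _ g] assoc_mult_mat[of _ g p _ p _ g] mult_carrier_mat[of _ p p _ g])
  have Nform: "x \<bullet> (N *\<^sub>v x) = (A *\<^sub>v x) \<bullet> (W0 *\<^sub>v (A *\<^sub>v x))" if "x \<in> carrier_vec g" for x
    unfolding N_def by (rule gram_form[OF A W'(1) that])
  have BAx: "(B * A *\<^sub>v x) \<bullet> (R *\<^sub>v (B * A *\<^sub>v x)) = x \<bullet> x" if "x \<in> carrier_vec g" for x
    using gram_form[OF BAc R'(1) that] BA that by simp
  have N: "pos_def g N"
    unfolding pos_def_def
  proof (intro conjI ballI impI)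
    fix x :: "real vec" assume x: "x \<in> carrier_vec g" "x \<noteq> 0\<^sub>v g"
    have Ax: "A *\<^sub>v x \<in> carrier_vec p" using A x by auto
    have "A *\<^sub>v x \<noteq> 0\<^sub>v p"
    proof
      assume "A *\<^sub>v x = 0\<^sub>v p"
      then have "B * A *\<^sub>v x = B *\<^sub>v 0\<^sub>v p" using B A x by (simp add: assoc_mult_mat_vec[of _ n p _ g])
      also have "\<dots> = 0\<^sub>v n" using B by (auto intro!: eq_vecI)
      finally have "x \<bullet> x = 0" using BAx[OF x(1)] R' by (simp add: mult_mat_vec_carrier[of _ n n])
      then show False using scalar_prod_self_pos[OF x] by simp
    qed
    then show "0 < x \<bullet> (N *\<^sub>v x)" unfolding Nform[OF x(1)] using W'(3)[OF Ax] by simp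
  qed (use Nc Ns in auto)
  note N' = pos_defD[OF N]
  define C where "C = V * A"
  have C: "C \<in> carrier_mat n g" unfolding C_def using V A by auto
  define \<tau> where "\<tau> = 1 / (4 * K)"
  have \<tau>: "\<tau> > 0" unfolding \<tau>_def using K by simp
  have "det ((1 + \<tau>) \<cdot>\<^sub>m N) \<le> det (N + C\<^sup>T * C)"
  proof (rule det_mono[of g])
    have f: "x \<bullet> (((1 + \<tau>) \<cdot>\<^sub>m N) *\<^sub>v x) = (1 + \<tau>) * (x \<bullet> (N *\<^sub>v x))" if "x \<in> carrier_vec g" for x
      using that N'(1) by (simp add: smult_mat_mult_vec[of _ g g] mult_mat_vec_carrier[of _ g g])
    show "pos_def g ((1 + \<tau>) \<cdot>\<^sub>m N)"
      unfolding pos_def_def using N' \<tau> f by (auto simp: transpose_smult)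
    show "N + C\<^sup>T * C \<in> carrier_mat g g" using N' C by auto
    show "(N + C\<^sup>T * C)\<^sup>T = N + C\<^sup>T * C"
      using N' C by (simp add: transpose_add[of _ g g] transpose_mult[of _ g n _ g])
    fix x :: "real vec" assume x: "x \<in> carrier_vec g"
    define a where "a = R *\<^sub>v (B * A *\<^sub>v x)"
    define b where "b = R *\<^sub>v (Z * A *\<^sub>v x)"
    have bax: "B * A *\<^sub>v x \<in> carrier_vec n" and zax: "Z * A *\<^sub>v x \<in> carrier_vec n"
      using BAc ZA x by (auto simp: mult_mat_vec_carrier[of _ n g])
    have ab: "a \<in> carrier_vec n" "b \<in> carrier_vec n"
      unfolding a_def b_def using R' bax zax by (auto simp: mult_mat_vec_carrier[of _ n n])
    have aa: "a \<bullet> a = x \<bullet> x"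
      unfolding a_def using BAx[OF x] orth_proj_form[OF R bax bax] by simp
    have bb: "b \<bullet> b \<le> (x \<bullet> x) / 4"
    proof -
      have "b \<bullet> b \<le> tr ((Z * A)\<^sup>T * R * (Z * A)) * (x \<bullet> x)"
        unfolding b_def using gram_form_le_tr[OF ZA R x] orth_proj_form[OF R zax zax] by simp
      also have "\<dots> \<le> 1 / 4 * (x \<bullet> x)"
        using small scalar_prod_self_nonneg by (intro mult_right_mono)
      finally show ?thesis by simp
    qed
    have Cx: "C *\<^sub>v x = a + b"
    proof -
      have "C *\<^sub>v x = R *\<^sub>v (Y *\<^sub>v (A *\<^sub>v x))"
        unfolding C_def V_def using R' Y A x
        by (simp add: assoc_mult_mat_vec[of _ n n _ g] assoc_mult_mat_vec[of _ n p _ g] assoc_mult_mat_vec[of _ n n _ p]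
            assoc_mult_mat[of _ n n _ p _ g] mult_carrier_mat[of _ n p _ g] mult_mat_vec_carrier[of _ p g])
      also have "Y *\<^sub>v (A *\<^sub>v x) = B * A *\<^sub>v x + Z * A *\<^sub>v x"
        unfolding Y_def using B Z A x
        by (simp add: add_mult_distrib_mat_vec[of _ n p] assoc_mult_mat_vec[of _ n p _ g] mult_mat_vec_carrier[of _ p g])
      finally show ?thesis unfolding a_def b_def using R' bax zax by (simp add: mult_add_distrib_mat_vec[of _ n n])
    qed
    \<comment> \<open>Yields \<open>|a + b|^2 \<ge> |a|^2 / 2 - |b|^2\<close>; with
      \<open>|b|^2 \<le> |a|^2 / 4\<close> a quarter of \<open>|a|^2\<close> remains.\<close>
    have "0 \<le> (a + 2 \<cdot>\<^sub>v b) \<bullet> (a + 2 \<cdot>\<^sub>v b)" by (rule scalar_prod_self_nonneg)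
    also have "\<dots> = a \<bullet> a + 4 * (b \<bullet> a) + 4 * (b \<bullet> b)"
      using ab comm_scalar_prod[OF ab] by (simp add: scalar_prod_add_distrib[of _ n] add_scalar_prod_distrib[of _ n])
    finally have "(C *\<^sub>v x) \<bullet> (C *\<^sub>v x) \<ge> (a \<bullet> a) / 2 - b \<bullet> b"
      unfolding Cx using ab comm_scalar_prod[OF ab] by (simp add: scalar_prod_add_distrib[of _ n] add_scalar_prod_distrib[of _ n])
    then have 1: "(C *\<^sub>v x) \<bullet> (C *\<^sub>v x) \<ge> (x \<bullet> x) / 4" using aa bb by simp
    have "x \<bullet> (N *\<^sub>v x) = (Z * A *\<^sub>v x) \<bullet> (Q *\<^sub>v (Z * A *\<^sub>v x))"
      unfolding Nform[OF x] W0_def using gram_form[OF Z Q'(1), of "A *\<^sub>v x"] Z A x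
      by (simp add: assoc_mult_mat_vec[of _ n p _ g] mult_mat_vec_carrier[of _ p g])
    also have "\<dots> \<le> (Z * A *\<^sub>v x) \<bullet> (1\<^sub>m n *\<^sub>v (Z * A *\<^sub>v x))" using orth_proj_form_le[OF Q zax] zax by simp
    also have "\<dots> \<le> tr ((Z * A)\<^sup>T * 1\<^sub>m n * (Z * A)) * (x \<bullet> x)" by (rule gram_form_le_tr[OF ZA orth_proj_one x])
    also have "\<dots> \<le> K * (x \<bullet> x)" using bound scalar_prod_self_nonneg by (intro mult_right_mono)
    finally have "\<tau> * (x \<bullet> (N *\<^sub>v x)) \<le> \<tau> * (K * (x \<bullet> x))" using \<tau> by simp
    then have 2: "\<tau> * (x \<bullet> (N *\<^sub>v x)) \<le> (x \<bullet> x) / 4" unfolding \<tau>_def using K by simp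
    have "x \<bullet> ((N + C\<^sup>T * C) *\<^sub>v x) = x \<bullet> (N *\<^sub>v x) + (C *\<^sub>v x) \<bullet> (C *\<^sub>v x)"
      using N' C x transpose_vec_mult_scalar[of "C\<^sup>T" g n "C *\<^sub>v x" x]
      by (simp add: add_mult_distrib_mat_vec[of _ g g] scalar_prod_add_distrib[of _ g] assoc_mult_mat_vec[of _ g n _ g]
          mult_mat_vec_carrier[of _ g g] mult_mat_vec_carrier[of _ g n] mult_mat_vec_carrier[of _ n g])
    then show "x \<bullet> (((1 + \<tau>) \<cdot>\<^sub>m N) *\<^sub>v x) \<le> x \<bullet> ((N + C\<^sup>T * C) *\<^sub>v x)"
      unfolding f[OF x] using 1 2 by (simp add: distrib_right)
  qed
  then have "(1 + \<tau>) ^ g * det N \<le> det (N + C\<^sup>T * C)" using N'(1) by simp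
  moreover have "det N > 0" by (rule pos_def_det[OF N])
  ultimately have "(1 + \<tau>) ^ g \<le> det (N + C\<^sup>T * C) / det N" by (simp add: field_simps)
  also have "\<dots> \<le> det (W0 + V\<^sup>T * V) / det W0"
    using det_ratio_compress[OF W V A] N unfolding N_def C_def by simp
  finally show ?thesis
    using pos_def_det[OF W] unfolding YW[unfolded Y_def, symmetric] W0_def[symmetric] \<tau>_def by (simp add: field_simps)
qed

text \<open>For \<open>H = G (G^T G)^(-1)\<close> one has \<open>G^T H = 1\<close> and
  \<open>H^T H = (G^T G)^(-1)\<close>. With \<open>A\<close> the inverse root of \<open>S\<close>
  times \<open>H\<close>, the compressed signal is \<open>H^T G G^T H = 1\<close> and
  \<open>A^T S A\<close> is \<open>(G^T G)^(-1)\<close>, whose diagonal entries are at most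
  \<open>1 / l\<close>.\<close>

lemma noncentrality_section:
  assumes S: "pos_def p S" and B: "B \<in> carrier_mat n p" and Q: "Q \<in> carrier_mat n n"
    and G: "G \<in> carrier_mat p g" and eq: "inv_sqrt_mat S * (B\<^sup>T * Q * B) * inv_sqrt_mat S = G * G\<^sup>T"
    and l: "l > 0" "\<And>x. x \<in> carrier_vec g \<Longrightarrow> l * (x \<bullet> x) \<le> x \<bullet> (G\<^sup>T * G *\<^sub>v x)"
  shows "\<exists>A \<in> carrier_mat p g. (B * A)\<^sup>T * Q * (B * A) = 1\<^sub>m g \<and> tr (A\<^sup>T * S * A) \<le> real g / l"
proof -
  define T where "T = inv_sqrt_mat S"
  note T = inv_sqrt_mat[OF S, folded T_def]
  have Sc: "S \<in> carrier_mat p p" using pos_defD[OF S] by auto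
  define C where "C = G\<^sup>T * G"
  have C: "C \<in> carrier_mat g g" "C\<^sup>T = C" unfolding C_def using G by (auto simp: transpose_mult[of _ g p])
  have Cpd: "pos_def g C"
    unfolding pos_def_def using C
  proof (intro conjI ballI impI)
    fix x :: "real vec" assume x: "x \<in> carrier_vec g" "x \<noteq> 0\<^sub>v g"
    have "0 < l * (x \<bullet> x)" using l(1) scalar_prod_self_pos[OF x] by simp
    also have "\<dots> \<le> x \<bullet> (C *\<^sub>v x)" using l(2)[OF x(1)] unfolding C_def .
    finally show "0 < x \<bullet> (C *\<^sub>v x)" .
  qed auto
  note C' = pos_defD[OF Cpd]
  note i = inv_mat[OF C(1) C'(5)] and isym = inv_mat_transpose[OF C(1) C'(5) C(2)]
  define I where "I = inv_mat C"
  note i = i[folded I_def] and isym = isym[folded I_def]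
  define H where "H = G * I"
  have H: "H \<in> carrier_mat p g" unfolding H_def using G i by auto
  have GH: "G\<^sup>T * H = 1\<^sub>m g"
    unfolding H_def using G i assoc_mult_mat[of "G\<^sup>T" g p G g I g] unfolding C_def[symmetric] by simp
  have HG: "H\<^sup>T * G = 1\<^sub>m g"
    using transpose_mult[of "G\<^sup>T" g p H g] G H GH by simp
  have HH: "H\<^sup>T * H = I"
  proof -
    have "H\<^sup>T * H = H\<^sup>T * (G * I)" using arg_cong[OF H_def, of "\<lambda>M. H\<^sup>T * M"] .
    also have "\<dots> = H\<^sup>T * G * I" using H G i by (intro assoc_mult_mat[symmetric, of _ g p _ g _ g]) auto
    finally have "H\<^sup>T * H = H\<^sup>T * G * I" .
    then show ?thesis unfolding HG using i by simp
  qed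
  define A where "A = T * H"
  have A: "A \<in> carrier_mat p g" unfolding A_def using T H by auto
  have AT: "A\<^sup>T = H\<^sup>T * T" unfolding A_def using transpose_mult[OF T(1) H] T(2) by simp
  have AFA: "A\<^sup>T * F * A = H\<^sup>T * (T * F * T) * H" if F: "F \<in> carrier_mat p p" for F
    unfolding AT unfolding A_def using T(1) H F
    by (simp add: assoc_mult_mat[of _ g p _ p _ g] assoc_mult_mat[of _ g p _ p _ p] assoc_mult_mat[of _ p p _ p _ g]
        assoc_mult_mat[of _ p p _ p _ p] mult_carrier_mat[of _ p p _ g] mult_carrier_mat[of _ p p _ p] mult_carrier_mat[of _ g p _ p])
  have 1: "(B * A)\<^sup>T * Q * (B * A) = 1\<^sub>m g"
  proof -
    have "(B * A)\<^sup>T * Q * (B * A) = A\<^sup>T * (B\<^sup>T * Q * B) * A"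
      using A B Q
      by (simp add: transpose_mult[of _ n p _ g] assoc_mult_mat[of _ g p _ n _ n] assoc_mult_mat[of _ g p _ n _ g] assoc_mult_mat[of _ g n _ n _ g]
          assoc_mult_mat[of _ p n _ n _ p] assoc_mult_mat[of _ p n _ n _ g] assoc_mult_mat[of _ g p _ p _ g] assoc_mult_mat[of _ n n _ p _ g]
          assoc_mult_mat[of _ p n _ p _ g] assoc_mult_mat[of _ g p _ n _ p] mult_carrier_mat[of _ n p _ g] mult_carrier_mat[of _ n n _ g]
          mult_carrier_mat[of _ n n _ p] mult_carrier_mat[of _ p n _ p] mult_carrier_mat[of _ p n _ n] mult_carrier_mat[of _ g p _ n])
    also have "\<dots> = H\<^sup>T * (T * (B\<^sup>T * Q * B) * T) * H" using B Q by (intro AFA) auto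
    also have "\<dots> = H\<^sup>T * (G * G\<^sup>T) * H" unfolding T_def eq ..
    also have "\<dots> = (H\<^sup>T * G) * (G\<^sup>T * H)"
      using H G by (simp add: assoc_mult_mat[of _ g p _ g _ p] assoc_mult_mat[of _ g p _ p _ g] assoc_mult_mat[of _ p g _ p _ g]
          assoc_mult_mat[of _ g p _ g _ g] mult_carrier_mat[of _ p g _ p])
    also have "\<dots> = 1\<^sub>m g" unfolding GH HG by simp
    finally show ?thesis .
  qed
  have "A\<^sup>T * S * A = I"
    unfolding AFA[OF Sc] T(3) using H HH by simp
  then have "tr (A\<^sup>T * S * A) = (\<Sum>b<g. I $$ (b, b))" unfolding tr_def using i by simp
  also have "\<dots> \<le> (\<Sum>b<g. 1 / l)"
  proof (rule sum_mono)
    fix b assume "b \<in> {..<g}"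
    then have b: "b < g" by simp
    define e where "e = (unit_vec g b :: real vec)"
    have e: "e \<in> carrier_vec g" "e \<bullet> e = 1" unfolding e_def using b by auto
    define y where "y = I *\<^sub>v e"
    note y = inv_mat_cancel[OF C(1) C'(5) e(1), folded I_def, folded y_def]
    have Ib: "I $$ (b, b) = e \<bullet> y" unfolding y_def e_def using i b by simp
    \<comment> \<open>The entry is \<open>s = e \<bullet> y\<close>. From
      \<open>l |y|^2 \<le> s\<close> and \<open>s^2 \<le> |y|^2\<close> follows
      \<open>l s^2 \<le> s\<close>, hence \<open>s \<le> 1 / l\<close>.\<close>
    have ly: "l * (y \<bullet> y) \<le> e \<bullet> y"
      using l(2)[OF y(2)] unfolding C_def[symmetric] y(1) using comm_scalar_prod[OF y(2) e(1)] by simp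
    have cs: "(e \<bullet> y)\<^sup>2 \<le> y \<bullet> y" using cauchy_schwarz_vec[OF y(2) e(1)] e(2) by simp
    have "l * (e \<bullet> y)\<^sup>2 \<le> l * (y \<bullet> y)" using cs l(1) by simp
    then have le: "l * (e \<bullet> y)\<^sup>2 \<le> e \<bullet> y" using ly by simp
    show "I $$ (b, b) \<le> 1 / l"
    proof (cases "e \<bullet> y > 0")
      case True
      then have "l * (e \<bullet> y) \<le> 1" using le by (simp add: power2_eq_square)
      then show ?thesis unfolding Ib using l(1) by (simp add: field_simps)
    next
      case False
      then have "e \<bullet> y \<le> 0" by simp
      also have "0 \<le> 1 / l" using l(1) by simp
      finally show ?thesis unfolding Ib .
    qed
  qed
  also have "\<dots> = real g / l" by simp
  finally show ?thesis using A 1 by blast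
qed

section \<open>The regression model for fixed sample size\<close>

text \<open>\<open>Sigma_hat\<close> without the factor \<open>1 / n\<close>, which keeps the sample
  size out of the determinant comparisons.\<close>

definition resid_gram :: "real mat \<Rightarrow> real mat \<Rightarrow> nat set \<Rightarrow> real mat" where
  "resid_gram X Y j = Y\<^sup>T * (1\<^sub>m (dim_row X) - proj_mat X j) * Y"

text \<open>\<open>p + k \<le> n\<close> leaves every model at least \<open>p\<close> residual
  degrees of freedom, which makes the residual Gram matrices of the noise nonsingular almost surely.
  Asymptotically it is available because \<open>c0 < 1\<close>.\<close>

locale regression = gaussian_noise M n p S E c + design n k X
  for M :: "'a measure" and n p S E c k X +
  fixes Y :: "'a \<Rightarrow> real mat" and jstar :: "nat set" and \<Theta> :: "real mat"
  assumes jstar: "jstar \<subseteq> {..<k}" and \<Theta>: "\<Theta> \<in> carrier_mat (card jstar) p"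
    and Y: "\<And>x. x \<in> space M \<Longrightarrow> Y x \<in> carrier_mat n p"
    and E: "\<And>x. x \<in> space M \<Longrightarrow> noise_mat n p (E x) = Y x - sub_cols X jstar * \<Theta>"
    and p: "p \<ge> 1" and n: "p + k \<le> n"
begin

abbreviation "W j x \<equiv> resid_gram X (Y x) j"
abbreviation "B \<equiv> sub_cols X jstar * \<Theta>"

lemma B: "B \<in> carrier_mat n p"
  using sub_cols_carrier[OF X jstar] \<Theta> by auto

lemma W_eq: "W j x = (Y x)\<^sup>T * res_proj j * Y x"
  unfolding resid_gram_def res_proj_def using X by simp

lemma Y_eq: "x \<in> space M \<Longrightarrow> Y x = B + Z x"
  using E[of x] Y[of x] B by (intro eq_matI) auto

lemma res_proj_B: "jstar \<subseteq> j \<Longrightarrow> j \<subseteq> {..<k} \<Longrightarrow> res_proj j * B = 0\<^sub>m n p"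
proof -
  assume j: "jstar \<subseteq> j" "j \<subseteq> {..<k}"
  have "res_proj j * B = res_proj j * sub_cols X jstar * \<Theta>"
    using orth_projD(1)[OF orth_proj_res_proj[OF j(2)]] sub_cols_carrier[OF X jstar] \<Theta>
    by (intro assoc_mult_mat[symmetric]) auto
  then show ?thesis unfolding res_proj_kills[OF j] using \<Theta> by simp
qed

lemma card_le_k: "j \<subseteq> {..<k} \<Longrightarrow> card j \<le> k"
  using card_mono[of "{..<k}" j] by simp

lemma tr_res_proj_ge: "j \<subseteq> {..<k} \<Longrightarrow> tr (res_proj j) \<ge> real p"
  using tr_res_proj[of j] card_le_k[of j] n by simp

lemma W_overfit:
  assumes j: "jstar \<subseteq> j" "j \<subseteq> {..<k}" and x: "x \<in> space M"
  shows "W j x = (Z x)\<^sup>T * res_proj j * Z x"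
proof -
  note Q = orth_proj_res_proj[OF j(2)]
  have "res_proj j * Y x = res_proj j * Z x"
    unfolding Y_eq[OF x] using orth_projD[OF Q] B res_proj_B[OF j]
    by (simp add: mult_add_distrib_mat[of _ n n _ p])
  then show ?thesis
    unfolding W_eq gram_expand[OF Q Y[OF x]] using gram_expand[OF Q, of "Z x" p] by simp
qed

lemma AE_W_pos_def:
  assumes j: "jstar \<subseteq> j" "j \<subseteq> {..<k}"
  shows "AE x in M. pos_def p (W j x)"
  using AE_gram_pos_def[OF orth_proj_res_proj[OF j(2)] tr_res_proj_ge[OF j(2)]] AE_space
  by eventually_elim (simp add: W_overfit[OF j])

text \<open>Hides the direction \<open>u\<close> and the projection. Only the update of the
  determinant by \<open>h\<close> and the two tail bounds remain, and the model enters these bounds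
  through its size alone.\<close>

lemma W_insert:
  assumes j: "jstar \<subseteq> j" "j \<subseteq> {..<k}" and i: "i < k" "i \<notin> j"
  shows "\<exists>h\<in>borel_measurable M.
    (\<forall>x\<in>space M. det (W j x) \<noteq> 0 \<longrightarrow> det (W (insert i j) x) = det (W j x) * (1 - h x)) \<and>
    (\<forall>K>0. prob {x \<in> space M. h x \<ge> K} \<le> real p / real (n - card j) / K) \<and>
    (\<forall>\<eta>>0. prob {x \<in> space M. h x \<ge> (1 + \<eta>) * (real p / real (n - card j))} \<le> 2 / (\<eta>\<^sup>2 * real p))"
proof -
  note Q = orth_proj_res_proj[OF j(2)] and t = tr_res_proj_ge[OF j(2)]
  have ij: "jstar \<subseteq> insert i j" "insert i j \<subseteq> {..<k}" using i j by auto
  obtain u where u: "u \<in> carrier_vec n" "u \<bullet> u = 1" "res_proj j *\<^sub>v u = u"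
    and eq: "res_proj (insert i j) = res_proj j - outer u"
    using res_proj_insert[OF i j(2)] by auto
  have tr: "tr (res_proj j) = real (n - card j)"
    using tr_res_proj[OF j(2)] card_le_k[OF j(2)] n by simp
  show ?thesis
  proof (intro bexI[of _ "\<lambda>x. leverage n p (res_proj j) u (E x)"] conjI ballI allI impI)
    show "(\<lambda>x. leverage n p (res_proj j) u (E x)) \<in> borel_measurable M"
      by (rule lev_measurable[OF Q t u(1)])
    show "prob {x \<in> space M. leverage n p (res_proj j) u (E x) \<ge> K} \<le> real p / real (n - card j) / K"
      if "K > 0" for K
      using lev_markov[OF Q t u that p] unfolding tr .
    show "prob {x \<in> space M. leverage n p (res_proj j) u (E x) \<ge> (1 + \<eta>) * (real p / real (n - card j))} \<le> 2 / (\<eta>\<^sup>2 * real p)"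
      if "\<eta> > 0" for \<eta>
      using lev_chebyshev[OF Q t u that p] unfolding tr .
    fix x assume x: "x \<in> space M" and d: "det (W j x) \<noteq> 0"
    show "det (W (insert i j) x) = det (W j x) * (1 - leverage n p (res_proj j) u (E x))"
      using d unfolding W_overfit[OF ij x] W_overfit[OF j x] eq leverage_def u(3) by simp
  qed
qed

lemma noncentrality_eq:
  assumes j: "j \<subseteq> {..<k}"
  shows "noncentrality X jstar \<Theta> S j = inv_sqrt_mat S * (B\<^sup>T * res_proj j * B) * inv_sqrt_mat S"
proof -
  let ?s = "card jstar"
  note A = sub_cols_carrier[OF X jstar]
  note T = inv_sqrt_mat(1)[OF S]
  have Q: "res_proj j \<in> carrier_mat n n" using orth_projD(1)[OF orth_proj_res_proj[OF j]] .
  have "noncentrality X jstar \<Theta> S j = inv_sqrt_mat S * \<Theta>\<^sup>T * (sub_cols X jstar)\<^sup>T * res_proj j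
       * sub_cols X jstar * \<Theta> * inv_sqrt_mat S"
    unfolding noncentrality_def res_proj_def using X by simp
  also have "\<dots> = inv_sqrt_mat S * (B\<^sup>T * res_proj j * B) * inv_sqrt_mat S"
    using A T Q \<Theta>
    by (simp add: transpose_mult[of _ n ?s _ p] assoc_mult_mat[of _ p p _ ?s _ n] assoc_mult_mat[of _ p ?s _ n _ n]
        assoc_mult_mat[of _ p p _ n _ n] assoc_mult_mat[of _ p p _ n _ p] assoc_mult_mat[of _ p p _ n _ ?s]
        assoc_mult_mat[of _ p p _ ?s _ p] assoc_mult_mat[of _ p p _ p _ p]
        assoc_mult_mat[of _ p n _ n _ ?s] assoc_mult_mat[of _ p n _ n _ p] assoc_mult_mat[of _ p n _ ?s _ p] assoc_mult_mat[of _ p ?s _ p _ p]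
        assoc_mult_mat[of _ p ?s _ n _ ?s] assoc_mult_mat[of _ p ?s _ n _ p] assoc_mult_mat[of _ p ?s _ ?s _ p]
        assoc_mult_mat[of _ p n _ p _ p] assoc_mult_mat[of _ n n _ p _ p] assoc_mult_mat[of _ n n _ ?s _ p] assoc_mult_mat[of _ n ?s _ p _ p]
        assoc_mult_mat[of _ ?s n _ ?s _ p] assoc_mult_mat[of _ ?s ?s _ p _ p] mult_carrier_mat[of _ ?s n _ ?s] mult_carrier_mat[of _ ?s ?s _ p]
        assoc_mult_mat[of _ ?s n _ n _ p] assoc_mult_mat[of _ ?s n _ p _ p]
        mult_carrier_mat[of _ p p _ ?s] mult_carrier_mat[of _ p p _ n] mult_carrier_mat[of _ p ?s _ n] mult_carrier_mat[of _ n n _ ?s]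
        mult_carrier_mat[of _ n n _ p] mult_carrier_mat[of _ n ?s _ p] mult_carrier_mat[of _ ?s n _ p] mult_carrier_mat[of _ ?s p _ p]
        mult_carrier_mat[of _ n p _ p] mult_carrier_mat[of _ p ?s _ p] mult_carrier_mat[of _ p n _ p])
  finally show ?thesis .
qed

text \<open>Two exceptional events are removed: the compressed noise is too long within the range of
  \<open>R\<close>, or too long in total. The first bound profits from \<open>tr R \<le> k\<close>,
  while the second contains \<open>n\<close> and is controlled by the free parameter
  \<open>K\<close>. The 32 is 8 divided by the threshold \<open>1 / 4\<close>.\<close>

lemma W_underfit:
  assumes j: "j \<subseteq> {..<k}" and g: "g > 0"
    and G: "full_rank_factor p g (noncentrality X jstar \<Theta> S j) G"
    and l: "l > 0" "l \<le> min_eigenvalue (G\<^sup>T * G)" and K: "K > 0"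
  shows "\<exists>A\<in>sets M. prob A \<ge> 1 - (32 * real k * real g / l + 8 * real n * real g / (l * K)) \<and>
    (\<forall>x\<in>A. pos_def p (W (j \<union> jstar) x) \<longrightarrow> det (W (j \<union> jstar) x) * (1 + 1 / (4 * K)) ^ g \<le> det (W j x))"
proof -
  let ?j' = "j \<union> jstar"
  have j': "jstar \<subseteq> ?j'" "?j' \<subseteq> {..<k}" "j \<subseteq> ?j'" using j jstar by auto
  define Q where "Q = res_proj ?j'"
  define R where "R = res_proj j - res_proj ?j'"
  have Q: "orth_proj n Q" unfolding Q_def by (rule orth_proj_res_proj[OF j'(2)])
  note RR = res_proj_diff[OF j'(3,2), folded R_def]
  note Q' = orth_projD[OF Q] and R' = orth_projD[OF RR(1)]
  have Qj: "res_proj j \<in> carrier_mat n n" using orth_projD(1)[OF orth_proj_res_proj[OF j]] .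
  have QR: "res_proj j = Q + R" unfolding Q_def R_def using Qj Q' by (intro eq_matI) (auto simp: Q_def)
  have QB: "Q * B = 0\<^sub>m n p" unfolding Q_def by (rule res_proj_B[OF j'(1,2)])
  have Gc: "G \<in> carrier_mat p g" and Geq: "inv_sqrt_mat S * (B\<^sup>T * res_proj j * B) * inv_sqrt_mat S = G * G\<^sup>T"
    using G noncentrality_eq[OF j] unfolding full_rank_factor_def by auto
  have GG: "G\<^sup>T * G \<in> carrier_mat g g" "(G\<^sup>T * G)\<^sup>T = G\<^sup>T * G" using Gc by (auto simp: transpose_mult[of _ g p])
  have lb: "l * (x \<bullet> x) \<le> x \<bullet> (G\<^sup>T * G *\<^sub>v x)" if x: "x \<in> carrier_vec g" for x
  proof -
    have "l * (x \<bullet> x) \<le> min_eigenvalue (G\<^sup>T * G) * (x \<bullet> x)"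
      using l(2) scalar_prod_self_nonneg by (intro mult_right_mono)
    also have "\<dots> \<le> x \<bullet> (G\<^sup>T * G *\<^sub>v x)" by (rule min_eigenvalue_le_form[OF GG g x])
    finally show ?thesis .
  qed
  obtain A where A: "A \<in> carrier_mat p g" "(B * A)\<^sup>T * res_proj j * (B * A) = 1\<^sub>m g" "tr (A\<^sup>T * S * A) \<le> real g / l"
    using noncentrality_section[OF S B Qj Gc Geq l(1) lb] by auto
  have BA: "B * A \<in> carrier_mat n g" using B A by auto
  \<comment> \<open>The larger model contains the true one, so \<open>Q\<close> kills the mean and
    the compressed signal is seen by \<open>R\<close> alone.\<close>
  have RBA: "(B * A)\<^sup>T * R * (B * A) = 1\<^sub>m g"
  proof -
    have "Q * (B * A) = 0\<^sub>m n g"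
      using assoc_mult_mat[OF Q'(1) B A(1)] QB A(1) by simp
    then have "res_proj j * (B * A) = R * (B * A)"
      unfolding QR using Q' R' BA by (simp add: add_mult_distrib_mat[of _ n n _ _ g] left_add_zero_mat[of _ n g] mult_carrier_mat[of _ n n _ g] del: assoc_mult_mat)
    then have "(B * A)\<^sup>T * R * (B * A) = (B * A)\<^sup>T * res_proj j * (B * A)"
      using Qj R' BA assoc_mult_mat[of "(B * A)\<^sup>T" g n R n "B * A" g] assoc_mult_mat[of "(B * A)\<^sup>T" g n "res_proj j" n "B * A" g]
      by (simp del: assoc_mult_mat)
    then show ?thesis using A(2) by simp
  qed
  define B1 where "B1 = {x \<in> space M. tr ((Z x * A)\<^sup>T * R * (Z x * A)) \<ge> 1 / 4}"
  define B2 where "B2 = {x \<in> space M. tr ((Z x * A)\<^sup>T * 1\<^sub>m n * (Z x * A)) \<ge> K}"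
  have B1: "B1 \<in> sets M" "prob B1 \<le> 8 * tr R * tr (A\<^sup>T * S * A) / (1 / 4)"
    unfolding B1_def
    by (rule frobenius_bound(2)[OF RR(1) A(1)], simp) (rule frobenius_bound(1)[OF RR(1) A(1)], simp)
  have B2: "B2 \<in> sets M" "prob B2 \<le> 8 * tr (1\<^sub>m n) * tr (A\<^sup>T * S * A) / K"
    unfolding B2_def by (rule frobenius_bound[OF orth_proj_one A(1) K])+
  have trR: "0 \<le> tr R" "tr R \<le> real k"
    using RR(2) card_le_k[OF j'(2)] card_mono[OF finite_subset[OF j'(2)] j'(3)] by auto
  have gl: "0 \<le> real g / l" using l(1) by simp
  have "8 * tr R * tr (A\<^sup>T * S * A) / (1 / 4) = 32 * (tr R * tr (A\<^sup>T * S * A))" by simp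
  also have "tr R * tr (A\<^sup>T * S * A) \<le> tr R * (real g / l)" using A(3) trR by (intro mult_left_mono)
  also have "\<dots> \<le> real k * (real g / l)" using trR gl by (intro mult_right_mono)
  finally have b1: "prob B1 \<le> 32 * real k * real g / l" using B1(2) by simp
  have "8 * tr (1\<^sub>m n) * tr (A\<^sup>T * S * A) / K \<le> 8 * real n * (real g / l) / K"
    unfolding tr_one using A(3) K by (intro divide_right_mono mult_left_mono) auto
  also have "\<dots> = 8 * real n * real g / (l * K)" by simp
  finally have b2: "prob B2 \<le> 8 * real n * real g / (l * K)" using B2(2) by simp
  have "prob (B1 \<union> B2) \<le> prob B1 + prob B2" by (rule measure_Un_le[OF B1(1) B2(1)])
  moreover have U: "B1 \<union> B2 \<in> sets M" using B1(1) B2(1) by (rule sets.Un)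
  ultimately have pr: "prob (space M - (B1 \<union> B2)) \<ge> 1 - (32 * real k * real g / l + 8 * real n * real g / (l * K))"
    using b1 b2 prob_compl[OF U] by linarith
  have "det (W ?j' x) * (1 + 1 / (4 * K)) ^ g \<le> det (W j x)"
    if x: "x \<in> space M - (B1 \<union> B2)" and pd: "pos_def p (W ?j' x)" for x
  proof -
    have xs: "x \<in> space M" using x by simp
    have W': "W ?j' x = (Z x)\<^sup>T * Q * Z x" unfolding Q_def by (rule W_overfit[OF j'(1,2) xs])
    have Wj: "W j x = (B + Z x)\<^sup>T * (Q + R) * (B + Z x)"
      using W_eq[of x j] Y_eq[OF xs] QR by simp
    show ?thesis
      unfolding W' Wj
      by (rule det_ratio_lower[OF Q RR(1) B _ QB pd[unfolded W'] A(1) RBA _ _ K])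
        (use x xs in \<open>simp_all only: B1_def B2_def Diff_iff Un_iff mem_Collect_eq, simp_all\<close>)
  qed
  then have "\<forall>x\<in>space M - (B1 \<union> B2). pos_def p (W ?j' x) \<longrightarrow> det (W ?j' x) * (1 + 1 / (4 * K)) ^ g \<le> det (W j x)"
    by blast
  with pr sets.compl_sets[OF U] show ?thesis by blast
qed

text \<open>The factor \<open>1 / n\<close> contributes \<open>- p * ln n\<close> to the logarithm,
  for every model alike, and so disappears from differences of the criterion.\<close>

lemma IC_eq:
  assumes x: "x \<in> space M" and d: "det (W j x) > 0"
  shows "IC X (Y x) m j = real n * ln (det (W j x)) + real n * (real p * (ln (2 * pi) + 1) - real p * ln (real n)) + m j"
proof -
  have n0: "n > 0" using p n by simp
  have dims: "dim_row (Y x) = n" "dim_col (Y x) = p" "dim_row X = n" using Y[OF x] X by auto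
  have "Sigma_hat X (Y x) j = (1 / real n) \<cdot>\<^sub>m W j x"
    unfolding Sigma_hat_def resid_gram_def dims ..
  then have "det (Sigma_hat X (Y x) j) = (1 / real n) ^ dim_col (W j x) * det (W j x)"
    by simp
  also have "dim_col (W j x) = p" unfolding resid_gram_def using dims by simp
  finally have "ln (det (Sigma_hat X (Y x) j)) = ln ((1 / real n) ^ p * det (W j x))" by simp
  also have "\<dots> = ln ((1 / real n) ^ p) + ln (det (W j x))" using n0 d by (intro ln_mult_pos) auto
  also have "ln ((1 / real n) ^ p) = - real p * ln (real n)" using n0 by (simp add: ln_realpow ln_div)
  finally have eq: "ln (det (Sigma_hat X (Y x) j)) = - real p * ln (real n) + ln (det (W j x))" .
  show ?thesis unfolding IC_def dims eq by (simp add: algebra_simps)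
qed

end

section \<open>Inner probability and the asymptotic log ratio\<close>

text \<open>Inner probability: the event \<open>P\<close> itself need not be measurable.\<close>

definition whp_level :: "(nat \<Rightarrow> 'a measure) \<Rightarrow> real \<Rightarrow> (nat \<Rightarrow> 'a \<Rightarrow> bool) \<Rightarrow> bool" where
  "whp_level M \<epsilon> P \<longleftrightarrow> (\<forall>\<^sub>F n in sequentially. \<exists>A\<in>sets (M n). (\<forall>x\<in>A. P n x) \<and> measure (M n) A \<ge> 1 - \<epsilon>)"

text \<open>The version for all levels at once. Bounds whose constant is chosen after
  \<open>\<epsilon>\<close> are available only as \<open>whp_level\<close>.\<close>

definition whp :: "(nat \<Rightarrow> 'a measure) \<Rightarrow> (nat \<Rightarrow> 'a \<Rightarrow> bool) \<Rightarrow> bool" where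
  "whp M P \<longleftrightarrow> (\<forall>\<epsilon>>0. whp_level M \<epsilon> P)"

lemma whpD: "whp M P \<Longrightarrow> \<epsilon> > 0 \<Longrightarrow> whp_level M \<epsilon> P"
  unfolding whp_def by simp

lemma whp_level_mono:
  assumes "whp_level M \<epsilon> P" "\<forall>\<^sub>F n in sequentially. \<forall>x\<in>space (M n). P n x \<longrightarrow> Q n x"
  shows "whp_level M \<epsilon> Q"
  using assms unfolding whp_level_def
proof eventually_elim
  case (elim n)
  then obtain A where "A \<in> sets (M n)" "\<forall>x\<in>A. P n x" "measure (M n) A \<ge> 1 - \<epsilon>" by auto
  then show ?case using elim(2) sets.sets_into_space[of A "M n"] by (intro bexI[of _ A]) auto
qed

lemma whp_mono:
  assumes "whp M P" "\<forall>\<^sub>F n in sequentially. \<forall>x\<in>space (M n). P n x \<longrightarrow> Q n x"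
  shows "whp M Q"
  using assms whp_level_mono unfolding whp_def by blast

lemma whp_level_conj:
  assumes M: "\<forall>\<^sub>F n in sequentially. prob_space (M n)"
    and "whp_level M a P" "whp_level M b Q"
  shows "whp_level M (a + b) (\<lambda>n x. P n x \<and> Q n x)"
  using assms unfolding whp_level_def
proof eventually_elim
  case (elim n)
  interpret prob_space "M n" by (rule elim(1))
  obtain A B where A: "A \<in> events" "\<forall>x\<in>A. P n x" "prob A \<ge> 1 - a"
    and B: "B \<in> events" "\<forall>x\<in>B. Q n x" "prob B \<ge> 1 - b"
    using elim by auto
  have "prob (A \<union> B) = prob A + prob B - prob (A \<inter> B)"
    using A(1) B(1) by (simp add: measure_Un3 fmeasurable_eq_sets)
  then have "prob (A \<inter> B) \<ge> 1 - (a + b)"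
    using A(3) B(3) prob_le_1[of "A \<union> B"] by linarith
  then show ?case using A B by (intro bexI[of _ "A \<inter> B"]) auto
qed

lemma whp_conj:
  assumes M: "\<forall>\<^sub>F n in sequentially. prob_space (M n)" and "whp M P" "whp M Q"
  shows "whp M (\<lambda>n x. P n x \<and> Q n x)"
  unfolding whp_def
proof (intro allI impI)
  fix \<epsilon> :: real assume "\<epsilon> > 0"
  then have "whp_level M (\<epsilon> / 2 + \<epsilon> / 2) (\<lambda>n x. P n x \<and> Q n x)"
    using assms by (intro whp_level_conj) (auto intro: whpD)
  then show "whp_level M \<epsilon> (\<lambda>n x. P n x \<and> Q n x)" by simp
qed

lemma whp_True:
  assumes "\<forall>\<^sub>F n in sequentially. prob_space (M n)" "\<forall>\<^sub>F n in sequentially. \<forall>x\<in>space (M n). P n x"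
  shows "whp M P"
  unfolding whp_def whp_level_def
proof (intro allI impI)
  fix \<epsilon> :: real assume "\<epsilon> > 0"
  from assms show "\<forall>\<^sub>F n in sequentially. \<exists>A\<in>sets (M n). (\<forall>x\<in>A. P n x) \<and> 1 - \<epsilon> \<le> measure (M n) A"
    by eventually_elim (use \<open>\<epsilon> > 0\<close> in \<open>auto simp: prob_space.prob_space intro!: bexI[of _ "space _"]\<close>)
qed

lemma whp_ball:
  assumes M: "\<forall>\<^sub>F n in sequentially. prob_space (M n)" and J: "finite J"
    and P: "\<And>j. j \<in> J \<Longrightarrow> whp M (P j)"
  shows "whp M (\<lambda>n x. \<forall>j\<in>J. P j n x)"
  using J P
proof (induction J rule: finite_induct)
  case empty
  then show ?case using M by (intro whp_True) auto
next
  case (insert j J)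
  then have "whp M (\<lambda>n x. P j n x \<and> (\<forall>j\<in>J. P j n x))" by (intro whp_conj[OF M]) auto
  then show ?case by simp
qed

lemma whp_AE:
  assumes M: "\<forall>\<^sub>F n in sequentially. prob_space (M n)" and P: "\<forall>\<^sub>F n in sequentially. AE x in M n. P n x"
  shows "whp M P"
  unfolding whp_def whp_level_def
proof (intro allI impI)
  fix \<epsilon> :: real assume "\<epsilon> > 0"
  from assms show "\<forall>\<^sub>F n in sequentially. \<exists>A\<in>sets (M n). (\<forall>x\<in>A. P n x) \<and> 1 - \<epsilon> \<le> measure (M n) A"
  proof eventually_elim
    case (elim n)
    interpret prob_space "M n" by (rule elim(1))
    obtain N where N: "{x \<in> space (M n). \<not> P n x} \<subseteq> N" "emeasure (M n) N = 0" "N \<in> events"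
      using AE_E[OF elim(2)] by blast
    have "prob (space (M n) - N) = 1" using prob_compl[OF N(3)] N(2) by (simp add: measure_def)
    then show ?case using N \<open>\<epsilon> > 0\<close> by (intro bexI[of _ "space (M n) - N"]) auto
  qed
qed

text \<open>\<open>plim\<close> does not assert that the events are measurable. As
  \<open>measure\<close> is 0 outside the sigma-algebra, a value above \<open>1 - d > 0\<close>
  proves it; hence \<open>d\<close> is capped at \<open>1 / 2\<close>.\<close>

lemma whp_plim:
  assumes "plim M f L" "open U" "L \<in> U"
  shows "whp M (\<lambda>n x. ereal (f n x) \<in> U)"
  unfolding whp_def whp_level_def
proof (intro allI impI)
  fix \<epsilon> :: real assume e: "\<epsilon> > 0"
  define d where "d = min \<epsilon> (1 / 2)"
  have d: "d > 0" "d < 1" "d \<le> \<epsilon>" unfolding d_def using e by auto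
  have "(\<lambda>n. measure (M n) {x \<in> space (M n). ereal (f n x) \<in> U}) \<longlonglongrightarrow> 1"
    using assms unfolding plim_def by blast
  then have "\<forall>\<^sub>F n in sequentially. measure (M n) {x \<in> space (M n). ereal (f n x) \<in> U} > 1 - d"
    using d by (intro order_tendstoD(1)) auto
  then show "\<forall>\<^sub>F n in sequentially. \<exists>A\<in>sets (M n). (\<forall>x\<in>A. ereal (f n x) \<in> U) \<and> 1 - \<epsilon> \<le> measure (M n) A"
  proof eventually_elim
    case (elim n)
    then have "{x \<in> space (M n). ereal (f n x) \<in> U} \<in> sets (M n)"
      using measure_notin_sets[of "{x \<in> space (M n). ereal (f n x) \<in> U}" "M n"] d by fastforce
    then show ?case using elim d by (intro bexI[of _ "{x \<in> space (M n). ereal (f n x) \<in> U}"]) auto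
  qed
qed

lemma whp_measure_tendsto:
  assumes M: "\<forall>\<^sub>F n in sequentially. prob_space (M n)" and "whp M P"
    and meas: "\<forall>\<^sub>F n in sequentially. {x \<in> space (M n). P n x} \<in> sets (M n)"
  shows "(\<lambda>n. measure (M n) {x \<in> space (M n). P n x}) \<longlonglongrightarrow> 1"
proof (rule order_tendstoI)
  fix a :: real assume "a > 1"
  then show "\<forall>\<^sub>F n in sequentially. measure (M n) {x \<in> space (M n). P n x} < a"
    using M by (auto elim!: eventually_mono intro: le_less_trans[OF prob_space.prob_le_1])
next
  fix a :: real assume "a < 1"
  then have "whp_level M ((1 - a) / 2) P" using assms(2) by (intro whpD) auto
  with M meas show "\<forall>\<^sub>F n in sequentially. a < measure (M n) {x \<in> space (M n). P n x}"
    unfolding whp_level_def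
  proof eventually_elim
    case (elim n)
    interpret prob_space "M n" by (rule elim(1))
    obtain A where A: "A \<in> events" "\<forall>x\<in>A. P n x" "prob A \<ge> 1 - (1 - a) / 2" using elim(3) by auto
    have "prob A \<le> prob {x \<in> space (M n). P n x}"
      using A sets.sets_into_space[OF A(1)] elim(2) by (intro finite_measure_mono) auto
    then show ?case using A(3) \<open>a < 1\<close> by (simp add: field_simps)
  qed
qed

section \<open>The asymptotic log ratio\<close>

text \<open>At 0 the limit is the derivative of \<open>ln (1 - t)\<close>; elsewhere a quotient of
  continuous functions is at hand.\<close>

lemma log_ratio_isCont:
  assumes "c < 1"
  shows "isCont log_ratio c"
proof (cases "c = 0")
  case True
  have "((\<lambda>t. ln (1 - t)) has_real_derivative - 1) (at 0)"
    by (auto intro!: derivative_eq_intros)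
  then have "((\<lambda>t. (ln (1 - t) - ln (1 - 0)) / (t - 0)) \<longlongrightarrow> - 1) (at (0 :: real))"
    unfolding has_field_derivative_iff .
  then have "((\<lambda>t. ln (1 - t) / t) \<longlongrightarrow> - 1) (at (0 :: real))" by simp
  then have "(log_ratio \<longlongrightarrow> - 1) (at 0)"
    by (rule Lim_transform_eventually) (auto simp: log_ratio_def eventually_at_filter)
  then show ?thesis unfolding True isCont_def by (simp add: log_ratio_def)
next
  case False
  have "isCont (\<lambda>t. ln (1 - t) / t) c" using assms False by (intro continuous_intros) auto
  moreover have "\<forall>\<^sub>F t in nhds c. log_ratio t = ln (1 - t) / t"
    using t1_space_nhds[OF False] by eventually_elim (simp add: log_ratio_def)
  ultimately show ?thesis by (simp cong: isCont_cong)
qed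

text \<open>With \<open>t n\<close> the threshold from Chebyshev's inequality, the expression equals
  \<open>(1 + \<eta>) * (n / (n - q)) * log_ratio (t n)\<close>. Continuity of the extended
  \<open>log_ratio\<close> then covers \<open>c0 = 0\<close> and \<open>c0 > 0\<close>
  together.\<close>

lemma log_ratio_tendsto_sample:
  assumes c0: "c0 < 1" and pn: "(\<lambda>n. real (p n) / real n) \<longlonglongrightarrow> c0"
    and p: "\<forall>\<^sub>F n in sequentially. p n \<ge> 1" and \<eta>: "\<eta> > 0" "(1 + \<eta>) * c0 < 1"
  shows "(\<lambda>n. real n / real (p n) * ln (1 - (1 + \<eta>) * (real (p n) / real (n - q)))) \<longlonglongrightarrow> (1 + \<eta>) * log_ratio ((1 + \<eta>) * c0)"
    and "(\<lambda>n. (1 + \<eta>) * (real (p n) / real (n - q))) \<longlonglongrightarrow> (1 + \<eta>) * c0"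
proof -
  have nq: "(\<lambda>n. real n / real (n - q)) \<longlonglongrightarrow> 1"
  proof -
    have "(\<lambda>n. 1 / (1 - real q / real n)) \<longlonglongrightarrow> 1 / (1 - 0)"
      by (intro tendsto_intros lim_const_over_n) auto
    moreover have "\<forall>\<^sub>F n in sequentially. 1 / (1 - real q / real n) = real n / real (n - q)"
      using eventually_gt_at_top[of q] by eventually_elim (auto simp: field_simps of_nat_diff)
    ultimately have "(\<lambda>n. real n / real (n - q)) \<longlonglongrightarrow> 1 / (1 - 0)" by (rule Lim_transform_eventually)
    then show ?thesis by simp
  qed
  define t where "t n = (1 + \<eta>) * (real (p n) / real (n - q))" for n
  have "(\<lambda>n. (1 + \<eta>) * (real (p n) / real n * (real n / real (n - q)))) \<longlonglongrightarrow> (1 + \<eta>) * (c0 * 1)"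
    by (intro tendsto_intros pn nq)
  moreover have "\<forall>\<^sub>F n in sequentially. (1 + \<eta>) * (real (p n) / real n * (real n / real (n - q))) = t n"
    using eventually_gt_at_top[of 0] by eventually_elim (simp add: t_def)
  ultimately have "t \<longlonglongrightarrow> (1 + \<eta>) * (c0 * 1)" by (rule Lim_transform_eventually)
  then have t: "t \<longlonglongrightarrow> (1 + \<eta>) * c0" by simp
  then show "(\<lambda>n. (1 + \<eta>) * (real (p n) / real (n - q))) \<longlonglongrightarrow> (1 + \<eta>) * c0" unfolding t_def .
  have "(\<lambda>n. log_ratio (t n)) \<longlonglongrightarrow> log_ratio ((1 + \<eta>) * c0)"
    by (rule isCont_tendsto_compose[OF log_ratio_isCont[OF \<eta>(2)] t])
  then have "(\<lambda>n. (1 + \<eta>) * (real n / real (n - q)) * log_ratio (t n)) \<longlonglongrightarrow> (1 + \<eta>) * 1 * log_ratio ((1 + \<eta>) * c0)"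
    by (intro tendsto_intros nq)
  moreover have "\<forall>\<^sub>F n in sequentially. (1 + \<eta>) * (real n / real (n - q)) * log_ratio (t n) = real n / real (p n) * ln (1 - t n)"
    using eventually_gt_at_top[of q] p
  proof eventually_elim
    case (elim n)
    then have "t n > 0" using \<eta>(1) unfolding t_def by simp
    then have "log_ratio (t n) = ln (1 - t n) / t n" unfolding log_ratio_def by simp
    moreover have "e * (a / r) * (L / (e * (b / r))) = a / b * L" if "e > 0" "r > 0" "b > 0" for e a r L b :: real
      using that by (simp add: field_simps)
    from this[of "1 + \<eta>" "real (n - q)" "real (p n)" "real n" "ln (1 - t n)", folded t_def]
    have "(1 + \<eta>) * (real n / real (n - q)) * (ln (1 - t n) / t n) = real n / real (p n) * ln (1 - t n)"
      using elim \<eta>(1) by simp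
    ultimately show ?case by simp
  qed
  ultimately show "(\<lambda>n. real n / real (p n) * ln (1 - (1 + \<eta>) * (real (p n) / real (n - q)))) \<longlonglongrightarrow> (1 + \<eta>) * log_ratio ((1 + \<eta>) * c0)"
    unfolding t_def mult_1_right by (rule Lim_transform_eventually)
qed

text \<open>By continuity as \<open>\<eta>\<close> decreases to 0, the slack in Chebyshev's
  threshold costs as little as desired.\<close>

lemma log_ratio_perturb:
  assumes "0 \<le> c0" "c0 < 1" "\<epsilon> > 0"
  shows "\<exists>\<eta>>0. (1 + \<eta>) * c0 < 1 \<and> (1 + \<eta>) * log_ratio ((1 + \<eta>) * c0) > log_ratio c0 - \<epsilon>"
proof -
  have "((\<lambda>\<eta>. (1 + \<eta>) * log_ratio ((1 + \<eta>) * c0)) \<longlongrightarrow> (1 + 0) * log_ratio ((1 + 0) * c0)) (at_right 0)"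
    using assms by (intro tendsto_intros isCont_tendsto_compose[OF log_ratio_isCont]) auto
  then have 1: "\<forall>\<^sub>F \<eta> in at_right 0. (1 + \<eta>) * log_ratio ((1 + \<eta>) * c0) > log_ratio c0 - \<epsilon>"
    using assms by (intro order_tendstoD(1)) auto
  have "((\<lambda>\<eta>. (1 + \<eta>) * c0) \<longlongrightarrow> (1 + 0) * c0) (at_right 0)" by (intro tendsto_intros)
  then have 2: "\<forall>\<^sub>F \<eta> in at_right 0. (1 + \<eta>) * c0 < 1" using assms by (intro order_tendstoD(2)) auto
  have 3: "\<forall>\<^sub>F \<eta> in at_right (0 :: real). \<eta> > 0" by (simp add: eventually_at_right_less)
  from eventually_conj[OF 3 eventually_conj[OF 1 2]]
  show ?thesis using eventually_happens'[of "at_right (0 :: real)"] by fastforce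
qed

section \<open>Consistency\<close>

locale asymptotic =
  fixes M :: "nat \<Rightarrow> 'a measure" and p :: "nat \<Rightarrow> nat" and S :: "nat \<Rightarrow> real mat"
    and E :: "nat \<Rightarrow> 'a \<Rightarrow> nat \<Rightarrow> nat \<Rightarrow> real" and c :: "nat \<Rightarrow> real" and k :: nat
    and X :: "nat \<Rightarrow> real mat" and Y :: "nat \<Rightarrow> 'a \<Rightarrow> real mat" and jstar :: "nat set"
    and \<Theta> :: "nat \<Rightarrow> real mat" and c0 :: real
  assumes reg: "\<forall>\<^sub>F n in sequentially. regression (M n) n (p n) (S n) (E n) (c n) k (X n) (Y n) jstar (\<Theta> n)"
    and p_over_n: "(\<lambda>n. real (p n) / real n) \<longlonglongrightarrow> c0" and c0: "0 \<le> c0" "c0 < 1"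
    and jstar: "jstar \<subseteq> {..<k}"
begin

abbreviation "V j n x \<equiv> resid_gram (X n) (Y n x) j"

definition "D j n x = ln (det (V j n x)) - ln (det (V jstar n x))"

lemma ev_prob: "\<forall>\<^sub>F n in sequentially. prob_space (M n)"
  using reg by eventually_elim (auto dest!: regression.axioms(1) gaussian_noise.axioms(1))

lemma ev_p: "\<forall>\<^sub>F n in sequentially. p n \<ge> 1 \<and> p n + k \<le> n"
  using reg by eventually_elim (auto dest: regression.p regression.n)

lemma whp_pos_def: "jstar \<subseteq> j \<Longrightarrow> j \<subseteq> {..<k} \<Longrightarrow> whp M (\<lambda>n x. pos_def (p n) (V j n x))"
  using reg by (intro whp_AE[OF ev_prob]) (auto elim!: eventually_mono intro: regression.AE_W_pos_def)

section \<open>Log determinant ratios of overspecified models\<close>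

text \<open>The threshold \<open>t\<close> is left open, and the last hypothesis speaks of every
  \<open>h\<close> with the two tail bounds, so that the lemma serves Chebyshev's threshold of order
  \<open>p / n\<close> as well as Markov's of order \<open>1 / n\<close>. The extra level
  \<open>e\<close> pays for the positive definiteness of two Gram matrices.\<close>

lemma whp_level_D_insert:
  assumes j: "jstar \<subseteq> j" "j \<subseteq> {..<k}" and i: "i < k" "i \<notin> j" and e: "e > 0"
    and t: "\<forall>\<^sub>F n in sequentially. t n < 1"
    and bound: "\<forall>\<^sub>F n in sequentially. \<forall>h\<in>borel_measurable (M n).
      (\<forall>K>0. measure (M n) {x \<in> space (M n). h x \<ge> K} \<le> real (p n) / real (n - card j) / K) \<longrightarrow>
      (\<forall>\<eta>>0. measure (M n) {x \<in> space (M n). h x \<ge> (1 + \<eta>) * (real (p n) / real (n - card j))} \<le> 2 / (\<eta>\<^sup>2 * real (p n))) \<longrightarrow>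
      measure (M n) {x \<in> space (M n). h x \<ge> t n} \<le> \<epsilon>"
  shows "whp_level M (\<epsilon> + e) (\<lambda>n x. D (insert i j) n x \<ge> D j n x + ln (1 - t n))"
proof -
  have ij: "jstar \<subseteq> insert i j" "insert i j \<subseteq> {..<k}" using i j by auto
  have 1: "whp_level M \<epsilon> (\<lambda>n x. det (V j n x) > 0 \<longrightarrow> det (V j n x) * (1 - t n) \<le> det (V (insert i j) n x))"
    unfolding whp_level_def
    using reg bound ev_prob
  proof eventually_elim
    case (elim n)
    interpret regression "M n" n "p n" "S n" "E n" "c n" k "X n" "Y n" jstar "\<Theta> n" by (rule elim(1))
    obtain h where h: "h \<in> borel_measurable (M n)"
      "\<forall>x\<in>space (M n). det (V j n x) \<noteq> 0 \<longrightarrow> det (V (insert i j) n x) = det (V j n x) * (1 - h x)"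
      "\<forall>K>0. prob {x \<in> space (M n). h x \<ge> K} \<le> real (p n) / real (n - card j) / K"
      "\<forall>\<eta>>0. prob {x \<in> space (M n). h x \<ge> (1 + \<eta>) * (real (p n) / real (n - card j))} \<le> 2 / (\<eta>\<^sup>2 * real (p n))"
      using W_insert[OF j i] by blast
    define A where "A = {x \<in> space (M n). h x \<ge> t n}"
    have A: "A \<in> events" unfolding A_def using h(1) by measurable
    have "prob A \<le> \<epsilon>" unfolding A_def using elim(2) h by blast
    then have "prob (space (M n) - A) \<ge> 1 - \<epsilon>" using prob_compl[OF A] by simp
    moreover have "det (V j n x) * (1 - t n) \<le> det (V (insert i j) n x)"
      if x: "x \<in> space (M n) - A" and d: "det (V j n x) > 0" for x
    proof -
      have "\<not> t n \<le> h x" using x unfolding A_def by blast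
      then have "h x \<le> t n" by simp
      then have "det (V j n x) * (1 - t n) \<le> det (V j n x) * (1 - h x)" using d by simp
      then show ?thesis using h(2) x d by simp
    qed
    ultimately show ?case using sets.compl_sets[OF A] by blast
  qed
  have 2: "whp_level M (e / 2) (\<lambda>n x. pos_def (p n) (V j n x))" "whp_level M (e / 2) (\<lambda>n x. pos_def (p n) (V (insert i j) n x))"
    using whp_pos_def[OF j] whp_pos_def[OF ij] e by (auto intro: whpD)
  have "whp_level M (\<epsilon> + (e / 2 + e / 2)) (\<lambda>n x. D (insert i j) n x \<ge> D j n x + ln (1 - t n))"
  proof (rule whp_level_mono[OF whp_level_conj[OF ev_prob 1 whp_level_conj[OF ev_prob 2]]])
    show "\<forall>\<^sub>F n in sequentially. \<forall>x\<in>space (M n).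
      (0 < det (V j n x) \<longrightarrow> det (V j n x) * (1 - t n) \<le> det (V (insert i j) n x)) \<and>
      pos_def (p n) (V j n x) \<and> pos_def (p n) (V (insert i j) n x) \<longrightarrow> D j n x + ln (1 - t n) \<le> D (insert i j) n x"
      using t
    proof (eventually_elim, intro ballI impI)
      fix n x
      assume t: "t n < 1" and a: "(0 < det (V j n x) \<longrightarrow> det (V j n x) * (1 - t n) \<le> det (V (insert i j) n x)) \<and>
        pos_def (p n) (V j n x) \<and> pos_def (p n) (V (insert i j) n x)"
      have d: "det (V j n x) > 0" using a pos_def_det by blast
      have "ln (det (V j n x)) + ln (1 - t n) = ln (det (V j n x) * (1 - t n))"
        using d t by (intro ln_mult_pos[symmetric]) auto
      also have "\<dots> \<le> ln (det (V (insert i j) n x))"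
        using a d t by (intro ln_mono) auto
      finally show "D j n x + ln (1 - t n) \<le> D (insert i j) n x" unfolding D_def by simp
    qed
  qed
  then show ?thesis by simp
qed

text \<open>Columns are added one at a time. Each contributes \<open>log_ratio c0\<close> on the
  scale \<open>p\<close>, up to half of the error that is left.\<close>

lemma D_overfit_high_dim:
  assumes p: "filterlim p at_top sequentially" and A: "finite A" "A \<subseteq> {..<k} - jstar" and \<epsilon>: "\<epsilon> > 0"
  shows "whp M (\<lambda>n x. real n * D (jstar \<union> A) n x \<ge> real (p n) * (real (card A) * log_ratio c0 - \<epsilon>))"
  using A \<epsilon>
proof (induction A arbitrary: \<epsilon> rule: finite_induct)
  case empty
  then show ?case by (intro whp_True[OF ev_prob] always_eventually) (simp add: D_def)
next
  case (insert i A)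
  let ?j = "jstar \<union> A"
  have j: "jstar \<subseteq> ?j" "?j \<subseteq> {..<k}" "i < k" "i \<notin> ?j" using insert jstar by auto
  obtain \<eta> where \<eta>: "\<eta> > 0" "(1 + \<eta>) * c0 < 1" "(1 + \<eta>) * log_ratio ((1 + \<eta>) * c0) > log_ratio c0 - \<epsilon> / 2"
    using log_ratio_perturb[OF c0, of "\<epsilon> / 2"] insert.prems by auto
  define t where "t n = (1 + \<eta>) * (real (p n) / real (n - card ?j))" for n
  have p1: "\<forall>\<^sub>F n in sequentially. p n \<ge> 1" using ev_p by eventually_elim simp
  note lim = log_ratio_tendsto_sample[OF c0(2) p_over_n p1 \<eta>(1,2), of "card ?j", folded t_def]
  have t1: "\<forall>\<^sub>F n in sequentially. t n < 1" by (rule order_tendstoD(2)[OF lim(2) \<eta>(2)])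
  have lr: "\<forall>\<^sub>F n in sequentially. real n / real (p n) * ln (1 - t n) > log_ratio c0 - \<epsilon> / 2"
    by (rule order_tendstoD(1)[OF lim(1) \<eta>(3)])
  have "whp M (\<lambda>n x. D (insert i ?j) n x \<ge> D ?j n x + ln (1 - t n))"
    unfolding whp_def
  proof (intro allI impI)
    fix e :: real assume e: "e > 0"
    \<comment> \<open>The exceptional probability in Chebyshev's inequality vanishes because
      \<open>p\<close> diverges.\<close>
    have "(\<lambda>n. 2 / (\<eta>\<^sup>2 * real (p n))) \<longlonglongrightarrow> 0"
      using p \<eta>(1) by (intro tendsto_divide_0[OF tendsto_const] filterlim_at_top_imp_at_infinity
        filterlim_tendsto_pos_mult_at_top[OF tendsto_const] filterlim_compose[OF filterlim_real_sequentially]) auto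
    then have "\<forall>\<^sub>F n in sequentially. 2 / (\<eta>\<^sup>2 * real (p n)) < e / 2" using e by (intro order_tendstoD(2)) auto
    then have "whp_level M (e / 2 + e / 2) (\<lambda>n x. D (insert i ?j) n x \<ge> D ?j n x + ln (1 - t n))"
      using e by (intro whp_level_D_insert[OF j _ t1])
        (auto elim!: eventually_mono simp: t_def intro: order.trans[OF _ less_imp_le] \<eta>(1))
    then show "whp_level M e (\<lambda>n x. D (insert i ?j) n x \<ge> D ?j n x + ln (1 - t n))" by simp
  qed
  moreover have "whp M (\<lambda>n x. real n * D ?j n x \<ge> real (p n) * (real (card A) * log_ratio c0 - \<epsilon> / 2))"
    using insert by auto
  ultimately have "whp M (\<lambda>n x. D (insert i ?j) n x \<ge> D ?j n x + ln (1 - t n) \<and>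
      real n * D ?j n x \<ge> real (p n) * (real (card A) * log_ratio c0 - \<epsilon> / 2))"
    by (rule whp_conj[OF ev_prob])
  then have "whp M (\<lambda>n x. real n * D (insert i ?j) n x \<ge> real (p n) * (real (card (insert i A)) * log_ratio c0 - \<epsilon>))"
  proof (rule whp_mono)
    show "\<forall>\<^sub>F n in sequentially. \<forall>x\<in>space (M n). D (insert i ?j) n x \<ge> D ?j n x + ln (1 - t n) \<and>
      real n * D ?j n x \<ge> real (p n) * (real (card A) * log_ratio c0 - \<epsilon> / 2) \<longrightarrow>
      real n * D (insert i ?j) n x \<ge> real (p n) * (real (card (insert i A)) * log_ratio c0 - \<epsilon>)"
      using lr p1
    proof (eventually_elim, intro ballI impI, elim conjE)
      fix n x
      assume a: "log_ratio c0 - \<epsilon> / 2 < real n / real (p n) * ln (1 - t n)" and p1: "1 \<le> p n"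
        and b: "D ?j n x + ln (1 - t n) \<le> D (insert i ?j) n x"
          "real (p n) * (real (card A) * log_ratio c0 - \<epsilon> / 2) \<le> real n * D ?j n x"
      have "real (p n) * (log_ratio c0 - \<epsilon> / 2) \<le> real (p n) * (real n / real (p n) * ln (1 - t n))"
        using a p1 by (intro mult_left_mono) auto
      also have "\<dots> = real n * ln (1 - t n)" using p1 by simp
      finally have 1: "real (p n) * (log_ratio c0 - \<epsilon> / 2) \<le> real n * ln (1 - t n)" .
      have "real n * (D ?j n x + ln (1 - t n)) \<le> real n * D (insert i ?j) n x"
        using b(1) by (intro mult_left_mono) auto
      then have "real (p n) * (real (card A) * log_ratio c0 - \<epsilon> / 2) + real (p n) * (log_ratio c0 - \<epsilon> / 2) \<le> real n * D (insert i ?j) n x"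
        using 1 b(2) by (simp add: distrib_left)
      moreover have "real (card (insert i A)) = real (card A) + 1" using insert by simp
      ultimately show "real (p n) * (real (card (insert i A)) * log_ratio c0 - \<epsilon>) \<le> real n * D (insert i ?j) n x"
        by (simp add: algebra_simps)
    qed
  qed
  then show ?case by simp
qed

text \<open>For bounded \<open>p\<close> the leverage is known to be of order \<open>1 / n\<close>
  only through its mean. So \<open>n D\<close> is merely bounded below at each level, by a constant
  that depends on \<open>\<epsilon>\<close>.\<close>

lemma D_overfit_large_sample:
  assumes p: "\<And>n. p n \<le> P" and A: "finite A" "A \<subseteq> {..<k} - jstar" and \<epsilon>: "\<epsilon> > 0"
  shows "\<exists>K>0. whp_level M \<epsilon> (\<lambda>n x. real n * D (jstar \<union> A) n x \<ge> - K)"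
  using A \<epsilon>
proof (induction A arbitrary: \<epsilon> rule: finite_induct)
  case empty
  have "whp M (\<lambda>n x. real n * D (jstar \<union> {}) n x \<ge> - 1)"
    by (intro whp_True[OF ev_prob] always_eventually) (simp add: D_def)
  then show ?case using empty by (intro exI[of _ 1]) (auto dest: whpD)
next
  case (insert i A)
  let ?j = "jstar \<union> A"
  have j: "jstar \<subseteq> ?j" "?j \<subseteq> {..<k}" "i < k" "i \<notin> ?j" using insert jstar by auto
  have e: "\<epsilon> / 3 > 0" using insert by simp
  obtain K where K: "K > 0" "whp_level M (\<epsilon> / 3) (\<lambda>n x. real n * D ?j n x \<ge> - K)"
    using insert.IH[of "\<epsilon> / 3"] insert.prems by auto
  \<comment> \<open>Makes Markov's bound at most \<open>\<epsilon> / 3\<close> once \<open>n\<close>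
    exceeds twice the size of the model: the factor 2 absorbs \<open>n / (n - card ?j)\<close>, and
    \<open>P + 1\<close> keeps \<open>L\<close> positive for \<open>P = 0\<close>.\<close>
  define L where "L = 2 * (real P + 1) / (\<epsilon> / 3)"
  have L: "L > 0" unfolding L_def using e by simp
  define t where "t n = L / real n" for n
  have tlim: "t \<longlonglongrightarrow> 0" unfolding t_def by (rule lim_const_over_n)
  have t2: "\<forall>\<^sub>F n in sequentially. t n < 1 / 2" by (rule order_tendstoD(2)[OF tlim]) simp
  have t1: "\<forall>\<^sub>F n in sequentially. t n < 1" using t2 by eventually_elim simp
  have bd: "\<forall>\<^sub>F n in sequentially. real (p n) / real (n - card ?j) / t n \<le> \<epsilon> / 3 \<and> t n > 0"
    using eventually_gt_at_top[of "2 * card ?j"]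
  proof eventually_elim
    case (elim n)
    then have n: "real n > 0" "real (n - card ?j) > 0" "real n \<le> 2 * real (n - card ?j)" by (auto simp: of_nat_diff)
    have "real (p n) / real (n - card ?j) / t n = real (p n) * (real n / real (n - card ?j)) / L"
      unfolding t_def using n L by simp
    also have "\<dots> \<le> (real P + 1) * 2 / L"
      using n L p[of n] by (intro divide_right_mono mult_mono) (auto simp: field_simps)
    also have "\<dots> = \<epsilon> / 3"
    proof -
      have "a * 2 / (2 * a / b) = b" if "a > 0" for a b :: real using that by simp
      from this[of "real P + 1" "\<epsilon> / 3"] show ?thesis unfolding L_def by simp
    qed
    finally show ?case using n L by (simp add: t_def)
  qed
  have "whp_level M (\<epsilon> / 3 + \<epsilon> / 3) (\<lambda>n x. D (insert i ?j) n x \<ge> D ?j n x + ln (1 - t n))"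
  proof (rule whp_level_D_insert[OF j e t1])
    show "\<forall>\<^sub>F n in sequentially. \<forall>h\<in>borel_measurable (M n).
      (\<forall>K>0. measure (M n) {x \<in> space (M n). h x \<ge> K} \<le> real (p n) / real (n - card ?j) / K) \<longrightarrow>
      (\<forall>\<eta>>0. measure (M n) {x \<in> space (M n). h x \<ge> (1 + \<eta>) * (real (p n) / real (n - card ?j))} \<le> 2 / (\<eta>\<^sup>2 * real (p n))) \<longrightarrow>
      measure (M n) {x \<in> space (M n). h x \<ge> t n} \<le> \<epsilon> / 3"
      using bd by eventually_elim (blast intro: order.trans)
  qed
  from whp_level_conj[OF ev_prob this K(2)]
  have "whp_level M (\<epsilon> / 3 + \<epsilon> / 3 + \<epsilon> / 3) (\<lambda>n x. real n * D (insert i ?j) n x \<ge> - (K + 2 * L))"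
  proof (rule whp_level_mono)
    show "\<forall>\<^sub>F n in sequentially. \<forall>x\<in>space (M n). D (insert i ?j) n x \<ge> D ?j n x + ln (1 - t n) \<and>
      real n * D ?j n x \<ge> - K \<longrightarrow> real n * D (insert i ?j) n x \<ge> - (K + 2 * L)"
      using t2 eventually_gt_at_top[of 0]
    proof (eventually_elim, intro ballI impI, elim conjE)
      fix n :: nat and x
      assume t2: "t n < 1 / 2" and n: "0 < n" and b: "D ?j n x + ln (1 - t n) \<le> D (insert i ?j) n x" "- K \<le> real n * D ?j n x"
      have t0: "t n \<ge> 0" unfolding t_def using L by simp
      \<comment> \<open>For \<open>t n < 1 / 2\<close> this gives
        \<open>ln (1 - t n) \<ge> - 2 * t n\<close>, which is a loss of \<open>2 * L\<close> after
        multiplication by \<open>n\<close>.\<close>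
      have "- t n - 2 * (t n)\<^sup>2 \<le> ln (1 - t n)" using t0 t2 by (intro ln_one_minus_pos_lower_bound) auto
      moreover have "(t n)\<^sup>2 \<le> t n * (1 / 2)" unfolding power2_eq_square using t0 t2 by (intro mult_left_mono) auto
      ultimately have "- 2 * t n \<le> ln (1 - t n)" by simp
      then have "real n * (- 2 * t n) \<le> real n * ln (1 - t n)" by (intro mult_left_mono) auto
      moreover have "real n * (- 2 * t n) = - 2 * L" unfolding t_def using n by simp
      moreover have "real n * (D ?j n x + ln (1 - t n)) \<le> real n * D (insert i ?j) n x"
        using b(1) by (intro mult_left_mono) auto
      ultimately show "- (K + 2 * L) \<le> real n * D (insert i ?j) n x" using b(2) by (simp add: distrib_left)
    qed
  qed
  then show ?case using K(1) L by (intro exI[of _ "K + 2 * L"]) auto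
qed

section \<open>Log determinant ratios of underspecified models\<close>

text \<open>The least eigenvalue is eventually at least \<open>l = \<delta> n p\<close>, so the
  compressed noise has total squared length of order \<open>1 / p\<close>. Choosing
  \<open>K = \<kappa> / p\<close> gives each direction of the signal the factor
  \<open>1 + p / (4 \<kappa>)\<close>.\<close>

lemma D_underfit:
  assumes j: "j \<subseteq> {..<k}" and g: "g > 0" and \<epsilon>: "\<epsilon> > 0"
    and G: "\<forall>\<^sub>F n in sequentially. full_rank_factor (p n) g (noncentrality (X n) jstar (\<Theta> n) (S n) j) (G n)"
    and lim: "liminf (\<lambda>n. ereal (min_eigenvalue ((G n)\<^sup>T * G n) / (real n * real (p n)))) > 0"
  shows "\<exists>\<kappa>>0. whp_level M \<epsilon> (\<lambda>n x. det (V j n x) > 0 \<and>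
    D j n x \<ge> D (j \<union> jstar) n x + real g * ln (1 + real (p n) / (4 * \<kappa>)))"
proof -
  let ?j' = "j \<union> jstar"
  have j': "jstar \<subseteq> ?j'" "?j' \<subseteq> {..<k}" using j jstar by auto
  obtain \<delta> where "0 < ereal \<delta>" and \<delta>2: "ereal \<delta> < liminf (\<lambda>n. ereal (min_eigenvalue ((G n)\<^sup>T * G n) / (real n * real (p n))))"
    using ereal_dense2[OF lim] by auto
  then have \<delta>: "\<delta> > 0" by simp
  have ev\<delta>: "\<forall>\<^sub>F n in sequentially. \<delta> < min_eigenvalue ((G n)\<^sup>T * G n) / (real n * real (p n))"
    using less_LiminfD[OF \<delta>2] by simp
  \<comment> \<open>Makes \<open>8 n g / (l K) = 8 g / (\<delta> \<kappa>)\<close> equal to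
    \<open>\<epsilon> / 4\<close>. The other error term is at most a constant divided by
    \<open>n\<close>.\<close>
  define \<kappa> where "\<kappa> = 32 * real g / (\<delta> * \<epsilon>)"
  have \<kappa>: "\<kappa> > 0" unfolding \<kappa>_def using g \<delta> \<epsilon> by simp
  have "(\<lambda>n. (32 * real k * real g / \<delta>) / real n) \<longlonglongrightarrow> 0" by (rule lim_const_over_n)
  then have evn: "\<forall>\<^sub>F n in sequentially. (32 * real k * real g / \<delta>) / real n < \<epsilon> / 4"
    using \<epsilon> by (intro order_tendstoD(2)) auto
  have 1: "whp_level M (\<epsilon> / 2) (\<lambda>n x. pos_def (p n) (V ?j' n x) \<longrightarrow>
      det (V ?j' n x) * (1 + real (p n) / (4 * \<kappa>)) ^ g \<le> det (V j n x))"
    unfolding whp_level_def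
    using reg G ev\<delta> evn ev_p
  proof eventually_elim
    case (elim n)
    interpret regression "M n" n "p n" "S n" "E n" "c n" k "X n" "Y n" jstar "\<Theta> n" by (rule elim(1))
    have np: "real n > 0" "real (p n) \<ge> 1" using elim(5) by auto
    define l where "l = \<delta> * (real n * real (p n))"
    have l: "l > 0" unfolding l_def using \<delta> np by simp
    have l2: "l \<le> min_eigenvalue ((G n)\<^sup>T * G n)" unfolding l_def using elim(3) np by (simp add: field_simps)
    define K where "K = \<kappa> / real (p n)"
    have K: "K > 0" unfolding K_def using \<kappa> np by simp
    obtain A where A: "A \<in> events" "prob A \<ge> 1 - (32 * real k * real g / l + 8 * real n * real g / (l * K))"
      "\<forall>x\<in>A. pos_def (p n) (V ?j' n x) \<longrightarrow> det (V ?j' n x) * (1 + 1 / (4 * K)) ^ g \<le> det (V j n x)"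
      using W_underfit[OF j g elim(2) l l2 K] by blast
    have "32 * real k * real g / l = (32 * real k * real g / \<delta>) / real n / real (p n)"
      unfolding l_def by simp
    also have "\<dots> \<le> (32 * real k * real g / \<delta>) / real n / 1"
      using np \<delta> by (intro divide_left_mono) auto
    finally have a: "32 * real k * real g / l \<le> \<epsilon> / 4" using elim(4) by simp
    have "l * K = \<delta> * real n * \<kappa>" unfolding l_def K_def using np by simp
    then have b: "8 * real n * real g / (l * K) = \<epsilon> / 4"
    proof -
      have "8 * a * b / (d * a * (32 * b / (d * e))) = e / 4" if "a > 0" "b > 0" "d > 0" for a b d e :: real
        using that by (cases "e = 0") (simp_all add: field_simps)
      from this[of "real n" "real g" \<delta> \<epsilon>] show ?thesis
        unfolding \<open>l * K = \<delta> * real n * \<kappa>\<close> \<kappa>_def using np \<delta> g by simp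
    qed
    have "1 / (4 * K) = real (p n) / (4 * \<kappa>)" unfolding K_def by simp
    moreover have "prob A \<ge> 1 - \<epsilon> / 2" using A(2) a b by linarith
    ultimately show ?case using A(1,3) by auto
  qed
  have 2: "whp_level M (\<epsilon> / 2) (\<lambda>n x. pos_def (p n) (V ?j' n x))"
    using whp_pos_def[OF j'] \<epsilon> by (intro whpD) auto
  have "whp_level M (\<epsilon> / 2 + \<epsilon> / 2) (\<lambda>n x. det (V j n x) > 0 \<and> D j n x \<ge> D ?j' n x + real g * ln (1 + real (p n) / (4 * \<kappa>)))"
  proof (rule whp_level_mono[OF whp_level_conj[OF ev_prob 1 2]], intro always_eventually allI ballI impI, elim conjE)
    fix n x
    assume a: "pos_def (p n) (V ?j' n x) \<longrightarrow> det (V ?j' n x) * (1 + real (p n) / (4 * \<kappa>)) ^ g \<le> det (V j n x)"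
      and pd: "pos_def (p n) (V ?j' n x)"
    have d: "det (V ?j' n x) > 0" by (rule pos_def_det[OF pd])
    define r where "r = 1 + real (p n) / (4 * \<kappa>)"
    have r: "r > 0" unfolding r_def using \<kappa> by (simp add: add_pos_nonneg)
    have le: "det (V ?j' n x) * r ^ g \<le> det (V j n x)" using a pd unfolding r_def by simp
    have pos: "det (V ?j' n x) * r ^ g > 0" using d r by simp
    have "ln (det (V ?j' n x)) + real g * ln r = ln (det (V ?j' n x) * r ^ g)"
      using d r by (simp add: ln_mult_pos ln_realpow)
    also have "\<dots> \<le> ln (det (V j n x))" using le pos by (intro ln_mono) auto
    finally show "0 < det (V j n x) \<and> D ?j' n x + real g * ln (1 + real (p n) / (4 * \<kappa>)) \<le> D j n x"
      using le pos unfolding D_def r_def by simp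
  qed
  then show ?thesis using \<kappa> by auto
qed

section \<open>Comparison of the criteria in the two regimes\<close>

lemma whp_IC_less:
  assumes j: "j \<subseteq> {..<k}"
    and w: "whp M (\<lambda>n x. det (V j n x) > 0 \<and> real n * D j n x + (m n x j - m n x jstar) > 0)"
  shows "whp M (\<lambda>n x. IC (X n) (Y n x) (m n x) jstar < IC (X n) (Y n x) (m n x) j)"
proof (rule whp_mono[OF whp_conj[OF ev_prob w whp_pos_def[OF subset_refl jstar]]])
  show "\<forall>\<^sub>F n in sequentially. \<forall>x\<in>space (M n).
    (0 < det (V j n x) \<and> 0 < real n * D j n x + (m n x j - m n x jstar)) \<and> pos_def (p n) (V jstar n x) \<longrightarrow>
    IC (X n) (Y n x) (m n x) jstar < IC (X n) (Y n x) (m n x) j"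
    using reg
  proof (eventually_elim, intro ballI impI, elim conjE)
    fix n x
    assume r: "regression (M n) n (p n) (S n) (E n) (c n) k (X n) (Y n) jstar (\<Theta> n)" and x: "x \<in> space (M n)"
      and d: "0 < det (V j n x)" and a: "0 < real n * D j n x + (m n x j - m n x jstar)" and pd: "pos_def (p n) (V jstar n x)"
    have ds: "det (V jstar n x) > 0" by (rule pos_def_det[OF pd])
    show "IC (X n) (Y n x) (m n x) jstar < IC (X n) (Y n x) (m n x) j"
      unfolding regression.IC_eq[OF r x d] regression.IC_eq[OF r x ds]
      using a unfolding D_def by (simp add: right_diff_distrib)
  qed
qed

lemma card_overfit: "jstar \<subseteq> j \<Longrightarrow> j \<subseteq> {..<k} \<Longrightarrow> real (card (j - jstar)) = real (card j) - real (card jstar)"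
  using card_mono[of j jstar] card_Diff_subset[of jstar j] finite_subset[of j "{..<k}"] finite_subset[of jstar j]
  by (auto simp: of_nat_diff)

lemma det_pos_overfit:
  assumes "jstar \<subseteq> j" "j \<subseteq> {..<k}"
  shows "whp M (\<lambda>n x. det (V j n x) > 0)"
  by (rule whp_mono[OF whp_pos_def[OF assms]]) (auto intro!: always_eventually pos_def_det)

lemma overfit_high_dim:
  assumes p: "filterlim p at_top sequentially" and j: "jstar \<subseteq> j" "j \<subseteq> {..<k}"
    and L: "L > ereal (- (real (card j) - real (card jstar)) * log_ratio c0)"
    and pl: "plim M (\<lambda>n x. (m n x j - m n x jstar) / real (p n)) L"
  shows "whp M (\<lambda>n x. det (V j n x) > 0 \<and> real n * D j n x + (m n x j - m n x jstar) > 0)"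
proof -
  define q where "q = real (card j) - real (card jstar)"
  obtain r where r: "- q * log_ratio c0 < r" "ereal r < L"
    using ereal_dense2[OF L] unfolding q_def by auto
  \<comment> \<open>Half of the gap between the penalty and the cost of the added columns; the other
    half remains as the margin \<open>p * e\<close>.\<close>
  define e where "e = (r + q * log_ratio c0) / 2"
  have e: "e > 0" unfolding e_def using r(1) by simp
  have "jstar \<union> (j - jstar) = j" using j by auto
  then have 1: "whp M (\<lambda>n x. real n * D j n x \<ge> real (p n) * (q * log_ratio c0 - e))"
    using D_overfit_high_dim[OF p, of "j - jstar" e] j e card_overfit[OF j] finite_subset[OF j(2)]
    unfolding q_def by auto
  have 2: "whp M (\<lambda>n x. ereal ((m n x j - m n x jstar) / real (p n)) \<in> {ereal r<..})"
    using r(2) by (intro whp_plim[OF pl]) auto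
  have p1: "\<forall>\<^sub>F n in sequentially. p n \<ge> 1" using ev_p by eventually_elim simp
  show ?thesis
  proof (rule whp_mono[OF whp_conj[OF ev_prob det_pos_overfit[OF j] whp_conj[OF ev_prob 1 2]]])
    show "\<forall>\<^sub>F n in sequentially. \<forall>x\<in>space (M n). 0 < det (V j n x) \<and>
      real (p n) * (q * log_ratio c0 - e) \<le> real n * D j n x \<and>
      ereal ((m n x j - m n x jstar) / real (p n)) \<in> {ereal r<..} \<longrightarrow>
      0 < det (V j n x) \<and> 0 < real n * D j n x + (m n x j - m n x jstar)"
      using p1
    proof (eventually_elim, intro ballI impI, elim conjE, intro conjI)
      fix n x
      assume p1: "1 \<le> p n" and a: "real (p n) * (q * log_ratio c0 - e) \<le> real n * D j n x"
        and b: "ereal ((m n x j - m n x jstar) / real (p n)) \<in> {ereal r<..}"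
      have "m n x j - m n x jstar > r * real (p n)" using b p1 by (simp add: field_simps)
      moreover have "real (p n) * (q * log_ratio c0 - e) + r * real (p n) = real (p n) * e"
        unfolding e_def by (simp add: field_simps)
      moreover have "real (p n) * e > 0" using e p1 by simp
      ultimately show "0 < real n * D j n x + (m n x j - m n x jstar)" using a by linarith
    qed
  qed
qed

lemma overfit_large_sample:
  assumes p: "\<And>n. p n \<le> P" and j: "jstar \<subseteq> j" "j \<subseteq> {..<k}"
    and pl: "plim M (\<lambda>n x. m n x j - m n x jstar) \<infinity>"
  shows "whp M (\<lambda>n x. det (V j n x) > 0 \<and> real n * D j n x + (m n x j - m n x jstar) > 0)"
  unfolding whp_def
proof (intro allI impI)
  fix \<epsilon> :: real assume e: "\<epsilon> > 0"
  have jj: "jstar \<union> (j - jstar) = j" using j by auto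
  obtain K where K: "whp_level M (\<epsilon> / 3) (\<lambda>n x. real n * D j n x \<ge> - K)"
    using D_overfit_large_sample[OF p, of "j - jstar" "\<epsilon> / 3"] j e finite_subset[OF j(2)] unfolding jj by auto
  have 2: "whp M (\<lambda>n x. ereal (m n x j - m n x jstar) \<in> {ereal K<..})"
    by (intro whp_plim[OF pl]) auto
  have "whp_level M (\<epsilon> / 3 + (\<epsilon> / 3 + \<epsilon> / 3)) (\<lambda>n x. det (V j n x) > 0 \<and> real n * D j n x + (m n x j - m n x jstar) > 0)"
  proof (rule whp_level_mono[OF whp_level_conj[OF ev_prob K whp_level_conj[OF ev_prob whpD[OF det_pos_overfit[OF j]] whpD[OF 2]]]])
  qed (use e in \<open>auto intro!: always_eventually\<close>)
  then show "whp_level M \<epsilon> (\<lambda>n x. det (V j n x) > 0 \<and> real n * D j n x + (m n x j - m n x jstar) > 0)" by simp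
qed

text \<open>On the scale \<open>n * ln p\<close> the log ratio gains \<open>g\<close>, while the
  penalty difference stays above some \<open>r > - g\<close>. Everything else is at most of order
  \<open>n\<close>: the constant \<open>\<kappa>\<close>, and the passage to the larger model, whose
  cost is a multiple of \<open>p \<le> n\<close>.\<close>

lemma underfit_high_dim:
  assumes p: "filterlim p at_top sequentially" and j: "j \<subseteq> {..<k}" and g: "g > 0"
    and G: "\<forall>\<^sub>F n in sequentially. full_rank_factor (p n) g (noncentrality (X n) jstar (\<Theta> n) (S n) j) (G n)"
    and lim: "liminf (\<lambda>n. ereal (min_eigenvalue ((G n)\<^sup>T * G n) / (real n * real (p n)))) > 0"
    and L: "L > - ereal (real g)"
    and pl: "plim M (\<lambda>n x. (m n x j - m n x jstar) / (real n * ln (real (p n)))) L"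
  shows "whp M (\<lambda>n x. det (V j n x) > 0 \<and> real n * D j n x + (m n x j - m n x jstar) > 0)"
  unfolding whp_def
proof (intro allI impI)
  fix \<epsilon> :: real assume e: "\<epsilon> > 0"
  let ?j' = "j \<union> jstar"
  have j': "jstar \<subseteq> ?j'" "?j' \<subseteq> {..<k}" "jstar \<union> (?j' - jstar) = ?j'" using j jstar by auto
  obtain r where r: "- real g < r" "ereal r < L" using ereal_dense2[OF L] by auto
  obtain \<kappa> where \<kappa>: "\<kappa> > 0" "whp_level M (\<epsilon> / 3) (\<lambda>n x. det (V j n x) > 0 \<and>
      D j n x \<ge> D ?j' n x + real g * ln (1 + real (p n) / (4 * \<kappa>)))"
    using D_underfit[OF j g _ G lim, of "\<epsilon> / 3"] e by auto
  define q where "q = real (card (?j' - jstar))"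
  have 1: "whp M (\<lambda>n x. real n * D ?j' n x \<ge> real (p n) * (q * log_ratio c0 - 1))"
    using D_overfit_high_dim[OF p, of "?j' - jstar" 1] j' finite_subset[OF j'(2)] unfolding q_def by auto
  have 2: "whp M (\<lambda>n x. ereal ((m n x j - m n x jstar) / (real n * ln (real (p n)))) \<in> {ereal r<..})"
    using r(2) by (intro whp_plim[OF pl]) auto
  define b where "b = \<bar>q * log_ratio c0 - 1\<bar>"
  have "filterlim (\<lambda>n. ln (real (p n))) at_top sequentially"
    by (intro filterlim_compose[OF ln_at_top] filterlim_compose[OF filterlim_real_sequentially p])
  then have "filterlim (\<lambda>n. (real g + r) * ln (real (p n))) at_top sequentially"
    using r(1) by (intro filterlim_tendsto_pos_mult_at_top[OF tendsto_const]) auto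
  then have ev: "\<forall>\<^sub>F n in sequentially. (real g + r) * ln (real (p n)) > real g * ln (4 * \<kappa>) + b"
    by (rule filterlim_at_top_dense[THEN iffD1, rule_format])
  \<comment> \<open>\<open>ln p\<close> has to be positive before the penalty condition can be
    multiplied by \<open>n * ln p\<close>.\<close>
  have p2: "\<forall>\<^sub>F n in sequentially. p n \<ge> 2" using p by (auto simp: filterlim_at_top)
  have "whp_level M (\<epsilon> / 3 + (\<epsilon> / 3 + \<epsilon> / 3)) (\<lambda>n x. det (V j n x) > 0 \<and> real n * D j n x + (m n x j - m n x jstar) > 0)"
  proof (rule whp_level_mono[OF whp_level_conj[OF ev_prob \<kappa>(2) whp_level_conj[OF ev_prob whpD[OF 1] whpD[OF 2]]]])
    show "\<forall>\<^sub>F n in sequentially. \<forall>x\<in>space (M n). (0 < det (V j n x) \<and>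
      D ?j' n x + real g * ln (1 + real (p n) / (4 * \<kappa>)) \<le> D j n x) \<and>
      real (p n) * (q * log_ratio c0 - 1) \<le> real n * D ?j' n x \<and>
      ereal ((m n x j - m n x jstar) / (real n * ln (real (p n)))) \<in> {ereal r<..} \<longrightarrow>
      0 < det (V j n x) \<and> 0 < real n * D j n x + (m n x j - m n x jstar)"
      using ev p2 ev_p
    proof (eventually_elim, intro ballI impI, elim conjE, intro conjI)
      fix n x
      assume ev: "real g * ln (4 * \<kappa>) + b < (real g + r) * ln (real (p n))" and p2: "2 \<le> p n"
        and n: "p n + k \<le> n"
        and a1: "D ?j' n x + real g * ln (1 + real (p n) / (4 * \<kappa>)) \<le> D j n x"
        and a2: "real (p n) * (q * log_ratio c0 - 1) \<le> real n * D ?j' n x"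
        and a3: "ereal ((m n x j - m n x jstar) / (real n * ln (real (p n)))) \<in> {ereal r<..}"
      have n0: "real n > 0" "real (p n) \<le> real n" using n p2 by auto
      have lp: "ln (real (p n)) > 0" using p2 by simp
      have m: "m n x j - m n x jstar > real n * (r * ln (real (p n)))"
        using a3 n0 lp by (simp add: field_simps)
      have "real (p n) * (q * log_ratio c0 - 1) \<ge> - (real n * b)"
      proof -
        have "real (p n) * (q * log_ratio c0 - 1) \<ge> real (p n) * (- b)" unfolding b_def by (intro mult_left_mono) auto
        moreover have "real (p n) * b \<le> real n * b" using n0 unfolding b_def by (intro mult_right_mono) auto
        ultimately show ?thesis by simp
      qed
      then have D': "real n * D ?j' n x \<ge> - (real n * b)" using a2 by linarith
      have "ln (real (p n)) - ln (4 * \<kappa>) = ln (real (p n) / (4 * \<kappa>))" using p2 \<kappa>(1) by (simp add: ln_div)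
      also have "\<dots> \<le> ln (1 + real (p n) / (4 * \<kappa>))" using p2 \<kappa>(1) by (intro ln_mono) auto
      finally have "real g * (ln (real (p n)) - ln (4 * \<kappa>)) \<le> real g * ln (1 + real (p n) / (4 * \<kappa>))"
        by (intro mult_left_mono) auto
      then have "D ?j' n x + real g * (ln (real (p n)) - ln (4 * \<kappa>)) \<le> D j n x" using a1 by linarith
      then have "real n * (D ?j' n x + real g * (ln (real (p n)) - ln (4 * \<kappa>))) \<le> real n * D j n x"
        using n0 by (intro mult_left_mono) auto
      then have "real n * D j n x \<ge> real n * (real g * (ln (real (p n)) - ln (4 * \<kappa>)) - b)"
        using D' by (simp add: algebra_simps)
      then have "real n * D j n x + (m n x j - m n x jstar) > real n * ((real g + r) * ln (real (p n)) - real g * ln (4 * \<kappa>) - b)"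
        using m by (simp add: algebra_simps)
      moreover have "real n * ((real g + r) * ln (real (p n)) - real g * ln (4 * \<kappa>) - b) > 0"
        using ev n0 by (intro mult_pos_pos) auto
      ultimately show "0 < real n * D j n x + (m n x j - m n x jstar)" by linarith
    qed
  qed (use e in auto)
  then show "whp_level M \<epsilon> (\<lambda>n x. det (V j n x) > 0 \<and> real n * D j n x + (m n x j - m n x jstar) > 0)" by simp
qed

text \<open>The gain is \<open>n * \<delta>\<close> with a fixed \<open>\<delta>\<close>, obtained
  from \<open>p \<ge> 1\<close> and \<open>g \<ge> 1\<close>. The penalty can take away less than
  half of it, as its limit on the scale \<open>n\<close> is nonnegative, and the bounded cost
  \<open>K\<close> of the larger model takes less than the other half.\<close>

lemma underfit_large_sample:
  assumes p: "\<And>n. p n \<le> P" and j: "j \<subseteq> {..<k}" and g: "g > 0"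
    and G: "\<forall>\<^sub>F n in sequentially. full_rank_factor (p n) g (noncentrality (X n) jstar (\<Theta> n) (S n) j) (G n)"
    and lim: "liminf (\<lambda>n. ereal (min_eigenvalue ((G n)\<^sup>T * G n) / (real n * real (p n)))) > 0"
    and L: "L \<ge> 0" and pl: "plim M (\<lambda>n x. (m n x j - m n x jstar) / real n) L"
  shows "whp M (\<lambda>n x. det (V j n x) > 0 \<and> real n * D j n x + (m n x j - m n x jstar) > 0)"
  unfolding whp_def
proof (intro allI impI)
  fix \<epsilon> :: real assume e: "\<epsilon> > 0"
  let ?j' = "j \<union> jstar"
  have j': "jstar \<subseteq> ?j'" "?j' \<subseteq> {..<k}" "jstar \<union> (?j' - jstar) = ?j'" using j jstar by auto
  obtain \<kappa> where \<kappa>: "\<kappa> > 0" "whp_level M (\<epsilon> / 3) (\<lambda>n x. det (V j n x) > 0 \<and>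
      D j n x \<ge> D ?j' n x + real g * ln (1 + real (p n) / (4 * \<kappa>)))"
    using D_underfit[OF j g _ G lim, of "\<epsilon> / 3"] e by auto
  obtain K where K: "whp_level M (\<epsilon> / 3) (\<lambda>n x. real n * D ?j' n x \<ge> - K)"
    using D_overfit_large_sample[OF p, of "?j' - jstar" "\<epsilon> / 3"] j' e finite_subset[OF j'(2)] by auto
  define \<delta> where "\<delta> = ln (1 + 1 / (4 * \<kappa>))"
  have \<delta>: "\<delta> > 0" unfolding \<delta>_def using \<kappa>(1) by (intro ln_gt_zero) simp
  have "ereal (- \<delta> / 2) < L" using \<delta> L by (intro less_le_trans[OF _ L]) simp
  then have 2: "whp M (\<lambda>n x. ereal ((m n x j - m n x jstar) / real n) \<in> {ereal (- \<delta> / 2)<..})"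
    by (intro whp_plim[OF pl]) auto
  have "(\<lambda>n. K / real n) \<longlonglongrightarrow> 0" by (rule lim_const_over_n)
  then have ev: "\<forall>\<^sub>F n in sequentially. K / real n < \<delta> / 2" using \<delta> by (intro order_tendstoD(2)) auto
  have "whp_level M (\<epsilon> / 3 + (\<epsilon> / 3 + \<epsilon> / 3)) (\<lambda>n x. det (V j n x) > 0 \<and> real n * D j n x + (m n x j - m n x jstar) > 0)"
  proof (rule whp_level_mono[OF whp_level_conj[OF ev_prob \<kappa>(2) whp_level_conj[OF ev_prob K whpD[OF 2]]]])
    show "\<forall>\<^sub>F n in sequentially. \<forall>x\<in>space (M n). (0 < det (V j n x) \<and>
      D ?j' n x + real g * ln (1 + real (p n) / (4 * \<kappa>)) \<le> D j n x) \<and>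
      - K \<le> real n * D ?j' n x \<and> ereal ((m n x j - m n x jstar) / real n) \<in> {ereal (- \<delta> / 2)<..} \<longrightarrow>
      0 < det (V j n x) \<and> 0 < real n * D j n x + (m n x j - m n x jstar)"
      using ev ev_p
    proof (eventually_elim, intro ballI impI, elim conjE, intro conjI)
      fix n x
      assume ev: "K / real n < \<delta> / 2" and p1: "1 \<le> p n" and n: "p n + k \<le> n"
        and a1: "D ?j' n x + real g * ln (1 + real (p n) / (4 * \<kappa>)) \<le> D j n x"
        and a2: "- K \<le> real n * D ?j' n x"
        and a3: "ereal ((m n x j - m n x jstar) / real n) \<in> {ereal (- \<delta> / 2)<..}"
      have n0: "real n > 0" using n p1 by auto
      have m: "m n x j - m n x jstar > - (real n * \<delta>) / 2" using a3 n0 by (simp add: field_simps)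
      have K': "K < real n * \<delta> / 2" using ev n0 by (simp add: field_simps)
      have "\<delta> \<le> ln (1 + real (p n) / (4 * \<kappa>))"
        unfolding \<delta>_def using p1 \<kappa>(1) by (intro ln_mono) (auto simp: field_simps add_pos_nonneg)
      also have "\<dots> \<le> real g * ln (1 + real (p n) / (4 * \<kappa>))"
        using g mult_right_mono[of 1 "real g" "ln (1 + real (p n) / (4 * \<kappa>))"] \<kappa>(1) by simp
      finally have "D ?j' n x + \<delta> \<le> D j n x" using a1 by linarith
      then have "real n * (D ?j' n x + \<delta>) \<le> real n * D j n x" using n0 by (intro mult_left_mono) auto
      then have "- K + real n * \<delta> \<le> real n * D j n x" using a2 by (simp add: distrib_left)
      then show "0 < real n * D j n x + (m n x j - m n x jstar)" using m K' by linarith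
    qed
  qed (use e in auto)
  then show "whp_level M \<epsilon> (\<lambda>n x. det (V j n x) > 0 \<and> real n * D j n x + (m n x j - m n x jstar) > 0)" by simp
qed

end

theorem theorem3p1:
  fixes M :: "nat \<Rightarrow> 'a measure"
    and Y :: "nat \<Rightarrow> 'a \<Rightarrow> real mat"
    and X \<Theta> \<Sigma> :: "nat \<Rightarrow> real mat"
    and k :: nat and p :: "nat \<Rightarrow> nat" and c0 :: real
    and J :: "nat set set" and jstar :: "nat set"
    and \<gamma> :: "nat set \<Rightarrow> nat"
    and \<Gamma> :: "nat \<Rightarrow> nat set \<Rightarrow> real mat"
    and m :: "nat \<Rightarrow> 'a \<Rightarrow> nat set \<Rightarrow> real"
    and jhat :: "nat \<Rightarrow> 'a \<Rightarrow> nat set"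
  defines "J_plus \<equiv> {j \<in> J. jstar \<subseteq> j}"
    and "J_minus \<equiv> {j \<in> J. \<not> jstar \<subseteq> j}"
  assumes cand: "J \<subseteq> Pow {..<k}" and true_model: "jstar \<subseteq> {..<k}"
    and p_pos: "\<And>n. n > k \<Longrightarrow> p n \<ge> 1"
    and p_mono: "mono_on {k<..} p"
    and c0: "0 \<le> c0" "c0 < 1"
    and p_over_n: "(\<lambda>n. real (p n) / real n) \<longlonglongrightarrow> c0"
    and X: "\<And>n. n > k \<Longrightarrow> X n \<in> carrier_mat n k" "\<And>n. n > k \<Longrightarrow> mat_rank (X n) = k"
    and Theta: "\<And>n. n > k \<Longrightarrow> \<Theta> n \<in> carrier_mat (card jstar) (p n)"
    and Sigma: "\<And>n. n > k \<Longrightarrow> pos_def (p n) (\<Sigma> n)"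
    and M: "\<And>n. n > k \<Longrightarrow> prob_space (M n)"
    and Y: "\<And>n. n > k \<Longrightarrow>
              matrix_normal (M n) n (p n) (Y n) (sub_cols (X n) jstar * \<Theta> n) (\<Sigma> n)"
    and m: "\<And>n j. n > k \<Longrightarrow> j \<in> J \<Longrightarrow> (\<lambda>x. m n x j) \<in> borel_measurable (M n)"
    and A1: "jstar \<in> J"
    and A2_rank: "\<And>j. j \<in> J_minus \<Longrightarrow> \<gamma> j > 0"
      "\<And>n j. n > k \<Longrightarrow> j \<in> J_minus \<Longrightarrow>
         mat_rank (noncentrality (X n) jstar (\<Theta> n) (\<Sigma> n) j) = \<gamma> j"
    and Gamma: "\<And>n j. n > k \<Longrightarrow> j \<in> J_minus \<Longrightarrow>
         full_rank_factor (p n) (\<gamma> j) (noncentrality (X n) jstar (\<Theta> n) (\<Sigma> n) j) (\<Gamma> n j)"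
    and A2_liminf: "\<And>j. j \<in> J_minus \<Longrightarrow>
         liminf (\<lambda>n. ereal (min_eigenvalue ((\<Gamma> n j)\<^sup>T * \<Gamma> n j) / (real n * real (p n)))) > 0"
    and penalty:
      "\<not> bdd_above (range p) \<and>
       (\<forall>j \<in> J_minus. \<exists>L. L > - ereal (real (\<gamma> j)) \<and>
          plim M (\<lambda>n x. (m n x j - m n x jstar) / (real n * ln (real (p n)))) L) \<and>
       (\<forall>j \<in> J_plus - {jstar}.
          \<exists>L. L > ereal (- (real (card j) - real (card jstar)) * log_ratio c0) \<and>
          plim M (\<lambda>n x. (m n x j - m n x jstar) / real (p n)) L)
       \<or>
       bdd_above (range p) \<and>
       (\<forall>j \<in> J_minus. \<exists>L. L \<ge> 0 \<and>
          plim M (\<lambda>n x. (m n x j - m n x jstar) / real n) L) \<and>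
       (\<forall>j \<in> J_plus - {jstar}. plim M (\<lambda>n x. m n x j - m n x jstar) \<infinity>)"
    and jhat_meas: "\<And>n. n > k \<Longrightarrow> jhat n \<in> measurable (M n) (count_space J)"
    and jhat_argmin: "\<And>n x. n > k \<Longrightarrow> x \<in> space (M n) \<Longrightarrow>
         is_arg_min (IC (X n) (Y n x) (m n x)) (\<lambda>j. j \<in> J) (jhat n x)"
  shows "(\<lambda>n. measure (M n) {x \<in> space (M n). jhat n x = jstar}) \<longlonglongrightarrow> 1"
proof -
  have evk: "\<forall>\<^sub>F n in sequentially. n > k" by (rule eventually_gt_at_top)
  \<comment> \<open>Because \<open>c0 < 1\<close>, eventually \<open>p + k \<le> n\<close>.\<close>
  have "(\<lambda>n. real (p n) / real n + real k / real n) \<longlonglongrightarrow> c0 + 0"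
    by (intro tendsto_add p_over_n lim_const_over_n)
  then have "\<forall>\<^sub>F n in sequentially. real (p n) / real n + real k / real n < 1"
    using c0 by (intro order_tendstoD(2)) auto
  then have evp: "\<forall>\<^sub>F n in sequentially. p n + k \<le> n"
    using evk by eventually_elim (auto simp: add_divide_distrib[symmetric] field_simps)
  let ?B = "\<lambda>n. sub_cols (X n) jstar * \<Theta> n"
  let ?E = "\<lambda>n. centred_rows n (p n) (Y n) (?B n)"
  let ?c = "\<lambda>n. (1 / sqrt ((2 * pi) ^ p n * det (\<Sigma> n))) ^ n"
  have reg: "\<forall>\<^sub>F n in sequentially. regression (M n) n (p n) (\<Sigma> n) (?E n) (?c n) k (X n) (Y n) jstar (\<Theta> n)"
    using evk evp
  proof eventually_elim
    case (elim n)
    have B: "?B n \<in> carrier_mat n (p n)"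
      using sub_cols_carrier[OF X(1)[OF elim(1)] true_model] Theta[OF elim(1)] by auto
    have Yc: "Y n x \<in> carrier_mat n (p n)" if "x \<in> space (M n)" for x
      using Y[OF elim(1)] that unfolding matrix_normal_def by blast
    have "gaussian_noise (M n) n (p n) (\<Sigma> n) (?E n) (?c n)"
      using elim by (intro matrix_normal_gaussian_noise M Sigma B Y) auto
    moreover have "design n k (X n)" using X elim(1) by unfold_locales auto
    moreover have "noise_mat n (p n) (?E n x) = Y n x - ?B n" if "x \<in> space (M n)" for x
      by (rule noise_mat_centred_rows[where Y = "Y n" and x = x, OF Yc[OF that] B])
    ultimately show ?case
      using elim true_model Theta p_pos Yc
      by (intro regression.intro regression_axioms.intro) auto
  qed
  interpret asymptotic M p \<Sigma> ?E ?c k X Y jstar \<Theta> c0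
    by unfold_locales (fact reg p_over_n c0 true_model)+
  have sub: "j \<subseteq> {..<k}" if "j \<in> J" for j using cand that by auto
  have finJ: "finite J" using cand by (rule finite_subset) simp
  have G: "\<forall>\<^sub>F n in sequentially. full_rank_factor (p n) (\<gamma> j) (noncentrality (X n) jstar (\<Theta> n) (\<Sigma> n) j) (\<Gamma> n j)"
    if "j \<in> J_minus" for j
    using evk by eventually_elim (rule Gamma[OF _ that])
  have key: "whp M (\<lambda>n x. det (V j n x) > 0 \<and> real n * D j n x + (m n x j - m n x jstar) > 0)"
    if j: "j \<in> J - {jstar}" for j
  proof -
    have jk: "j \<subseteq> {..<k}" using sub j by auto
    from penalty show ?thesis
    proof (elim disjE conjE)
      assume unb: "\<not> bdd_above (range p)"
        and m1: "\<forall>j\<in>J_minus. \<exists>L. L > - ereal (real (\<gamma> j)) \<and>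
          plim M (\<lambda>n x. (m n x j - m n x jstar) / (real n * ln (real (p n)))) L"
        and m2: "\<forall>j\<in>J_plus - {jstar}. \<exists>L. L > ereal (- (real (card j) - real (card jstar)) * log_ratio c0) \<and>
          plim M (\<lambda>n x. (m n x j - m n x jstar) / real (p n)) L"
      have p_top: "filterlim p at_top sequentially"
        unfolding filterlim_at_top eventually_sequentially
      proof
        fix Z
        \<comment> \<open>Monotonicity is given beyond \<open>k\<close> only; the finitely many
          earlier values cannot make the range unbounded.\<close>
        have "\<exists>N>k. p N \<ge> Z"
        proof (rule ccontr)
          assume "\<not> ?thesis"
          then have "p n \<le> max Z (Max (p ` {..k}))" for n
            by (cases "n \<le> k") (auto simp: le_max_iff_disj not_le intro: less_imp_le Max_ge)
          then show False using unb by (auto simp: bdd_above_def)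
        qed
        then obtain N where "N > k" "p N \<ge> Z" by auto
        then have "\<forall>n\<ge>N. Z \<le> p n" using p_mono unfolding mono_on_def by (auto intro: order.trans)
        then show "\<exists>N. \<forall>n\<ge>N. Z \<le> p n" by blast
      qed
      show ?thesis
      proof (cases "jstar \<subseteq> j")
        case True
        then have "j \<in> J_plus - {jstar}" using j unfolding J_plus_def by auto
        with m2 obtain L where L: "L > ereal (- (real (card j) - real (card jstar)) * log_ratio c0)"
          "plim M (\<lambda>n x. (m n x j - m n x jstar) / real (p n)) L" by blast
        show ?thesis by (rule overfit_high_dim[OF p_top True jk L])
      next
        case False
        then have jm: "j \<in> J_minus" using j unfolding J_minus_def by auto
        with m1 obtain L where L: "L > - ereal (real (\<gamma> j))"
          "plim M (\<lambda>n x. (m n x j - m n x jstar) / (real n * ln (real (p n)))) L" by blast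
        show ?thesis by (rule underfit_high_dim[OF p_top jk A2_rank(1)[OF jm] G[OF jm] A2_liminf[OF jm] L])
      qed
    next
      assume "bdd_above (range p)"
        and m1: "\<forall>j\<in>J_minus. \<exists>L. L \<ge> 0 \<and> plim M (\<lambda>n x. (m n x j - m n x jstar) / real n) L"
        and m2: "\<forall>j\<in>J_plus - {jstar}. plim M (\<lambda>n x. m n x j - m n x jstar) \<infinity>"
      then obtain P where P: "\<And>n. p n \<le> P" unfolding bdd_above_def by auto
      show ?thesis
      proof (cases "jstar \<subseteq> j")
        case True
        then have "plim M (\<lambda>n x. m n x j - m n x jstar) \<infinity>" using m2 j unfolding J_plus_def by auto
        then show ?thesis by (rule overfit_large_sample[OF P True jk])
      next
        case False
        then have jm: "j \<in> J_minus" using j unfolding J_minus_def by auto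
        with m1 obtain L where L: "L \<ge> 0" "plim M (\<lambda>n x. (m n x j - m n x jstar) / real n) L" by blast
        show ?thesis by (rule underfit_large_sample[OF P jk A2_rank(1)[OF jm] G[OF jm] A2_liminf[OF jm] L])
      qed
    qed
  qed
  have "whp M (\<lambda>n x. \<forall>j\<in>J - {jstar}. IC (X n) (Y n x) (m n x) jstar < IC (X n) (Y n x) (m n x) j)"
  proof (rule whp_ball[OF ev_prob])
    fix j assume j: "j \<in> J - {jstar}"
    show "whp M (\<lambda>n x. IC (X n) (Y n x) (m n x) jstar < IC (X n) (Y n x) (m n x) j)"
      by (rule whp_IC_less[OF _ key[OF j]]) (use sub j in auto)
  qed (use finJ in simp)
  \<comment> \<open>A strict inequality against every competitor leaves \<open>jstar\<close> as the
    only minimiser, so \<open>jhat\<close> has no choice.\<close>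
  then have "whp M (\<lambda>n x. jhat n x = jstar)"
  proof (rule whp_mono)
    show "\<forall>\<^sub>F n in sequentially. \<forall>x\<in>space (M n).
      (\<forall>j\<in>J - {jstar}. IC (X n) (Y n x) (m n x) jstar < IC (X n) (Y n x) (m n x) j) \<longrightarrow> jhat n x = jstar"
      using evk
    proof (eventually_elim, intro ballI impI)
      fix n x
      assume n: "k < n" and x: "x \<in> space (M n)"
        and less: "\<forall>j\<in>J - {jstar}. IC (X n) (Y n x) (m n x) jstar < IC (X n) (Y n x) (m n x) j"
      note am = jhat_argmin[OF n x]
      show "jhat n x = jstar"
      proof (rule ccontr)
        assume "jhat n x \<noteq> jstar"
        then have "jhat n x \<in> J - {jstar}" using am unfolding is_arg_min_def by simp
        then have "IC (X n) (Y n x) (m n x) jstar < IC (X n) (Y n x) (m n x) (jhat n x)" using less by blast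
        then show False using am A1 unfolding is_arg_min_def by blast
      qed
    qed
  qed
  \<comment> \<open>Measurability of \<open>jhat\<close> turns the inner probability of the final
    event into its probability.\<close>
  moreover have "\<forall>\<^sub>F n in sequentially. {x \<in> space (M n). jhat n x = jstar} \<in> sets (M n)"
    using evk
  proof eventually_elim
    case (elim n)
    have "jhat n -` {jstar} \<inter> space (M n) \<in> sets (M n)"
      using jhat_meas[OF elim] A1 by (intro measurable_sets) auto
    moreover have "jhat n -` {jstar} \<inter> space (M n) = {x \<in> space (M n). jhat n x = jstar}" by auto
    ultimately show ?case by simp
  qed
  ultimately show ?thesis by (rule whp_measure_tendsto[OF ev_prob])
qed

end
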